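(* Let $0<T<\infty$, $L>0$, $\lambda\in\{1,-1\}$, and let $q(x,t)$ be a sufficiently smooth solution of $$iq_t+q_{xx}-2\lambda|q|^2q=0,\qquad 0<x<L,\ 0<t<T,$$ with vanishing initial data $q(x,0)=q_0(x)=0$, $0\le x\le L$, and boundary values $g_0(t)=q(0,t)$, $h_0(t)=q(L,t)$, $g_1(t)=q_x(0,t)$, $h_1(t)=q_x(L,t)$. For the Dirichlet problem it is assumed that $g_0(t)$ and $h_0(t)$, $0\le t<T$, are sufficiently smooth and compatible with the initial data; for the Neumann problem it is assumed that $g_1(t)$ and $h_1(t)$, $0\le t<T$, are sufficiently smooth and compatible with the initial data. Then the spectral functions $A,B,\mathcal A,\mathcal B$ (defined in the context) are given, for $k\in\mathbb C$, by $$A(k)=\overline{\Phi_2(T,\bar k)},\quad B(k)=-\Phi_1(T,k)e^{4ik^2T},\quad \mathcal A(k)=\overline{\varphi_2(T,\bar k)},\quad \mathcal B(k)=-\varphi_1(T,k)e^{4ik^2T},$$ where the complex-valued functions $\Phi_1,\Phi_2,\varphi_1,\varphi_2$ satisfy, for $0<t<T$ and $k\in\mathbb C$, $$\Phi_1(t,k)=\int_0^te^{4ik^2(t'-t)}\big[-i\lambda|g_0|^2\Phi_1+(2kg_0+ig_1)\Phi_2\big](t',k)\,dt',$$ $$\Phi_2(t,k)=1+\lambda\int_0^t\big[(2k\bar g_0-i\bar g_1)\Phi_1+i|g_0|^2\Phi_2\big](t',k)\,dt',$$ $$\varphi_1(t,k)=\int_0^te^{4ik^2(t'-t)}\big[-i\lambda|h_0|^2\varphi_1+(2kh_0+ih_1)\varphi_2\big](t',k)\,dt',$$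 $$\varphi_2(t,k)=1+\lambda\int_0^t\big[(2k\bar h_0-i\bar h_1)\varphi_1+i|h_0|^2\varphi_2\big](t',k)\,dt'.$$ Moreover, for $0<t<T$: (a) For the Dirichlet problem, the unknown Neumann boundary values are given by $$\begin{aligned}g_1(t)=\frac{4}{\pi i}\int_{\partial D_3^0}\Big\{&\frac{\Sigma(k)}{2\Delta(k)}\big[k\Phi_{1-}(t,k)+ig_0(t)\big]-\frac{1}{\Delta(k)}\big[k\varphi_{1-}(t,k)+ih_0(t)\big]+\frac{g_0(t)}{4i}\varphi_{2-}(t,k)+\frac{ig_0(t)}{2}\Phi_{2-}(t,k)\\&+\frac{k}{\Delta(k)}\Big[(\overline{\varphi_2(t,\bar k)}-1)\Phi_1(t,k)e^{-2ikL}-\varphi_1(t,k)(\overline{\Phi_2(t,\bar k)}-1)\Big]_-\Big\}dk,\end{aligned}$$ $$\begin{aligned}h_1(t)=\frac{4}{\pi i}\int_{\partial D_3^0}\Big\{&-\frac{\Sigma(k)}{2\Delta(k)}\big[k\varphi_{1-}(t,k)+ih_0(t)\big]+\frac{1}{\Delta(k)}\big[k\Phi_{1-}(t,k)+ig_0(t)\big]+\frac{h_0(t)}{4i}\Phi_{2-}(t,k)+\frac{ih_0(t)}{2}\varphi_{2-}(t,k)\\&+\frac{k}{\Delta(k)}\Big[(\overline{\varphi_2(t,\bar k)}-1)\Phi_1(t,k)-\varphi_1(t,k)(\overline{\Phi_2(t,\bar k)}-1)e^{2ikL}\Big]_-\Big\}dk.\end{aligned}$$ (b) For the Neumann problem,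 the unknown Dirichlet boundary values are given by $$\begin{aligned}g_0(t)=\frac2\pi\int_{\partial D_3^0}\frac1{\Delta(k)}\Big\{&\frac{\Sigma(k)}2\Phi_{1+}(t,k)-\varphi_{1+}(t,k)\\&+\Big[\Phi_1(t,k)(\overline{\varphi_2(t,\bar k)}-1)e^{-2ikL}-(\overline{\Phi_2(t,\bar k)}-1)\varphi_1(t,k)\Big]_+\Big\}dk,\end{aligned}$$ $$\begin{aligned}h_0(t)=\frac2\pi\int_{\partial D_3^0}\frac1{\Delta(k)}\Big\{&-\frac{\Sigma(k)}2\varphi_{1+}(t,k)+\Phi_{1+}(t,k)\\&+\Big[(\overline{\varphi_2(t,\bar k)}-1)\Phi_1(t,k)-e^{2ikL}(\overline{\Phi_2(t,\bar k)}-1)\varphi_1(t,k)\Big]_+\Big\}dk.\end{aligned}$$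
   Context: Lax pair and eigenfunctions. Let $\sigma_3=\mathrm{diag}(1,-1)$, $\hat\sigma_3A=[\sigma_3,A]$ (so $e^{\hat\sigma_3}A=e^{\sigma_3}Ae^{-\sigma_3}$), $Q=\begin{pmatrix}0&q\\ \lambda\bar q&0\end{pmatrix}$, $\tilde Q=2kQ-i(Q_x+\lambda|q|^2)\sigma_3$. For a point $(x_j,t_j)$, let $\mu_j(x,t,k)$ be the $2\times2$ matrix solution of $$\mu_j(x,t,k)=I+\int_{(x_j,t_j)}^{(x,t)}e^{i(k(x'-x)+2k^2(t'-t))\hat\sigma_3}\big[(Q\,dx'+\tilde Q\,dt')\mu_j(x',t',k)\big],$$ where the one-form is closed, so that the integral is path independent, and $(x_1,t_1)=(0,T)$, $(x_2,t_2)=(0,0)$, $(x_3,t_3)=(L,0)$, $(x_4,t_4)=(L,T)$. Spectral functions: $A,B,\mathcal A,\mathcal B$ are the entire functions defined by $$\mu_1(0,0,k)=\begin{pmatrix}\overline{A(\bar k)}&B(k)\\ \lambda\overline{B(\bar k)}&A(k)\end{pmatrix},\qquad \mu_4(L,0,k)=\begin{pmatrix}\overline{\mathcal A(\bar k)}&\mathcal B(k)\\ \lambda\overline{\mathcal B(\bar k)}&\mathcal A(k)\end{pmatrix}.$$ The functions $\Phi_j,\varphi_j$ are defined by: $(\Phi_1,\Phi_2)^T$ is the second column of $\mu_2(0,t,k)$ and $(\varphi_1,\varphi_2)^T$ is the second column of $\mu_3(L,t,k)$. Notation. For a function $f$ of $k$ (possibly depending also on $t$): $f_+(k)=f(k)+f(-k)$,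 $f_-(k)=f(k)-f(-k)$; thus $\Phi_{j\pm}(t,k)=\Phi_j(t,k)\pm\Phi_j(t,-k)$, similarly $\varphi_{j\pm}$, and $[\,\cdot\,]_\pm$ is applied to the entire bracketed function of $k$. $\Delta(k)=e^{2ikL}-e^{-2ikL}$, $\Sigma(k)=e^{2ikL}+e^{-2ikL}$. Contours. $D_1,\dots,D_4$ are the four open quadrants of the complex $k$-plane. $\partial D_3$ is the boundary of $D_3$ oriented so that $D_3$ lies to its left (from $-i\infty$ to $0$, then to $-\infty$). $\partial D_3^0$ is the contour obtained by deforming $\partial D_3$ so that it passes below the zeros of $\Delta(k)$ in $(-\infty,0]$, i.e. below the set $\{-\frac{n\pi}{2L}: n=0,1,2,\dots\}$. Integrals along unbounded contours are understood as limits, as $R\to\infty$, of the integrals over the part of the contour in $|k|<R$. *)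

theory Defs
  imports "HOL-Analysis.Analysis"
begin

section \<open>Functions on the rectangle\<close>

definition rect :: "real \<Rightarrow> real \<Rightarrow> (real \<times> real) set" where
  "rect L T = {0..L} \<times> {0..T}"

text \<open>Partial derivatives on the closed rectangle; they are one-sided on its edges, so
  that \<open>dx L q 0 t\<close> and \<open>dx L q L t\<close> are the Neumann boundary values.\<close>

definition dx :: "real \<Rightarrow> (real \<Rightarrow> real \<Rightarrow> complex) \<Rightarrow> real \<Rightarrow> real \<Rightarrow> complex" where
  "dx L q x t = vector_derivative (\<lambda>y. q y t) (at x within {0..L})"

definition dt :: "real \<Rightarrow> (real \<Rightarrow> real \<Rightarrow> complex) \<Rightarrow> real \<Rightarrow> real \<Rightarrow> complex" where
  "dt T q x t = vector_derivative (\<lambda>s. q x s) (at t within {0..T})"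

text \<open>Class $C^n$ up to the boundary, corners included. For such a \<open>q\<close> the boundary functions
  $q(0,\cdot)$, $q(L,\cdot)$ are of class $C^n$ and $q_x(0,\cdot)$, $q_x(L,\cdot)$ of class
  $C^{n-1}$ on $[0,T]$, and their compatibility with the initial datum at the two corners
  $t=0$ is automatic.\<close>

primrec C_on_rect :: "nat \<Rightarrow> real \<Rightarrow> real \<Rightarrow> (real \<Rightarrow> real \<Rightarrow> complex) \<Rightarrow> bool" where
  "C_on_rect 0 L T q \<longleftrightarrow> continuous_on (rect L T) (\<lambda>(x, t). q x t)"
| "C_on_rect (Suc n) L T q \<longleftrightarrow>
     (\<forall>x\<in>{0..L}. \<forall>t\<in>{0..T}.
        (\<lambda>y. q y t) differentiable (at x within {0..L}) \<and>
        (\<lambda>s. q x s) differentiable (at t within {0..T})) \<and>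
     C_on_rect n L T (dx L q) \<and> C_on_rect n L T (dt T q)"

text \<open>``Sufficiently smooth'' is fixed as $C^6$ on the closed rectangle.\<close>

definition sufficiently_smooth :: "real \<Rightarrow> real \<Rightarrow> (real \<Rightarrow> real \<Rightarrow> complex) \<Rightarrow> bool" where
  "sufficiently_smooth L T q \<longleftrightarrow> C_on_rect 6 L T q"

definition nls_solution ::
    "real \<Rightarrow> real \<Rightarrow> complex \<Rightarrow> (real \<Rightarrow> real \<Rightarrow> complex) \<Rightarrow> bool" where
  "nls_solution L T lam q \<longleftrightarrow>
     (\<forall>x\<in>{0<..<L}. \<forall>t\<in>{0<..<T}.
        \<i> * dt T q x t + dx L (dx L q) x t
          - 2 * lam * complex_of_real ((cmod (q x t))\<^sup>2) * q x t = 0)"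

section \<open>Lax pair and eigenfunctions\<close>

definition mat2 :: "complex \<Rightarrow> complex \<Rightarrow> complex \<Rightarrow> complex \<Rightarrow> complex^2^2" where
  "mat2 a b c d = vector [vector [a, b], vector [c, d]]"

definition sigma3 :: "complex^2^2" where
  "sigma3 = mat2 1 0 0 (-1)"

text \<open>$e^{z\hat\sigma_3}A = e^{z\sigma_3}Ae^{-z\sigma_3}$\<close>

definition exp_sigma3_hat :: "complex \<Rightarrow> complex^2^2 \<Rightarrow> complex^2^2" where
  "exp_sigma3_hat z A = mat2 (exp z) 0 0 (exp (-z)) ** A ** mat2 (exp (-z)) 0 0 (exp z)"

text \<open>\<open>mat c\<close> is the scalar matrix $cI$; it is used to multiply matrices by complex scalars.\<close>

definition Qmat :: "complex \<Rightarrow> (real \<Rightarrow> real \<Rightarrow> complex) \<Rightarrow> real \<Rightarrow> real \<Rightarrow> complex^2^2" where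
  "Qmat lam q x t = mat2 0 (q x t) (lam * cnj (q x t)) 0"

definition Qtilde ::
    "real \<Rightarrow> complex \<Rightarrow> (real \<Rightarrow> real \<Rightarrow> complex) \<Rightarrow> complex \<Rightarrow> real \<Rightarrow> real \<Rightarrow> complex^2^2" where
  "Qtilde L lam q k x t =
     mat (2 * k) ** Qmat lam q x t
     - mat \<i> ** (Qmat lam (dx L q) x t + mat (lam * complex_of_real ((cmod (q x t))\<^sup>2))) ** sigma3"

text \<open>The line integral of $e^{i(k(x'-x)+2k^2(t'-t))\hat\sigma_3}[(Q\,dx'+\tilde Q\,dt')\mu]$
  along a path \<open>p\<close> in the rectangle; $(x,t)$ is the end point of the path.\<close>

definition lax_line_integral ::
    "real \<Rightarrow> complex \<Rightarrow> (real \<Rightarrow> real \<Rightarrow> complex) \<Rightarrow> (real \<Rightarrow> real \<Rightarrow> complex \<Rightarrow> complex^2^2) \<Rightarrow>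
     complex \<Rightarrow> real \<Rightarrow> real \<Rightarrow> (real \<Rightarrow> real \<times> real) \<Rightarrow> complex^2^2" where
  "lax_line_integral L lam q \<mu> k x t p =
     integral {0..1} (\<lambda>s.
       let x' = fst (p s); t' = snd (p s); v = vector_derivative p (at s within {0..1}) in
       exp_sigma3_hat (\<i> * (k * complex_of_real (x' - x) + 2 * k\<^sup>2 * complex_of_real (t' - t)))
         ((fst v *\<^sub>R Qmat lam q x' t' + snd v *\<^sub>R Qtilde L lam q k x' t') ** \<mu> x' t' k))"

text \<open>The solution of the Volterra equation normalised at $(x_0,t_0)$. The one-form being closed,
  the integral may be taken along any path from $(x_0,t_0)$ to $(x,t)$.\<close>

definition eigenfunction ::
    "real \<Rightarrow> real \<Rightarrow> complex \<Rightarrow> (real \<Rightarrow> real \<Rightarrow> complex) \<Rightarrow> real \<Rightarrow> real \<Rightarrow>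
     (real \<Rightarrow> real \<Rightarrow> complex \<Rightarrow> complex^2^2) \<Rightarrow> bool" where
  "eigenfunction L T lam q x0 t0 \<mu> \<longleftrightarrow>
     (\<forall>k. continuous_on (rect L T) (\<lambda>(x, t). \<mu> x t k)) \<and>
     (\<forall>k x t p. (x, t) \<in> rect L T \<longrightarrow>
        valid_path p \<longrightarrow> path_image p \<subseteq> rect L T \<longrightarrow>
        pathstart p = (x0, t0) \<longrightarrow> pathfinish p = (x, t) \<longrightarrow>
        \<mu> x t k = mat 1 + lax_line_integral L lam q \<mu> k x t p)"

section \<open>Notation in the spectral variable\<close>

definition plus_part :: "(complex \<Rightarrow> complex) \<Rightarrow> complex \<Rightarrow> complex" where
  "plus_part f k = f k + f (- k)"

definition minus_part :: "(complex \<Rightarrow> complex) \<Rightarrow> complex \<Rightarrow> complex" where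
  "minus_part f k = f k - f (- k)"

definition Delta :: "real \<Rightarrow> complex \<Rightarrow> complex" where
  "Delta L k = exp (2 * \<i> * k * complex_of_real L) - exp (- (2 * \<i> * k * complex_of_real L))"

definition Sigma_fun :: "real \<Rightarrow> complex \<Rightarrow> complex" where
  "Sigma_fun L k = exp (2 * \<i> * k * complex_of_real L) + exp (- (2 * \<i> * k * complex_of_real L))"

section \<open>The deformed contour\<close>

text \<open>A parametrisation \<open>\<gamma>\<close> of a contour obtained from the boundary of the third quadrant, run
  through from $-i\infty$ via a neighbourhood of $0$ to $-\infty$, by deforming it so as to pass
  below the zeros $-n\pi/(2L)$ of $\Delta$. A curve in the closed third quadrant that avoids these
  boundary points passes below them.

  The eigenfunctions contain the factor $e^{-4ik^2t}$, of modulus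
  $e^{8t\,\mathrm{Re}k\,\mathrm{Im}k}$, which stays bounded along the undeformed contour; the
  deformation has to preserve this, since the improper integrals diverge in general along, say,
  a horizontal line below the real axis. Hence the bound on
  $|\mathrm{Re}k\,\mathrm{Im}k|$: the contour approaches the real axis like $1/|k|$. The distance
  to the zeros is bounded below at the same rate. Lower semicircles of radius
  $\varepsilon/(n+1)$ about the zeros, with $\varepsilon>0$ small, and the real axis in between are
  allowed, as is the curve $k=-x-i\varepsilon/(1+x)$, $x\ge0$.\<close>

definition deformed_bdry_D3 :: "real \<Rightarrow> (real \<Rightarrow> complex) \<Rightarrow> bool" where
  "deformed_bdry_D3 L \<gamma> \<longleftrightarrow>
     (\<forall>a b. \<gamma> piecewise_C1_differentiable_on {a..b}) \<and>
     (\<forall>s. Re (\<gamma> s) \<le> 0 \<and> Im (\<gamma> s) \<le> 0) \<and>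
     (\<exists>r>0. (\<forall>s\<le>-r. \<gamma> s = \<i> * complex_of_real s) \<and> mono_on {r..} (\<lambda>s. cmod (\<gamma> s))) \<and>
     filterlim (\<lambda>s. Re (\<gamma> s)) at_bot at_top \<and>
     (\<exists>C. \<forall>s. \<bar>Re (\<gamma> s) * Im (\<gamma> s)\<bar> \<le> C) \<and>
     (\<exists>c>0. \<forall>s. \<forall>n::nat.
        c / (real n + 1) \<le> cmod (\<gamma> s - complex_of_real (- (real n * pi / (2 * L)))))"

text \<open>The integral over the part of the contour in $|k|<R$.\<close>

definition truncated_integral ::
    "(real \<Rightarrow> complex) \<Rightarrow> real \<Rightarrow> (complex \<Rightarrow> complex) \<Rightarrow> complex" where
  "truncated_integral \<gamma> R f =
     integral {s. cmod (\<gamma> s) < R} (\<lambda>s. f (\<gamma> s) * vector_derivative \<gamma> (at s))"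

text \<open>The improper integral converges, with value \<open>I\<close>.\<close>

definition has_improper_integral ::
    "(real \<Rightarrow> complex) \<Rightarrow> (complex \<Rightarrow> complex) \<Rightarrow> complex \<Rightarrow> bool" where
  "has_improper_integral \<gamma> f I \<longleftrightarrow> ((\<lambda>R. truncated_integral \<gamma> R f) \<longlongrightarrow> I) at_top"

end

theory Submission
  imports Defs "HOL-Complex_Analysis.Riemann_Mapping" "HOL-Real_Asymp.Real_Asymp"
begin

text \<open>Write \<open>f\<^sup>*(k)\<close> for the conjugate of \<open>f\<close> at the conjugate of \<open>k\<close>. As the initial datum vanishes,
  $\mu_2$ and $\mu_3$ coincide, so at a fixed time the \<open>x\<close>-part of the Lax pair connects
  $(\Phi_1,\Phi_2)$ with $(\varphi_1,\varphi_2)$, and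
  $c = \Phi_1\varphi_2^* - \Phi_2^*\varphi_1e^{2ikL}$ is an entry of the connection matrix; hence \<open>c\<close>
  is of exponential type in \<open>k\<close>. Expressed through \<open>c\<close>, every integrand is a sum of odd differences
  $G(k) - G(-k)$ of entire functions and of a part with poles at the zeros of $\Delta$. The former
  are integrated over arcs in the second and fourth quadrants, where the \<open>t\<close>-part of the Lax pair
  yields the behaviour of $\Phi_j$ and $\varphi_j$ for large \<open>k\<close>. The latter is integrated
  over an arc in the third quadrant; there the expansion of \<open>c\<close> follows from the one on the axes by
  the Phragmen-Lindelof principle, which applies because exponential type is of order one while the
  quadrant would admit any order below two. The formulas at \<open>x = L\<close> follow from those at
  \<open>x = 0\<close> by reflection of the interval.\<close>

section \<open>Functions of exponential type\<close>

text \<open>The factor exp (-4ik^2 t) has modulus exp (8t Re k Im k), so the expansions of Phi_j and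
  phi_j in powers of 1/k are uniform only where Re k Im k is bounded above. Inside the third
  quadrant the separate functions may grow with order two; only a combination determined by
  \<open>q\<close> on one line t = const, such as \<open>c\<close>, has order one there. This
  decides the splitting: whatever is not divided by Delta has to form odd differences, which can be
  moved to the good quadrants, and whatever is divided by Delta has to be expressed by
  \<open>c\<close>.

  With Phi_1 = g0/(2ik) + (g1/4 + g0 b/(2i))/k^2 + ..., Phi_2 = 1 + b/k + ... and phi_2 = 1 + beta/k
  + ..., each arc extracts a coefficient of 1/k. In the Dirichlet problem this coefficient is
  contaminated by g0 b and g0 beta, where b and beta are time integrals over the unknown boundary
  values; the terms with Phi_{2-} and phi_{2-} in the integrand cancel them. As Delta vanishes on
  the real axis, the arc for the part with poles depends on the rate 1/|k| at which the contour
  keeps away from the zeros.\<close>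

definition exp_type :: "(complex \<Rightarrow> complex) \<Rightarrow> bool" where
  "exp_type f \<longleftrightarrow> (\<exists>C. \<forall>k. cmod (f k) \<le> C * exp (C * cmod k))"

lemma exp_typeE:
  assumes "exp_type f"
  obtains C where "C \<ge> 0" "\<And>k. cmod (f k) \<le> C * exp (C * cmod k)"
proof -
  obtain C where C: "\<And>k. cmod (f k) \<le> C * exp (C * cmod k)" using assms unfolding exp_type_def by blast
  have "0 \<le> C * exp (C * cmod 0)" using C[of 0] norm_ge_zero order_trans by blast
  then have "C \<ge> 0" by simp
  then show ?thesis using that C by blast
qed

lemma exp_type_mult:
  assumes "exp_type f" "exp_type g"
  shows "exp_type (\<lambda>k. f k * g k)"
proof -
  obtain A where A: "A \<ge> 0" "\<And>k. cmod (f k) \<le> A * exp (A * cmod k)" using exp_typeE[OF assms(1)] by blast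
  obtain B where B: "B \<ge> 0" "\<And>k. cmod (g k) \<le> B * exp (B * cmod k)" using exp_typeE[OF assms(2)] by blast
  define C where "C = A * B + A + B"
  have C: "C \<ge> A * B" "C \<ge> A + B" "C \<ge> 0" using A B by (auto simp: C_def)
  have "cmod (f k * g k) \<le> C * exp (C * cmod k)" for k
  proof -
    have "cmod (f k * g k) \<le> (A * exp (A * cmod k)) * (B * exp (B * cmod k))"
      unfolding norm_mult using A B by (intro mult_mono) auto
    also have "\<dots> = (A * B) * exp ((A + B) * cmod k)" by (simp add: algebra_simps exp_add)
    also have "\<dots> \<le> C * exp (C * cmod k)" using C A B by (intro mult_mono) (auto intro!: mult_right_mono)
    finally show ?thesis .
  qed
  then show ?thesis unfolding exp_type_def by blast
qed

lemma exp_type_add: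
  assumes "exp_type f" "exp_type g"
  shows "exp_type (\<lambda>k. f k + g k)"
proof -
  obtain A where A: "A \<ge> 0" "\<And>k. cmod (f k) \<le> A * exp (A * cmod k)" using exp_typeE[OF assms(1)] by blast
  obtain B where B: "B \<ge> 0" "\<And>k. cmod (g k) \<le> B * exp (B * cmod k)" using exp_typeE[OF assms(2)] by blast
  have "cmod (f k + g k) \<le> (A + B) * exp ((A + B) * cmod k)" for k
  proof -
    have "cmod (f k + g k) \<le> A * exp (A * cmod k) + B * exp (B * cmod k)"
      using norm_triangle_le[OF add_mono[OF A(2) B(2)]] .
    also have "\<dots> \<le> A * exp ((A + B) * cmod k) + B * exp ((A + B) * cmod k)"
      using A B by (intro add_mono mult_left_mono) (auto intro!: mult_right_mono)
    finally show ?thesis by (simp add: algebra_simps)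
  qed
  then show ?thesis unfolding exp_type_def by blast
qed

lemma exp_type_const: "exp_type (\<lambda>k. c)"
  unfolding exp_type_def
proof (intro exI[of _ "cmod c"] allI)
  show "cmod c \<le> cmod c * exp (cmod c * cmod k)" for k
    using mult_left_mono[of 1 "exp (cmod c * cmod k)" "cmod c"] by simp
qed

lemma exp_type_ident: "exp_type (\<lambda>k. k)"
  unfolding exp_type_def
proof (intro exI[of _ 1] allI)
  show "cmod k \<le> 1 * exp (1 * cmod k)" for k
    using exp_ge_add_one_self[of "cmod k"] unfolding mult_1 by linarith
qed

lemma exp_type_exp: "exp_type (\<lambda>k. exp (c * k))"
  unfolding exp_type_def
proof (intro exI[of _ "max 1 (cmod c)"] allI)
  fix k
  have "Re (c * k) \<le> cmod c * cmod k" using complex_Re_le_cmod[of "c * k"] by (simp add: norm_mult)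
  also have "\<dots> \<le> max 1 (cmod c) * cmod k" by (intro mult_right_mono) auto
  finally have "cmod (exp (c * k)) \<le> 1 * exp (max 1 (cmod c) * cmod k)" by simp
  also have "\<dots> \<le> max 1 (cmod c) * exp (max 1 (cmod c) * cmod k)" by (intro mult_right_mono) auto
  finally show "cmod (exp (c * k)) \<le> max 1 (cmod c) * exp (max 1 (cmod c) * cmod k)" .
qed

lemma exp_type_compose_uminus: "exp_type f \<Longrightarrow> exp_type (\<lambda>k. f (- k))"
  unfolding exp_type_def by (metis norm_minus_cancel)

lemma exp_type_uminus: "exp_type f \<Longrightarrow> exp_type (\<lambda>k. - f k)"
  unfolding exp_type_def by simp

lemma exp_type_diff: "exp_type f \<Longrightarrow> exp_type g \<Longrightarrow> exp_type (\<lambda>k. f k - g k)"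
  using exp_type_add[of f "\<lambda>k. - g k"] exp_type_uminus by simp

lemma exp_type_power: "exp_type f \<Longrightarrow> exp_type (\<lambda>k. f k ^ n)"
  by (induction n) (auto intro: exp_type_const exp_type_mult)

lemmas exp_type_intros = exp_type_mult exp_type_add exp_type_const exp_type_ident exp_type_exp
  exp_type_compose_uminus exp_type_uminus exp_type_diff exp_type_power

section \<open>Phragmen-Lindelof principle in a quadrant\<close>

definition sector :: "complex set" where
  "sector = {w. \<bar>Im w\<bar> \<le> Re w}"

lemma sector_Arg:
  assumes "w \<in> sector" "w \<noteq> 0"
  shows "\<bar>Arg w\<bar> \<le> pi / 4"
proof -
  have re: "Re w > 0"
  proof (rule ccontr)
    assume "\<not> Re w > 0"
    with assms(1) have "Re w = 0 \<and> Im w = 0" by (auto simp: sector_def)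
    with assms(2) show False by (simp add: complex_eq_iff)
  qed
  then have A: "Arg w = arctan (Im w / Re w)" by (rule arg_conv_arctan)
  have "\<bar>Im w / Re w\<bar> \<le> 1" using assms(1) re by (simp add: sector_def)
  then have "- 1 \<le> Im w / Re w" "Im w / Re w \<le> 1" by linarith+
  then have "arctan (- 1) \<le> Arg w" "Arg w \<le> arctan 1" unfolding A arctan_le_iff .
  then show ?thesis unfolding arctan_minus arctan_one by linarith
qed

text \<open>The angle 3/2 Arg w stays within 3 pi/8 < pi/2, so the real part is a fixed fraction of
  the modulus. The exponent 3/2 lies between 1, the order of the functions to be damped, and 2,
  where a sector of opening pi/2 gives no positive lower bound.\<close>

lemma sector_powr_bound:
  assumes "w \<in> sector" "w \<noteq> 0"
  shows "cos (3 * pi / 8) * cmod w powr (3 / 2) \<le> Re (w powr (3 / 2))"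
proof -
  have "Re (w powr (3 / 2)) = cmod w powr (3 / 2) * cos (3 / 2 * Arg w)"
  proof -
    have "w powr (3 / 2) = exp (of_real (3 / 2) * Ln w)" using assms(2) by (simp add: powr_def)
    then have "Re (w powr (3 / 2)) = exp (3 / 2 * Re (Ln w)) * cos (3 / 2 * Im (Ln w))" by (simp add: Re_exp)
    then show ?thesis using assms(2) by (simp add: powr_def Arg_eq_Im_Ln)
  qed
  moreover have "cos (3 * pi / 8) \<le> cos (3 / 2 * Arg w)"
  proof -
    have "cos (3 / 2 * Arg w) = cos \<bar>3 / 2 * Arg w\<bar>" by (rule cos_abs_real[symmetric])
    moreover have "\<bar>3 / 2 * Arg w\<bar> \<le> 3 * pi / 8" using sector_Arg[OF assms] by (simp add: abs_mult)
    ultimately show ?thesis using cos_monotone_0_pi_le[of "\<bar>3 / 2 * Arg w\<bar>" "3 * pi / 8"] pi_gt_zero by simp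
  qed
  ultimately show ?thesis by (simp add: mult.commute mult_left_mono)
qed

text \<open>Damping by exp (-e (w+1)^(3/2)) beats exponential type on a large arc of the sector and
  has modulus at most 1 on the edges. The maximum modulus principle gives the bound for each e > 0;
  then e tends to 0.\<close>

lemma phragmen_lindelof_sector:
  assumes hol: "g holomorphic_on UNIV" and "exp_type g"
    and bd: "\<And>w. \<bar>Im w\<bar> = Re w \<Longrightarrow> cmod (g w) \<le> M"
    and w: "w \<in> sector"
  shows "cmod (g w) \<le> M"
proof -
  obtain C where C: "C \<ge> 0" "\<And>k. cmod (g k) \<le> C * exp (C * cmod k)" using exp_typeE[OF assms(2)] by blast
  have M: "M \<ge> 0" using bd[of 0] by (auto intro: order_trans[OF norm_ge_zero])
  define d where "d = cos (3 * pi / 8)"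
  have d: "d > 0" unfolding d_def by (rule cos_gt_zero) (use pi_gt_zero in auto)
  \<comment> \<open>The shift by 1 keeps the branch cut of \<open>powr\<close> away from the sector,
    whose vertex would otherwise lie on it.\<close>
  have shift: "w + 1 \<in> sector" "w + 1 \<noteq> 0" "Re (w + 1) > 0" "cmod w \<le> cmod (w + 1)" if "w \<in> sector" for w
  proof -
    have re: "Re w \<ge> 0" using that by (auto simp: sector_def)
    show "w + 1 \<in> sector" using that by (auto simp: sector_def)
    show r1: "Re (w + 1) > 0" using re by simp
    then show "w + 1 \<noteq> 0" by (metis less_irrefl zero_complex.sel(1))
    show "cmod w \<le> cmod (w + 1)" unfolding cmod_def
      by (rule real_sqrt_le_mono) (use re in \<open>simp add: power_mono\<close>)
  qed
  have main: "cmod (g w) * exp (- e * Re ((w + 1) powr (3/2))) \<le> M + \<eta>" if e: "e > 0" and eta: "\<eta> > 0" for e \<eta> :: real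
  proof -
    define u where "u z = g z * exp (- of_real e * (z + 1) powr (3 / 2))" for z
    have nu: "cmod (u z) = cmod (g z) * exp (- e * Re ((z + 1) powr (3/2)))" for z
      by (simp add: u_def norm_mult)
    have ub: "cmod (u z) \<le> C * exp (C * cmod z - e * d * cmod z powr (3/2))" if z: "z \<in> sector" for z
    proof -
      have "d * cmod z powr (3/2) \<le> d * cmod (z + 1) powr (3/2)"
        using shift(4)[OF z] d by (intro mult_left_mono powr_mono2) auto
      also have "\<dots> \<le> Re ((z + 1) powr (3/2))" unfolding d_def by (rule sector_powr_bound[OF shift(1,2)[OF z]])
      finally have "- e * Re ((z + 1) powr (3/2)) \<le> - (e * d * cmod z powr (3/2))" using e by (simp add: mult.assoc)
      then have "cmod (u z) \<le> (C * exp (C * cmod z)) * exp (- (e * d * cmod z powr (3/2)))"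
        unfolding nu using C by (intro mult_mono) auto
      then show ?thesis by (simp add: exp_diff exp_minus field_simps)
    qed
    \<comment> \<open>Provides a radius beyond \<open>cmod w\<close> at which the damped function is
      below \<open>\<eta>\<close> on the arc, so that only the two edges matter.\<close>
    have "((\<lambda>\<rho>::real. C * exp (C * \<rho> - (e * d) * \<rho> powr (3/2))) \<longlongrightarrow> 0) at_top"
      using e d C(1) by real_asymp
    then have "\<forall>\<^sub>F \<rho> in at_top. C * exp (C * \<rho> - (e * d) * \<rho> powr (3/2)) < \<eta>"
      using eta by (rule order_tendstoD)
    then have "\<exists>\<rho>. C * exp (C * \<rho> - (e * d) * \<rho> powr (3/2)) < \<eta> \<and> \<rho> > cmod w"
      using eventually_happens'[OF trivial_limit_at_top_linorder eventually_conj[OF _ eventually_gt_at_top[of "cmod w"]]] by blast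
    then obtain \<rho> where rho: "C * exp (C * \<rho> - (e * d) * \<rho> powr (3/2)) < \<eta>" "\<rho> > cmod w" by blast
    define S where "S = sector \<inter> cball 0 \<rho>"
    have cS: "closed sector" unfolding sector_def by (intro closed_Collect_le continuous_intros)
    have holu: "u holomorphic_on {z. Re z > -1}" unfolding u_def
      by (intro holomorphic_intros holomorphic_on_subset[OF hol]) (auto simp: complex_nonpos_Reals_iff)
    have Ssub: "S \<subseteq> {z. Re z > -1}" by (auto simp: S_def sector_def)
    have "cmod (u w) \<le> M + \<eta>"
    proof (rule maximum_modulus_frontier[of u S])
      have clS: "closed S" unfolding S_def by (intro closed_Int cS closed_cball)
      show "u holomorphic_on interior S" using holomorphic_on_subset[OF holu] Ssub interior_subset[of S] by blast
      show "continuous_on (closure S) u"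
        using holomorphic_on_imp_continuous_on[OF holomorphic_on_subset[OF holu Ssub]] clS by simp
      show "bounded S" unfolding S_def by (rule bounded_subset[OF bounded_cball]) auto
      show "w \<in> S" using w rho by (auto simp: S_def)
      fix z assume z: "z \<in> frontier S"
      then have zS: "z \<in> S" using clS frontier_subset_eq by blast
      then have zs: "z \<in> sector" by (simp add: S_def)
      have "z \<notin> interior S" using z by (simp add: frontier_def)
      have "\<bar>Im z\<bar> = Re z \<or> cmod z = \<rho>"
      proof (rule ccontr)
        assume "\<not> (\<bar>Im z\<bar> = Re z \<or> cmod z = \<rho>)"
        then have "z \<in> {w. \<bar>Im w\<bar> < Re w} \<inter> ball 0 \<rho>" using zS by (auto simp: S_def sector_def)
        moreover have "open ({w. \<bar>Im w\<bar> < Re w} \<inter> ball 0 \<rho>)"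
          by (intro open_Int open_ball open_Collect_less continuous_intros)
        moreover have "{w. \<bar>Im w\<bar> < Re w} \<inter> ball 0 \<rho> \<subseteq> S" by (auto simp: S_def sector_def)
        ultimately have "z \<in> interior S" by (meson interior_maximal subsetD)
        with \<open>z \<notin> interior S\<close> show False by simp
      qed
      then show "cmod (u z) \<le> M + \<eta>"
      proof
        assume b: "\<bar>Im z\<bar> = Re z"
        have "0 \<le> d * cmod (z + 1) powr (3/2)" using d by simp
        also have "\<dots> \<le> Re ((z + 1) powr (3/2))" unfolding d_def by (rule sector_powr_bound[OF shift(1,2)[OF zs]])
        finally have "exp (- e * Re ((z + 1) powr (3/2))) \<le> 1" using e by simp
        then have "cmod (u z) \<le> M * 1" unfolding nu using bd[OF b] M by (intro mult_mono) auto
        then show ?thesis using eta by simp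
      next
        assume "cmod z = \<rho>"
        then show ?thesis using ub[OF zs] rho M by simp
      qed
    qed
    then show ?thesis unfolding nu .
  qed
  show ?thesis
  proof (rule field_le_epsilon)
    fix \<eta> :: real assume eta: "\<eta> > 0"
    have "((\<lambda>e. cmod (g w) * exp (- e * Re ((w + 1) powr (3/2)))) \<longlongrightarrow> cmod (g w) * exp (- 0 * Re ((w + 1) powr (3/2)))) (at_right 0)"
      by (intro tendsto_intros)
    then show "cmod (g w) \<le> M + \<eta>"
      using main[OF _ eta] by (intro tendsto_upperbound[where F = "at_right (0::real)"]) (auto simp: eventually_at_right_less eventually_at_filter)
  qed
qed

lemma phragmen_lindelof_third_quadrant:
  assumes hol: "f holomorphic_on UNIV" and "exp_type f"
    and "\<And>x. x \<le> 0 \<Longrightarrow> cmod (f (of_real x)) \<le> M" "\<And>y. y \<le> 0 \<Longrightarrow> cmod (f (\<i> * of_real y)) \<le> M"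
    and k: "Re k \<le> 0" "Im k \<le> 0"
  shows "cmod (f k) \<le> M"
proof -
  \<comment> \<open>Multiplication by -1 - i turns the sector onto the third quadrant, its edges
    onto the two negative half-axes.\<close>
  define r where "r = Complex (-1) (-1)"
  have r: "cmod r \<le> 2" "r \<noteq> 0" unfolding r_def by (auto simp: complex_norm complex_eq_iff real_sqrt_le_iff[of 2 4, simplified])
  define g where "g w = f (r * w)" for w
  obtain C where C: "C \<ge> 0" "\<And>k. cmod (f k) \<le> C * exp (C * cmod k)" using exp_typeE[OF assms(2)] by blast
  have "exp_type g" unfolding exp_type_def
  proof (intro exI[of _ "2 * C"] allI)
    fix w
    have "cmod (g w) \<le> C * exp (C * cmod (r * w))" unfolding g_def by (rule C)
    also have "\<dots> \<le> (2 * C) * exp ((2 * C) * cmod w)"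
      using C r mult_right_mono[OF r(1), of "C * cmod w"] by (intro mult_mono) (auto simp: norm_mult algebra_simps)
    finally show "cmod (g w) \<le> (2 * C) * exp ((2 * C) * cmod w)" .
  qed
  moreover have "g holomorphic_on UNIV" unfolding g_def
    using holomorphic_on_compose[of "\<lambda>w. r * w" UNIV f] hol by (auto simp: o_def intro!: holomorphic_intros holomorphic_on_subset[OF hol])
  moreover have "cmod (g w) \<le> M" if "\<bar>Im w\<bar> = Re w" for w
  proof (cases "Im w \<ge> 0")
    case True
    then have "r * w = \<i> * of_real (- 2 * Re w)" using that by (simp add: r_def complex_eq_iff)
    then show ?thesis unfolding g_def using assms(4)[of "- 2 * Re w"] that True by simp
  next
    case False
    then have "r * w = of_real (- 2 * Re w)" using that by (simp add: r_def complex_eq_iff)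
    then show ?thesis unfolding g_def using assms(3)[of "- 2 * Re w"] that False by simp
  qed
  moreover have "k / r \<in> sector"
  proof -
    have "k / r = Complex ((- Re k - Im k) / 2) ((Re k - Im k) / 2)"
      using r(2) by (simp add: divide_eq_eq) (simp add: r_def complex_eq_iff field_simps)
    then show ?thesis using k by (auto simp: sector_def)
  qed
  ultimately have "cmod (g (k / r)) \<le> M" using phragmen_lindelof_sector by blast
  then show ?thesis using r(2) by (simp add: g_def)
qed

section \<open>Integrals along the deformed contour\<close>

lemma vector_derivative_bound:
  fixes f :: "real \<Rightarrow> complex"
  assumes "\<And>x. x \<in> {a..b} \<Longrightarrow> (f has_vector_derivative f' x) (at x within {a..b})"
    and "\<And>x. x \<in> {a..b} \<Longrightarrow> norm (f' x) \<le> B"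
    and "x \<in> {a..b}" "y \<in> {a..b}"
  shows "norm (f x - f y) \<le> B * \<bar>x - y\<bar>"
proof -
  have "norm (f x - f y) \<le> B * norm (x - y)"
  proof (rule differentiable_bound[of "{a..b}" f "\<lambda>x h. h *\<^sub>R f' x"])
    show "(f has_derivative (\<lambda>h. h *\<^sub>R f' x)) (at x within {a..b})" if "x \<in> {a..b}" for x
      using assms(1)[OF that] by (simp add: has_vector_derivative_def)
    show "onorm (\<lambda>h. h *\<^sub>R f' x) \<le> B" if "x \<in> {a..b}" for x
      using assms(2)[OF that] by (intro onorm_le) (simp add: mult.commute[of B] mult_left_mono)
  qed (use assms in auto)
  then show ?thesis by simp
qed

text \<open>On the circle dk/k = i d theta, so the term b/k contributes i b (t - s) exactly, and the
  remainder at most \<open>B\<close> times the arc length. The integral over the arc is phrased as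
  the increment of a primitive \<open>H\<close>.\<close>

lemma arc_bound:
  fixes H f :: "complex \<Rightarrow> complex"
  assumes "0 < R" "s \<le> t"
    and "\<And>\<theta>. \<theta> \<in> {s..t} \<Longrightarrow> (H has_field_derivative f (of_real R * cis \<theta>)) (at (of_real R * cis \<theta>))"
    and "\<And>\<theta>. \<theta> \<in> {s..t} \<Longrightarrow> norm (f (of_real R * cis \<theta>) - b / (of_real R * cis \<theta>)) \<le> B"
  shows "norm (H (of_real R * cis t) - H (of_real R * cis s) - \<i> * b * of_real (t - s)) \<le> B * R * (t - s)"
proof -
  define u where "u \<theta> = H (of_real R * cis \<theta>) - \<i> * b * of_real \<theta>" for \<theta>
  define u' where "u' \<theta> = \<i> * (of_real R * cis \<theta>) * (f (of_real R * cis \<theta>) - b / (of_real R * cis \<theta>))" for \<theta>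
  have cisd: "((\<lambda>\<theta>. of_real R * cis \<theta>) has_vector_derivative \<i> * (of_real R * cis \<theta>)) (at \<theta> within {s..t})" for \<theta>
    unfolding cis_conv_exp
    by (rule has_vector_derivative_real_field[THEN has_vector_derivative_at_within]) (auto intro!: derivative_eq_intros)
  have "norm (u t - u s) \<le> (B * R) * \<bar>t - s\<bar>"
  proof (rule vector_derivative_bound[of s t u u'])
    fix \<theta> assume th: "\<theta> \<in> {s..t}"
    have "((H \<circ> (\<lambda>\<theta>. of_real R * cis \<theta>)) has_vector_derivative (\<i> * (of_real R * cis \<theta>)) * f (of_real R * cis \<theta>)) (at \<theta> within {s..t})"
      by (rule field_vector_diff_chain_within[OF cisd]) (use assms(3)[OF th] in \<open>auto intro: has_field_derivative_at_within\<close>)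
    moreover have "((\<lambda>\<theta>. \<i> * b * of_real \<theta>) has_vector_derivative \<i> * b) (at \<theta> within {s..t})"
      by (rule has_vector_derivative_real_field[THEN has_vector_derivative_at_within]) (auto intro!: derivative_eq_intros)
    ultimately have "(u has_vector_derivative (\<i> * (of_real R * cis \<theta>)) * f (of_real R * cis \<theta>) - \<i> * b) (at \<theta> within {s..t})"
      unfolding u_def[abs_def] o_def by (rule has_vector_derivative_diff)
    moreover have "(\<i> * (of_real R * cis \<theta>)) * f (of_real R * cis \<theta>) - \<i> * b = u' \<theta>"
      using assms(1) by (simp add: u'_def field_simps)
    ultimately show "(u has_vector_derivative u' \<theta>) (at \<theta> within {s..t})" by simp
    have "norm (u' \<theta>) = R * norm (f (of_real R * cis \<theta>) - b / (of_real R * cis \<theta>))"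
      using assms(1) by (simp add: u'_def norm_mult)
    also have "\<dots> \<le> R * B" using assms(1) assms(4)[OF th] by (intro mult_left_mono) auto
    finally show "norm (u' \<theta>) \<le> B * R" by (simp add: mult.commute)
  qed (use assms in auto)
  then show ?thesis using assms by (simp add: u_def algebra_simps)
qed

text \<open>Jordan's inequality: sine is concave and lies above its chord from 0 to pi/2.\<close>

lemma sin_ge_linear:
  assumes "0 \<le> x" "x \<le> pi / 2"
  shows "2 / pi * x \<le> sin x"
proof -
  have "concave_on {0..pi} sin" 
    by (rule f''_le0_imp_concave[where f' = cos and f'' = "\<lambda>x. - sin x"]) (auto intro!: derivative_eq_intros sin_ge_zero)
  from concave_onD[OF this, of "x * 2 / pi" 0 "pi/2"] assms show ?thesis by (auto simp: field_simps)
qed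

text \<open>For small R the set |gamma| < R may be disconnected. Once R exceeds the maximum of
  |gamma| on the middle part, the monotonicity of |gamma| beyond \<open>r\<close> and the explicit
  half-axis before \<open>-r\<close> make it an interval.\<close>

lemma truncated_contour_interval:
  assumes "deformed_bdry_D3 L \<gamma>"
  obtains b where "\<And>S. \<forall>\<^sub>F R in at_top. b R \<ge> S"
    and "\<forall>\<^sub>F R in at_top. - R \<le> b R \<and> cmod (\<gamma> (b R)) = R \<and> \<gamma> (- R) = - \<i> * of_real R \<and>
           {s. cmod (\<gamma> s) < R} = {- R<..<b R}"
proof -
  from assms obtain r where r: "r > 0" "\<And>s. s \<le> - r \<Longrightarrow> \<gamma> s = \<i> * of_real s"
      "mono_on {r..} (\<lambda>s. cmod (\<gamma> s))"
    unfolding deformed_bdry_D3_def by auto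
  have lim: "filterlim (\<lambda>s. Re (\<gamma> s)) at_bot at_top" using assms unfolding deformed_bdry_D3_def by auto
  have cont: "continuous_on {a..b} \<gamma>" for a b
    using assms unfolding deformed_bdry_D3_def by (auto simp: piecewise_C1_differentiable_on_def)
  have contn: "continuous_on {a..b} (\<lambda>s. cmod (\<gamma> s))" for a b
    by (intro continuous_on_norm cont)
  have ge: "\<exists>s\<ge>S. cmod (\<gamma> s) \<ge> R" for R S
  proof -
    have "\<forall>\<^sub>F s in at_top. Re (\<gamma> s) \<le> - R \<and> s \<ge> S"
      using lim eventually_ge_at_top[of S] unfolding filterlim_at_bot by (auto intro: eventually_conj)
    then obtain s where "Re (\<gamma> s) \<le> - R" "s \<ge> S" using eventually_happens'[OF trivial_limit_at_top_linorder] by blast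
    moreover have "- Re (\<gamma> s) \<le> cmod (\<gamma> s)" using abs_Re_le_cmod[of "\<gamma> s"] by linarith
    ultimately show ?thesis by (intro exI[of _ s]) auto
  qed
  have bdd: "\<exists>M. \<forall>s\<in>{- r..S}. cmod (\<gamma> s) \<le> M" for S
    using compact_continuous_image[OF contn, of "-r" S] by (force dest!: compact_imp_bounded simp: bounded_iff)
  have ex: "\<exists>b\<ge>r. cmod (\<gamma> b) = R \<and> (\<forall>s\<ge>r. cmod (\<gamma> s) < R \<longleftrightarrow> s < b)" if R: "\<forall>s\<in>{- r..r}. cmod (\<gamma> s) < R" for R
  proof -
    obtain s1 where s1: "s1 \<ge> r" "cmod (\<gamma> s1) \<ge> R" using ge by blast
    \<comment> \<open>The modulus increases only weakly and may stay at R for a while; the right end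
      of the interval is the first parameter at which R is attained.\<close>
    define A where "A = {r..s1} \<inter> (\<lambda>s. cmod (\<gamma> s)) -` {R}"
    have "closed A" unfolding A_def by (intro continuous_closed_preimage contn) auto
    moreover have "bounded A" unfolding A_def by (rule bounded_subset[OF bounded_closed_interval[of r s1]]) auto
    ultimately have cA: "compact A" by (simp add: compact_eq_bounded_closed)
    have "\<exists>x. r \<le> x \<and> x \<le> s1 \<and> cmod (\<gamma> x) = R"
      by (rule IVT') (use R r s1 contn in \<open>auto intro!: less_imp_le\<close>)
    then have "A \<noteq> {}" by (auto simp: A_def)
    then obtain b where b: "b \<in> A" "\<And>x. x \<in> A \<Longrightarrow> b \<le> x" using compact_attains_inf[OF cA] by blast
    have "cmod (\<gamma> s) < R \<longleftrightarrow> s < b" if "s \<ge> r" for s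
    proof
      assume *: "cmod (\<gamma> s) < R"
      show "s < b"
      proof (rule ccontr)
        assume "\<not> s < b"
        then have "cmod (\<gamma> b) \<le> cmod (\<gamma> s)" using b(1) that r(3) by (auto simp: A_def mono_on_def)
        with * b(1) show False by (auto simp: A_def)
      qed
    next
      assume *: "s < b"
      have "cmod (\<gamma> s) \<le> cmod (\<gamma> b)" using b(1) that r(3) * by (auto simp: A_def mono_on_def)
      moreover have "cmod (\<gamma> s) \<noteq> R" using b(2)[of s] * b(1) that by (auto simp: A_def)
      ultimately show "cmod (\<gamma> s) < R" using b(1) by (auto simp: A_def)
    qed
    then show ?thesis using b(1) by (auto simp: A_def)
  qed
  define b where "b R = (SOME b. b \<ge> r \<and> cmod (\<gamma> b) = R \<and> (\<forall>s\<ge>r. cmod (\<gamma> s) < R \<longleftrightarrow> s < b))" for R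
  have b: "b R \<ge> r \<and> cmod (\<gamma> (b R)) = R \<and> (\<forall>s\<ge>r. cmod (\<gamma> s) < R \<longleftrightarrow> s < b R)"
    if "\<forall>s\<in>{- r..r}. cmod (\<gamma> s) < R" for R
    unfolding b_def using ex[OF that] by (rule someI2_ex) auto
  obtain M where M: "\<And>s. s\<in>{- r..r} \<Longrightarrow> cmod (\<gamma> s) \<le> M" using bdd by blast
  have evM: "\<forall>\<^sub>F R in at_top. R > max M r" by (rule eventually_gt_at_top)
  show ?thesis
  proof (rule that[of b])
    fix S
    obtain M' where M': "\<And>s. s\<in>{- r..S} \<Longrightarrow> cmod (\<gamma> s) \<le> M'" using bdd by blast
    show "\<forall>\<^sub>F R in at_top. b R \<ge> S"
      using evM eventually_gt_at_top[of M']
    proof eventually_elim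
      case (elim R)
      then have "\<forall>s\<in>{- r..r}. cmod (\<gamma> s) < R" using M by force
      note bR = b[OF this]
      show ?case
      proof (rule ccontr)
        assume "\<not> S \<le> b R"
        then have "b R \<in> {-r..S}" using bR r by auto
        from M'[OF this] bR elim show False by auto
      qed
    qed
  next
    show "\<forall>\<^sub>F R in at_top. - R \<le> b R \<and> cmod (\<gamma> (b R)) = R \<and> \<gamma> (- R) = - \<i> * of_real R \<and>
           {s. cmod (\<gamma> s) < R} = {- R<..<b R}"
      using evM
    proof eventually_elim
      case (elim R)
      then have RR: "\<forall>s\<in>{- r..r}. cmod (\<gamma> s) < R" using M by force
      note bR = b[OF this]
      have iff: "cmod (\<gamma> s) < R \<longleftrightarrow> - R < s \<and> s < b R" for s
      proof -
        consider "s \<le> - r" | "s \<in> {-r..r}" | "s \<ge> r" by fastforce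
        then show ?thesis
        proof cases
          case 1
          then show ?thesis using r bR by (auto simp: norm_mult)
        next
          case 2
          then have "s < b R" if "s \<noteq> r" using that bR by auto
          moreover have "r < b R" using RR bR r(1) by auto
          ultimately show ?thesis using 2 RR elim by auto
        next
          case 3
          then show ?thesis using bR elim r(1) by auto
        qed
      qed
      have "{s. cmod (\<gamma> s) < R} = {- R<..<b R}" unfolding iff by (rule set_eqI) simp
      moreover have "\<gamma> (- R) = - \<i> * of_real R" using r(2)[of "-R"] elim by auto
      moreover have "- R \<le> b R" using bR elim r(1) by linarith
      ultimately show ?case using bR by blast
    qed
  qed
qed

text \<open>From here on the curve enters only through the angle \<open>\<psi>\<close> of its end
  point. The hyperbolic bound on Re k Im k makes this angle O(1/R^2), the end point inherits the
  distance from the zeros, and an integrand with a primitive near the curve is integrated by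
  evaluating the primitive at both ends.\<close>

lemma truncated_contour_end:
  assumes "deformed_bdry_D3 L \<gamma>"
  obtains \<psi> :: "real \<Rightarrow> real" and D c where "D > 0" "c > 0"
    and "\<forall>\<^sub>F R in at_top. 0 \<le> \<psi> R \<and> \<psi> R \<le> D / R\<^sup>2 \<and>
      (\<forall>n::nat. c / (real n + 1) \<le> cmod (- of_real R * cis (\<psi> R) - of_real (- (real n * pi / (2 * L))))) \<and>
      (\<forall>f H U. open U \<longrightarrow> range \<gamma> \<subseteq> U \<longrightarrow> (\<forall>z\<in>U. (H has_field_derivative f z) (at z)) \<longrightarrow>
          truncated_integral \<gamma> R f = H (- of_real R * cis (\<psi> R)) - H (- \<i> * of_real R))"
proof -
  obtain b where b1: "\<And>S. \<forall>\<^sub>F R in at_top. b R \<ge> S"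
    and b2: "\<forall>\<^sub>F R in at_top. - R \<le> b R \<and> cmod (\<gamma> (b R)) = R \<and> \<gamma> (- R) = - \<i> * of_real R \<and>
           {s. cmod (\<gamma> s) < R} = {- R<..<b R}"
    using truncated_contour_interval[OF assms] by blast
  have lim: "filterlim (\<lambda>s. Re (\<gamma> s)) at_bot at_top" using assms unfolding deformed_bdry_D3_def by auto
  have quad: "Re (\<gamma> s) \<le> 0" "Im (\<gamma> s) \<le> 0" for s using assms unfolding deformed_bdry_D3_def by auto
  obtain C where C: "\<And>s. \<bar>Re (\<gamma> s) * Im (\<gamma> s)\<bar> \<le> C" using assms unfolding deformed_bdry_D3_def by auto
  have C0: "C \<ge> 0" using C[of 0] by linarith
  obtain c where c: "c > 0" "\<And>s n. c / (real n + 1) \<le> cmod (\<gamma> s - of_real (- (real n * pi / (2 * L))))"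
    using assms unfolding deformed_bdry_D3_def by blast
  define \<psi> where "\<psi> R = arcsin (- Im (\<gamma> (b R)) / R)" for R
  \<comment> \<open>\<open>\<psi> R \<le> pi / 2 * sin (\<psi> R)\<close> and sin psi at most 2C/R^2
    give the constant pi C; the additional pi makes \<open>D\<close> positive.\<close>
  define D where "D = pi * (C + 1)"
  have "\<forall>\<^sub>F s in at_top. Re (\<gamma> s) \<le> - (C + 1)" using lim unfolding filterlim_at_bot by auto
  then obtain S where S: "\<And>s. s \<ge> S \<Longrightarrow> Re (\<gamma> s) \<le> - (C + 1)" unfolding eventually_at_top_linorder by blast
  have "\<forall>\<^sub>F R in at_top. 0 \<le> \<psi> R \<and> \<psi> R \<le> D / R\<^sup>2 \<and>
      (\<forall>n::nat. c / (real n + 1) \<le> cmod (- of_real R * cis (\<psi> R) - of_real (- (real n * pi / (2 * L))))) \<and>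
      (\<forall>f H U. open U \<longrightarrow> range \<gamma> \<subseteq> U \<longrightarrow> (\<forall>z\<in>U. (H has_field_derivative f z) (at z)) \<longrightarrow>
          truncated_integral \<gamma> R f = H (- of_real R * cis (\<psi> R)) - H (- \<i> * of_real R))"
    using b2 b1[of S] eventually_gt_at_top[of 2]
  proof eventually_elim
    case (elim R)
    define X Y where "X = - Re (\<gamma> (b R))" and "Y = - Im (\<gamma> (b R))"
    \<comment> \<open>Since X Y is at most C, this size of X forces Y to be at most 1 and, as R > 2,
      X to be at least R/2.\<close>
    have X: "X \<ge> C + 1" using S[of "b R"] elim by (auto simp: X_def)
    have Y: "Y \<ge> 0" using quad[of "b R"] by (auto simp: Y_def)
    have XY: "X * Y \<le> C" using C[of "b R"] by (auto simp: X_def Y_def)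
    have R2: "X\<^sup>2 + Y\<^sup>2 = R\<^sup>2" using elim by (auto simp: X_def Y_def cmod_power2[symmetric])
    have "(C + 1) * Y \<le> X * Y" using X Y by (intro mult_right_mono) auto
    then have "(C + 1) * Y \<le> (C + 1) * 1" using XY by simp
    then have Y1: "Y \<le> 1" using C0 by simp
    then have "Y\<^sup>2 \<le> 1" using Y by (simp add: power_le_one)
    moreover have "R\<^sup>2 \<ge> 2 * 2" unfolding power2_eq_square using elim by (intro mult_mono) auto
    ultimately have "X\<^sup>2 \<ge> (R/2)\<^sup>2" using R2 by (simp add: power_divide)
    then have XR: "X \<ge> R / 2" by (rule power2_le_imp_le) (use X C0 in auto)
    have "Y * (R/2) \<le> Y * X" using XR Y by (intro mult_left_mono) auto
    then have YR: "Y \<le> 2 * C / R" using XY elim by (simp add: field_simps)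
    have YleR: "Y \<le> R" using Y1 elim by simp
    have sinpsi: "sin (\<psi> R) = Y / R" unfolding \<psi>_def Y_def[symmetric]
      by (rule sin_arcsin) (use Y YleR elim in \<open>auto simp: field_simps intro: order_trans[of "-1" 0]\<close>)
    have cospsi: "cos (\<psi> R) = X / R"
    proof -
      have "cos (\<psi> R) = sqrt (1 - (Y/R)\<^sup>2)" unfolding \<psi>_def Y_def[symmetric]
        by (rule cos_arcsin) (use Y YleR elim in \<open>auto simp: field_simps intro: order_trans[of "-1" 0]\<close>)
      also have "1 - (Y/R)\<^sup>2 = (X/R)\<^sup>2" using R2 elim by (simp add: field_simps)
      finally show ?thesis using XR elim by simp
    qed
    have gb: "\<gamma> (b R) = - of_real R * cis (\<psi> R)"
      using sinpsi cospsi elim by (auto simp: complex_eq_iff X_def Y_def)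
    have psi0: "0 \<le> \<psi> R" unfolding \<psi>_def Y_def[symmetric] using Y elim YleR arcsin_le_arcsin[of 0 "Y/R"] by simp
    have psi1: "\<psi> R \<le> pi / 2" unfolding \<psi>_def Y_def[symmetric] using Y elim YleR by (intro arcsin_ubound) (auto intro: order_trans[of "-1" 0])
    have "\<psi> R \<le> D / R\<^sup>2"
    proof -
      have "\<psi> R \<le> pi / 2 * sin (\<psi> R)"
      proof -
        have "sin (\<psi> R) \<ge> 2 / pi * \<psi> R" by (rule sin_ge_linear[OF psi0 psi1])
        then show ?thesis by (simp add: field_simps)
      qed
      also have "\<dots> \<le> pi / 2 * ((2 * C / R) / R)" unfolding sinpsi using YR elim by (intro mult_left_mono divide_right_mono) auto
      also have "\<dots> = pi * C / R\<^sup>2" by (simp add: power2_eq_square)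
      also have "\<dots> \<le> D / R\<^sup>2" unfolding D_def by (intro divide_right_mono mult_left_mono) auto
      finally show ?thesis .
    qed
    moreover have "truncated_integral \<gamma> R f = H (- of_real R * cis (\<psi> R)) - H (- \<i> * of_real R)"
      if U: "open U" "range \<gamma> \<subseteq> U" "\<forall>z\<in>U. (H has_field_derivative f z) (at z)" for f H U
    proof -
      have "\<gamma> piecewise_C1_differentiable_on {-R..b R}" using assms unfolding deformed_bdry_D3_def by auto
      then obtain F where F: "finite F" "\<gamma> C1_differentiable_on ({-R..b R} - F)" and cg: "continuous_on {-R..b R} \<gamma>"
        unfolding piecewise_C1_differentiable_on_def by auto
      obtain g' where g': "\<And>x. x \<in> {-R..b R} - F \<Longrightarrow> (\<gamma> has_vector_derivative g' x) (at x)"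
        using F(2) unfolding C1_differentiable_on_def by blast
      have contH: "continuous_on U H"
        using U(3) by (meson DERIV_isCont continuous_at_imp_continuous_on)
      have "((\<lambda>s. f (\<gamma> s) * vector_derivative \<gamma> (at s)) has_integral (H \<circ> \<gamma>) (b R) - (H \<circ> \<gamma>) (- R)) {-R..b R}"
      proof (rule fundamental_theorem_of_calculus_interior_strong[OF F(1)])
        show "- R \<le> b R" using elim by auto
        show "continuous_on {- R..b R} (H \<circ> \<gamma>)"
          by (rule continuous_on_compose[OF cg]) (use contH U(2) in \<open>auto intro: continuous_on_subset\<close>)
        fix x assume x: "x \<in> {-R<..<b R} - F"
        then have d: "(\<gamma> has_vector_derivative vector_derivative \<gamma> (at x)) (at x)"
          using g'[of x] by (auto simp: vector_derivative_at)
        have "(H has_field_derivative f (\<gamma> x)) (at (\<gamma> x))" using U by auto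
        then show "((H \<circ> \<gamma>) has_vector_derivative f (\<gamma> x) * vector_derivative \<gamma> (at x)) (at x)"
          using field_vector_diff_chain_at[OF d] by (simp add: mult.commute)
      qed
      then have "integral {-R<..<b R} (\<lambda>s. f (\<gamma> s) * vector_derivative \<gamma> (at s)) = H (\<gamma> (b R)) - H (\<gamma> (- R))"
        by (simp add: integral_open_interval_real[symmetric] integral_unique)
      then show ?thesis using elim gb by (simp add: truncated_integral_def)
    qed
    ultimately show ?case using psi0 c(2)[of _ "b R"] unfolding gb by auto
  qed
  moreover have "D > 0" using C0 by (simp add: D_def)
  ultimately show ?thesis using that c(1) by blast
qed

text \<open>The plane cut vertically upwards from the zeros of $\Delta$. It contains the contour and is
  simply connected, so the part of the integrand with poles has a primitive on it.\<close>

definition slit_plane :: "real \<Rightarrow> complex set" where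
  "slit_plane L = {k. Im k < 0 \<or> sin (2 * L * Re k) \<noteq> 0}"

lemma open_slit_plane: "open (slit_plane L)"
  unfolding slit_plane_def by (intro open_Collect_disj open_Collect_less open_Collect_neq continuous_intros)

text \<open>Vertical rays do both halves: downward rays stay in the set and reach the lower
  half-plane, so the set is connected; upward rays from its complement stay in the complement, so no
  component of the complement is bounded.\<close>

lemma slit_plane_simply_connected: "simply_connected (slit_plane L)"
proof -
  define V where "V z = (\<lambda>y. Complex (Re z) y) ` {..Im z}" for z :: complex
  have conV: "connected (V z)" for z
    unfolding V_def Complex_eq by (intro connected_continuous_image continuous_intros) auto
  have "connected (\<Union>z\<in>slit_plane L. V z \<union> {k. Im k < 0})"
  proof (rule connected_Union)
    fix S assume "S \<in> (\<lambda>z. V z \<union> {k. Im k < 0}) ` slit_plane L"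
    then obtain z where z: "S = V z \<union> {k. Im k < 0}" by auto
    have "Complex (Re z) (min (Im z) (-1)) \<in> V z \<inter> {k. Im k < 0}" unfolding V_def by auto
    then show "connected S" unfolding z
      by (intro connected_Un conV convex_connected convex_halfspace_Im_lt) blast
  next
    have "- \<i> \<in> \<Inter> ((\<lambda>z. V z \<union> {k. Im k < 0}) ` slit_plane L)" by auto
    then show "\<Inter> ((\<lambda>z. V z \<union> {k. Im k < 0}) ` slit_plane L) \<noteq> {}" by blast
  qed
  also have "(\<Union>z\<in>slit_plane L. V z \<union> {k. Im k < 0}) = slit_plane L"
  proof
    show "(\<Union>z\<in>slit_plane L. V z \<union> {k. Im k < 0}) \<subseteq> slit_plane L" by (auto simp: V_def slit_plane_def)
    show "slit_plane L \<subseteq> (\<Union>z\<in>slit_plane L. V z \<union> {k. Im k < 0})"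
    proof
      fix z assume "z \<in> slit_plane L"
      moreover have "z \<in> V z" unfolding V_def by (rule image_eqI[of _ _ "Im z"]) auto
      ultimately show "z \<in> (\<Union>z\<in>slit_plane L. V z \<union> {k. Im k < 0})" by blast
    qed
  qed
  finally have "connected (slit_plane L)" .
  moreover have "\<not> bounded C" if C: "C \<in> components (- slit_plane L)" for C
  proof
    assume b: "bounded C"
    obtain z where z: "z \<in> C" using in_components_nonempty[OF C] by blast
    define W where "W = (\<lambda>y. Complex (Re z) y) ` {Im z..}"
    have "z \<in> - slit_plane L" using in_components_subset[OF C] z by blast
    then have WS: "W \<subseteq> - slit_plane L" by (auto simp: W_def slit_plane_def)
    have conW: "connected W" unfolding W_def Complex_eq by (intro connected_continuous_image continuous_intros) auto
    have "z \<in> W" unfolding W_def by (rule image_eqI[of _ _ "Im z"]) auto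
    then have "W \<subseteq> C" using components_maximal[OF C conW WS] z by blast
    then have "bounded W" using b bounded_subset by blast
    then obtain M where M: "\<And>w. w \<in> W \<Longrightarrow> cmod w \<le> M" unfolding bounded_iff by blast
    have "Complex (Re z) (max (Im z) (M + 1)) \<in> W" by (auto simp: W_def)
    from M[OF this] have "max (Im z) (M + 1) \<le> M" using abs_Im_le_cmod[of "Complex (Re z) (max (Im z) (M + 1))"] by simp
    then show False by simp
  qed
  ultimately show ?thesis using simply_connected_eq_unbounded_complement_components[OF open_slit_plane] by blast
qed

text \<open>In the closed third quadrant the slit plane omits just the zeros -n pi/(2L), and the
  contour keeps a positive distance from each of them.\<close>

lemma contour_in_slit_plane:
  assumes "deformed_bdry_D3 L \<gamma>" "0 < L"
  shows "range \<gamma> \<subseteq> slit_plane L"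
proof -
  have "\<gamma> s \<in> slit_plane L" for s
  proof (rule ccontr)
    assume "\<gamma> s \<notin> slit_plane L"
    moreover have quad: "Re (\<gamma> s) \<le> 0" "Im (\<gamma> s) \<le> 0" using assms unfolding deformed_bdry_D3_def by auto
    ultimately have im: "Im (\<gamma> s) = 0" and "sin (2 * L * Re (\<gamma> s)) = 0" by (auto simp: slit_plane_def)
    then obtain n :: int where n: "2 * L * Re (\<gamma> s) = of_int n * pi" unfolding sin_zero_iff_int2 by blast
    have "of_int n * pi \<le> 0" unfolding n[symmetric] using assms(2) quad by (simp add: mult_nonneg_nonpos)
    then have "n \<le> 0" using pi_gt_zero by (simp add: mult_le_0_iff)
    then have "Re (\<gamma> s) = - (real (nat (- n)) * pi / (2 * L))" using n assms(2) by (simp add: field_simps)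
    then have "cmod (\<gamma> s - of_real (- (real (nat (- n)) * pi / (2 * L)))) = 0"
      using im by (simp add: complex_eq_iff)
    moreover obtain c where c: "c > 0" "\<And>s n. c / (real n + 1) \<le> cmod (\<gamma> s - of_real (- (real n * pi / (2 * L))))"
      using assms unfolding deformed_bdry_D3_def by blast
    ultimately have "c / (real (nat (- n)) + 1) \<le> 0" by metis
    then show False using c(1) by (simp add: divide_le_0_iff)
  qed
  then show ?thesis by auto
qed

text \<open>|sin w|^2 = sin^2 (Re w) + sinh^2 (Im w). The first sine is at least half its argument
  by Jordan's inequality and 2/pi > 1/2, the second at least half its argument by convexity of
  exp.\<close>

lemma norm_sin_ge:
  fixes w :: complex
  assumes "\<bar>Re w\<bar> \<le> pi / 2"
  shows "cmod w / 2 \<le> cmod (sin w)"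
proof (rule power2_le_imp_le)
  define x y where "x = \<bar>Re w\<bar>" and "y = \<bar>Im w\<bar>"
  have y0: "y \<ge> 0" and x0: "x \<ge> 0" by (auto simp: x_def y_def)
  have c: "cos (2 * Re w) = 1 - 2 * (sin x)\<^sup>2"
    by (auto simp: x_def cos_double_sin abs_if)
  have e: "exp (2 * Im w) + inverse (exp (2 * Im w)) = (exp y - exp (- y))\<^sup>2 + 2"
  proof (cases "Im w \<ge> 0")
    case True then show ?thesis
      by (simp add: y_def power2_eq_square algebra_simps exp_minus[symmetric] exp_add[symmetric])
  next
    case False then show ?thesis
      by (simp add: y_def power2_eq_square algebra_simps exp_minus[symmetric] exp_add[symmetric])
  qed
  have "(cmod (sin w))\<^sup>2 = (sin x)\<^sup>2 + ((exp y - exp (- y)) / 2)\<^sup>2"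
    unfolding norm_sin_squared e c by (simp add: power_divide field_simps)
  moreover have "sin x \<ge> x / 2"
  proof -
    have "x / 2 \<le> 2 / pi * x" using mult_right_mono[OF less_imp_le[OF pi_less_4] x0] by (simp add: field_simps)
    then show ?thesis using sin_ge_linear[of x] assms x0 by (simp add: x_def)
  qed
  then have "(x / 2)\<^sup>2 \<le> (sin x)\<^sup>2" using x0 by (intro power_mono) auto
  moreover have "exp y - exp (- y) \<ge> y" using exp_ge_add_one_self[of y] y0 by (smt (verit) exp_le_one_iff)
  then have "(y / 2)\<^sup>2 \<le> ((exp y - exp (- y)) / 2)\<^sup>2" using y0 by (intro power_mono) auto
  moreover have "(cmod w / 2)\<^sup>2 = (x/2)\<^sup>2 + (y/2)\<^sup>2" by (simp add: power_divide x_def y_def cmod_power2)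
  ultimately show "(cmod w / 2)\<^sup>2 \<le> (cmod (sin w))\<^sup>2" by linarith
qed auto

text \<open>1 - exp (-4ikL) is exp (-2ikL) Delta(k), the normalisation of Delta that tends to 1 as
  Im k tends to minus infinity.\<close>

lemma one_minus_exp_lower_far:
  assumes "0 < L" "Im k \<le> - d"
  shows "1 - exp (- (4 * L * d)) \<le> cmod (1 - exp (- (4 * \<i> * k * of_real L)))"
proof -
  have "cmod (exp (- (4 * \<i> * k * of_real L))) = exp (4 * L * Im k)" by (simp add: mult.commute)
  also have "\<dots> \<le> exp (- (4 * L * d))" using mult_left_mono[OF assms(2), of "4 * L"] assms(1) by simp
  finally have "cmod (exp (- (4 * \<i> * k * of_real L))) \<le> exp (- (4 * L * d))" .
  then show ?thesis using norm_triangle_ineq2[of 1 "exp (- (4 * \<i> * k * of_real L))"] unfolding norm_one by linarith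
qed

text \<open>Up to an exponential factor the function is a sine, whose modulus is unchanged by
  translation to the nearest zero. The assumed distance c/(n+1) from that zero is at least of size
  1/|k|, because n grows at most linearly in |k|.\<close>

lemma one_minus_exp_lower_near:
  assumes "0 < L" "0 < c"
  obtains c1 where "c1 > 0"
    and "\<And>k. Im k \<le> 0 \<Longrightarrow> - 1 \<le> Im k \<Longrightarrow> Re k \<le> 0 \<Longrightarrow> 1 \<le> cmod k \<Longrightarrow>
      (\<And>n::nat. c / (real n + 1) \<le> cmod (k - of_real (- (real n * pi / (2 * L))))) \<Longrightarrow>
      c1 / cmod k \<le> cmod (1 - exp (- (4 * \<i> * k * of_real L)))"
proof
  \<comment> \<open>\<open>2 * L * c\<close> comes from the scaling w = 2Lk + n pi,
    \<open>exp (- (2 * L))\<close> from |exp (-2ikL)| for Im k at least -1, and the denominator from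
    \<open>real n + 1 \<le> (2 * L / pi + 2) * cmod k\<close>.\<close>
  define c1 where "c1 = 2 * L * c * exp (- (2 * L)) / (2 * L / pi + 2)"
  show "c1 > 0" using assms by (simp add: c1_def add_pos_pos)
  fix k assume k: "Im k \<le> 0" "- 1 \<le> Im k" "Re k \<le> 0" "1 \<le> cmod k"
    and z: "\<And>n::nat. c / (real n + 1) \<le> cmod (k - of_real (- (real n * pi / (2 * L))))"
  \<comment> \<open>Index of the zero -m pi/(2L) nearest to Re k; it is nonnegative because Re k is
    not positive.\<close>
  define m where "m = round (- (2 * L * Re k / pi))"
  have "0 \<le> - (2 * L * Re k / pi)" using k assms by (simp add: mult_nonneg_nonpos divide_nonpos_pos)
  then have "0 \<le> - (2 * L * Re k / pi) + 1 / 2" by linarith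
  then have m0: "m \<ge> 0" unfolding m_def round_def zero_le_floor .
  define n where "n = nat m"
  have nm: "real n = of_int m" using m0 by (simp add: n_def)
  have mr: "\<bar>of_int m - (- (2 * L * Re k / pi))\<bar> \<le> 1/2" unfolding m_def by (rule of_int_round_abs_le)
  define w where "w = 2 * of_real L * k + of_real (real n * pi)"
  have "Re w = pi * (of_int m - (- (2 * L * Re k / pi)))" by (simp add: w_def nm field_simps)
  then have rw: "\<bar>Re w\<bar> \<le> pi / 2" using mr by (simp add: abs_mult)
  have wk: "w = 2 * of_real L * (k - of_real (- (real n * pi / (2 * L))))" using assms by (simp add: w_def field_simps)
  have "real n \<le> 2 * L * \<bar>Re k\<bar> / pi + 1/2" proof -
    have "real n \<le> - (2 * L * Re k / pi) + 1/2" using mr unfolding nm by linarith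
    also have "- (2 * L * Re k / pi) = 2 * L * \<bar>Re k\<bar> / pi" using k by simp
    finally show ?thesis .
  qed
  also have "2 * L * \<bar>Re k\<bar> / pi \<le> 2 * L / pi * cmod k" using assms abs_Re_le_cmod[of k] by (simp add: divide_right_mono)
  finally have n1: "real n + 1 \<le> (2 * L / pi + 2) * cmod k" using k by (simp add: algebra_simps)
  have "2 * L * c / ((2 * L / pi + 2) * cmod k) \<le> 2 * L * (c / (real n + 1))"
    using n1 assms by (simp add: divide_left_mono)
  also have "\<dots> \<le> 2 * L * cmod (k - of_real (- (real n * pi / (2 * L))))"
    using z[of n] assms(1) by (intro mult_left_mono) auto
  also have "\<dots> = cmod w" unfolding wk using assms(1) by (simp add: norm_mult)
  finally have wl: "2 * L * c / ((2 * L / pi + 2) * cmod k) \<le> cmod w" .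
  have "sin w = sin (2 * of_real L * k) * of_real (cos (real n * pi)) + cos (2 * of_real L * k) * of_real (sin (real n * pi))"
    unfolding w_def sin_add by (simp only: sin_of_real cos_of_real)
  then have "cmod (sin w) = cmod (sin (2 * of_real L * k))" by (simp add: norm_mult norm_power)
  then have sl: "2 * L * c / ((2 * L / pi + 2) * cmod k) / 2 \<le> cmod (sin (2 * of_real L * k))"
    using norm_sin_ge[OF rw] wl by simp
  have "1 - exp (- (4 * \<i> * k * of_real L)) = exp (- (2 * \<i> * k * of_real L)) * (2 * \<i> * sin (2 * of_real L * k))"
    by (simp add: sin_exp_eq field_simps exp_add[symmetric] exp_diff[symmetric] mult_exp_exp)
  then have "cmod (1 - exp (- (4 * \<i> * k * of_real L))) = exp (2 * L * Im k) * (2 * cmod (sin (2 * of_real L * k)))"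
    by (simp add: norm_mult mult.commute)
  also have "\<dots> \<ge> exp (- (2 * L)) * (2 * (2 * L * c / ((2 * L / pi + 2) * cmod k) / 2))"
    using sl k assms mult_left_mono[OF k(2), of L] by (intro mult_mono) (auto intro!: divide_nonneg_nonneg add_nonneg_nonneg mult_nonneg_nonneg)
  also have "exp (- (2 * L)) * (2 * (2 * L * c / ((2 * L / pi + 2) * cmod k) / 2)) = c1 / cmod k"
    by (simp add: c1_def)
  finally show "c1 / cmod k \<le> cmod (1 - exp (- (4 * \<i> * k * of_real L)))" .
qed

text \<open>The condition \<open>Re k * Im k \<le> K\<close> describes where exp (-4ik^2 t) stays
  bounded for t in [0, T]: for K at least 0 the closed second and fourth quadrants together with
  hyperbolic collars along the axes, in which the ends of the contour lie. It is invariant under k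
  -> -k.\<close>

definition strip_bound :: "real \<Rightarrow> nat \<Rightarrow> (complex \<Rightarrow> complex) \<Rightarrow> bool" where
  "strip_bound K n f \<longleftrightarrow> (\<exists>M. \<forall>k. 1 \<le> cmod k \<longrightarrow> Re k * Im k \<le> K \<longrightarrow> cmod (f k) \<le> M / cmod k ^ n)"

lemma strip_boundE:
  assumes "strip_bound K n f"
  obtains M where "\<And>k. 1 \<le> cmod k \<Longrightarrow> Re k * Im k \<le> K \<Longrightarrow> cmod (f k) \<le> M / cmod k ^ n"
  using assms unfolding strip_bound_def by blast

lemma strip_boundI:
  assumes "\<And>k. 1 \<le> cmod k \<Longrightarrow> Re k * Im k \<le> K \<Longrightarrow> cmod (f k) \<le> M / cmod k ^ n"
  shows "strip_bound K n f"
  using assms unfolding strip_bound_def by blast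

lemma strip_bound_cong:
  assumes "\<And>k. k \<noteq> 0 \<Longrightarrow> f k = g k"
  shows "strip_bound K n f \<longleftrightarrow> strip_bound K n g"
proof -
  have "f k = g k" if "1 \<le> cmod k" for k by (rule assms) (use that in auto)
  then show ?thesis unfolding strip_bound_def by simp
qed

lemma strip_bound_reflect:
  assumes "strip_bound K n f"
  shows "strip_bound K n (\<lambda>k. f (- k))" "strip_bound K n (\<lambda>k. - f (- k))"
proof -
  obtain M where M: "\<And>k. 1 \<le> cmod k \<Longrightarrow> Re k * Im k \<le> K \<Longrightarrow> cmod (f k) \<le> M / cmod k ^ n"
    using strip_boundE[OF assms] by blast
  have b: "cmod (f (- k)) \<le> M / cmod k ^ n" "cmod (- f (- k)) \<le> M / cmod k ^ n" if "1 \<le> cmod k" "Re k * Im k \<le> K" for k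
    using M[of "- k"] that by simp_all
  show "strip_bound K n (\<lambda>k. f (- k))" by (rule strip_boundI[OF b(1)])
  show "strip_bound K n (\<lambda>k. - f (- k))" by (rule strip_boundI[OF b(2)])
qed

lemma strip_bound_lower:
  assumes "strip_bound K (Suc n) f" "0 \<le> K"
  shows "strip_bound K n (\<lambda>k. k * f k)" "strip_bound K n f"
proof -
  obtain M where M: "\<And>k. 1 \<le> cmod k \<Longrightarrow> Re k * Im k \<le> K \<Longrightarrow> cmod (f k) \<le> M / cmod k ^ Suc n"
    using strip_boundE[OF assms(1)] by blast
  have kf: "cmod (k * f k) \<le> M / cmod k ^ n" if k: "1 \<le> cmod k" "Re k * Im k \<le> K" for k
  proof -
    have "cmod k * cmod (f k) \<le> cmod k * (M / cmod k ^ Suc n)" by (intro mult_left_mono M k) auto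
    also have "\<dots> = M / cmod k ^ n" using k by auto
    finally show ?thesis by (simp add: norm_mult)
  qed
  then show "strip_bound K n (\<lambda>k. k * f k)" by (rule strip_boundI)
  have "cmod (f k) \<le> M / cmod k ^ n" if k: "1 \<le> cmod k" "Re k * Im k \<le> K" for k
    using kf[OF k] mult_right_mono[OF k(1), of "cmod (f k)"] by (simp add: norm_mult)
  then show "strip_bound K n f" by (rule strip_boundI)
qed

lemma strip_bound_add_inverse_power:
  assumes "strip_bound K n f"
  shows "strip_bound K n (\<lambda>k. f k + c / k ^ n)"
proof -
  obtain M where M: "\<And>k. 1 \<le> cmod k \<Longrightarrow> Re k * Im k \<le> K \<Longrightarrow> cmod (f k) \<le> M / cmod k ^ n"
    using strip_boundE[OF assms] by blast
  have "cmod (f k + c / k ^ n) \<le> (M + cmod c) / cmod k ^ n" if k: "1 \<le> cmod k" "Re k * Im k \<le> K" for k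
    unfolding add_divide_distrib using M[OF k] by (intro norm_triangle_le add_mono) (auto simp: norm_divide norm_power)
  then show ?thesis by (rule strip_boundI)
qed

text \<open>The integral of $G(-k)$ is an integral of \<open>G\<close> along the reflected contour. The four end points
  of the two contours are joined crosswise by arcs in the second and fourth quadrants, so that the
  constant \<open>a\<close> cancels.\<close>

lemma odd_difference_limit:
  fixes \<psi> :: "real \<Rightarrow> real" and G :: "complex \<Rightarrow> complex"
  assumes "D > 0" and ev: "\<forall>\<^sub>F R in at_top. 0 \<le> \<psi> R \<and> \<psi> R \<le> D / R\<^sup>2"
    and hol: "G holomorphic_on UNIV"
    and asy: "strip_bound D 2 (\<lambda>k. G k - (a + b / k))"
  obtains H where "\<And>z. (H has_field_derivative G z - G (- z)) (at z)"
    and "((\<lambda>R. H (- of_real R * cis (\<psi> R)) - H (- \<i> * of_real R)) \<longlongrightarrow> \<i> * of_real pi * b) at_top"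
proof -
  obtain M where bnd: "\<And>k. 1 \<le> cmod k \<Longrightarrow> Re k * Im k \<le> D \<Longrightarrow> cmod (G k - (a + b / k)) \<le> M / (cmod k)\<^sup>2"
    using strip_boundE[OF asy] by blast
  obtain H0 where H0: "\<And>z. (H0 has_field_derivative G z) (at z)"
    using holomorphic_convex_primitive'[OF convex_UNIV open_UNIV hol] by auto
  \<comment> \<open>A primitive of the odd difference. Its increment is that of \<open>H0\<close>
    over the contour plus that over the reflected contour.\<close>
  define H where "H z = H0 z + H0 (- z)" for z
  have "M \<ge> 0" using bnd[of "1"] assms(1) by (auto intro: order_trans[OF norm_ge_zero])
  have d: "(H has_field_derivative G z - G (- z)) (at z)" for z
  proof -
    have "((\<lambda>z. H0 (- z)) has_field_derivative G (- z) * (- 1)) (at z)"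
      by (rule DERIV_chain2[OF H0]) (auto intro!: derivative_eq_intros)
    from DERIV_add[OF H0 this] show ?thesis unfolding H_def by simp
  qed
  \<comment> \<open>Removing \<open>a\<close> leaves an integrand of order 1/k on the arcs. The
    correction \<open>a * z\<close> is odd and therefore drops out of \<open>H\<close>.\<close>
  define H1 where "H1 z = H0 z - a * z" for z
  have H1: "(H1 has_field_derivative G z - a) (at z)" for z
    unfolding H1_def by (auto intro!: derivative_eq_intros H0)
  define K where "K = 2 * M * (D + pi / 2) + 2 * D * cmod b"
  have "\<forall>\<^sub>F R in at_top. norm ((H (- of_real R * cis (\<psi> R)) - H (- \<i> * of_real R)) - \<i> * of_real pi * b) \<le> K / R"
    using ev eventually_ge_at_top[of 1]
  proof eventually_elim
    case (elim R)
    then have R: "R \<ge> 1" and psi: "0 \<le> \<psi> R" "\<psi> R \<le> D / R\<^sup>2" by auto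
    have "R \<le> R\<^sup>2" using R by (simp add: power2_eq_square)
    then have psiR: "\<psi> R \<le> D / R" using psi(2) R \<open>D > 0\<close>
      by (intro order_trans[OF psi(2) divide_left_mono]) auto
    \<comment> \<open>The arcs overshoot the fourth and the second quadrant by the angle psi. As psi
      is at most D/R^2, Re k Im k stays below D on the overshoot, still within the region of the
      expansion.\<close>
    have reg: "Re (of_real R * cis \<theta>) * Im (of_real R * cis \<theta>) \<le> D" if "- pi / 2 \<le> \<theta>" "\<theta> \<le> \<psi> R" for \<theta>
    proof -
      have "sin \<theta> * cos \<theta> \<le> D / R\<^sup>2"
      proof (cases "\<theta> \<ge> 0")
        case True
        have "sin \<theta> * cos \<theta> \<le> \<bar>sin \<theta>\<bar> * \<bar>cos \<theta>\<bar>" by (simp add: abs_mult[symmetric])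
        also have "\<dots> \<le> \<theta> * 1" using abs_sin_le_one abs_cos_le_one abs_sin_x_le_abs_x[of \<theta>] True by (intro mult_mono) auto
        finally show ?thesis using psi that by linarith
      next
        case False
        then have "sin \<theta> \<le> 0" using that sin_ge_zero[of "- \<theta>"] pi_gt_zero by simp
        moreover have "cos \<theta> \<ge> 0" using that False by (intro cos_ge_zero) (auto intro: order_trans[OF _ less_imp_le[OF pi_half_gt_zero]])
        ultimately have "sin \<theta> * cos \<theta> \<le> 0" by (rule mult_nonpos_nonneg)
        moreover have "0 \<le> D / R\<^sup>2" using \<open>D > 0\<close> by simp
          ultimately show ?thesis by linarith
      qed
      then have "R\<^sup>2 * (sin \<theta> * cos \<theta>) \<le> R\<^sup>2 * (D / R\<^sup>2)" by (intro mult_left_mono) auto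
      then show ?thesis using R by (simp add: power2_eq_square mult_ac)
    qed
    have regm: "Re (of_real R * cis \<theta>) * Im (of_real R * cis \<theta>) \<le> D" if "pi / 2 \<le> \<theta>" "\<theta> \<le> pi + \<psi> R" for \<theta>
      using reg[of "\<theta> - pi"] that by simp
    have nR: "cmod (of_real R * cis \<theta>) = R" for \<theta> using R by (simp add: norm_mult)
    have psi': "- pi / 2 \<le> \<psi> R" using psi by (auto intro: order_trans[of _ 0])
    have e1: "norm (H1 (of_real R * cis (\<psi> R)) - H1 (of_real R * cis (- pi / 2)) - \<i> * b * of_real (\<psi> R - (- pi / 2)))
        \<le> M / R^2 * R * (\<psi> R - (- pi / 2))"
    proof (rule arc_bound[where f = "\<lambda>k. G k - a"])
      show "cmod (G (of_real R * cis \<theta>) - a - b / (of_real R * cis \<theta>)) \<le> M / R^2" if "\<theta> \<in> {- pi / 2..\<psi> R}" for \<theta>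
        using bnd[of "of_real R * cis \<theta>"] reg[of \<theta>] that R nR[of \<theta>] by (simp add: algebra_simps)
    qed (use R psi' H1 in auto)
    have e2: "norm (H1 (of_real R * cis (pi + \<psi> R)) - H1 (of_real R * cis (pi / 2)) - \<i> * b * of_real (pi + \<psi> R - (pi / 2)))
        \<le> M / R^2 * R * (pi + \<psi> R - (pi / 2))"
    proof (rule arc_bound[where f = "\<lambda>k. G k - a"])
      show "cmod (G (of_real R * cis \<theta>) - a - b / (of_real R * cis \<theta>)) \<le> M / R^2" if "\<theta> \<in> {pi / 2..pi + \<psi> R}" for \<theta>
        using bnd[of "of_real R * cis \<theta>"] regm[of \<theta>] that R nR[of \<theta>] by (simp add: algebra_simps)
      show "pi / 2 \<le> pi + \<psi> R" using psi by (simp add: add_increasing2)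
    qed (use R H1 in auto)
    have c1: "cis (- pi / 2) = - \<i>" "cis (pi / 2) = \<i>" "cis (pi + \<psi> R) = - cis (\<psi> R)"
      by (auto simp: complex_eq_iff)
    define X1 X2 where "X1 = H1 (of_real R * cis (\<psi> R)) - H1 (of_real R * cis (- pi / 2)) - \<i> * b * of_real (\<psi> R - (- pi / 2))"
      and "X2 = H1 (of_real R * cis (pi + \<psi> R)) - H1 (of_real R * cis (pi / 2)) - \<i> * b * of_real (pi + \<psi> R - (pi / 2))"
    \<comment> \<open>The two arcs together span the angle pi + 2 psi; the excess is the last
      summand, which vanishes in the limit.\<close>
    have "(H (- of_real R * cis (\<psi> R)) - H (- \<i> * of_real R)) - \<i> * of_real pi * b = X1 + X2 + 2 * \<i> * b * of_real (\<psi> R)"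
      unfolding X1_def X2_def c1 H_def H1_def by (simp add: algebra_simps)
    also have "norm \<dots> \<le> norm X1 + norm X2 + norm (2 * \<i> * b * of_real (\<psi> R))"
      by (intro order_trans[OF norm_triangle_ineq] add_mono norm_triangle_ineq order_refl)
    also have "\<dots> \<le> M / R * (\<psi> R + pi / 2) + M / R * (\<psi> R + pi / 2) + 2 * cmod b * \<psi> R"
    proof -
      have "norm X1 \<le> M / R * (\<psi> R + pi / 2)" "norm X2 \<le> M / R * (\<psi> R + pi / 2)"
        using e1 e2 R unfolding X1_def[symmetric] X2_def[symmetric] by (simp_all add: power2_eq_square add.commute)
      then show ?thesis using psi by (simp add: norm_mult)
    qed
    also have "\<dots> \<le> M / R * (D + pi / 2) + M / R * (D + pi / 2) + 2 * cmod b * (D / R)"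
    proof -
      have "D / R \<le> D" using R \<open>D > 0\<close> by (simp add: field_simps)
      then have "\<psi> R \<le> D" using psiR by linarith
      then show ?thesis using psiR \<open>M \<ge> 0\<close> R by (intro add_mono mult_left_mono) auto
    qed
    also have "\<dots> = K / R" using R by (simp add: K_def field_simps)
    finally show ?case .
  qed
  then have "((\<lambda>R. (H (- of_real R * cis (\<psi> R)) - H (- \<i> * of_real R)) - \<i> * of_real pi * b) \<longlongrightarrow> 0) at_top"
    by (rule Lim_null_comparison) real_asymp
  from that[OF d LIM_zero_cancel[OF this]] show ?thesis .
qed

text \<open>The ends of the contour are joined by one arc in the third quadrant, of angle -pi/2 up
  to O(1/R^2). Near the real axis the denominator can be of size 1/R, so the arc is cut at the angle
  1/R: the near piece has length at most 1 and an error O(1/R) in the integrand, and on the far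
  piece the denominator is bounded below.\<close>

lemma pole_part_limit:
  fixes \<psi> :: "real \<Rightarrow> real" and f :: "complex \<Rightarrow> complex"
  assumes "L > 0" "D > 0" "c > 0"
    and ev: "\<forall>\<^sub>F R in at_top. 0 \<le> \<psi> R \<and> \<psi> R \<le> D / R\<^sup>2 \<and>
      (\<forall>n::nat. c / (real n + 1) \<le> cmod (- of_real R * cis (\<psi> R) - of_real (- (real n * pi / (2 * L)))))"
    and hol: "f holomorphic_on slit_plane L"
    and asy: "\<And>k. 1 \<le> cmod k \<Longrightarrow> Re k \<le> 0 \<Longrightarrow> Im k \<le> 0 \<Longrightarrow> k \<in> slit_plane L \<Longrightarrow>
        cmod (f k - b / k) \<le> M / ((cmod k)^2 * cmod (1 - exp (- (4 * \<i> * k * of_real L))))"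
  obtains H where "\<And>z. z \<in> slit_plane L \<Longrightarrow> (H has_field_derivative f z) (at z)"
    and "((\<lambda>R. H (- of_real R * cis (\<psi> R)) - H (- \<i> * of_real R)) \<longlongrightarrow> - \<i> * of_real pi * b / 2) at_top"
proof -
  obtain H where H: "\<And>z. z \<in> slit_plane L \<Longrightarrow> (H has_field_derivative f z) (at z)"
    using simply_connected_eq_global_primitive[OF open_slit_plane] slit_plane_simply_connected hol by metis
  obtain c1 where c1: "c1 > 0" 
    "\<And>k. Im k \<le> 0 \<Longrightarrow> - 1 \<le> Im k \<Longrightarrow> Re k \<le> 0 \<Longrightarrow> 1 \<le> cmod k \<Longrightarrow>
      (\<And>n::nat. c / (real n + 1) \<le> cmod (k - of_real (- (real n * pi / (2 * L))))) \<Longrightarrow>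
      c1 / cmod k \<le> cmod (1 - exp (- (4 * \<i> * k * of_real L)))"
    using one_minus_exp_lower_near[OF \<open>L > 0\<close> \<open>c > 0\<close>] by blast
  \<comment> \<open>On the far piece Im k is at most -2/pi, by Jordan's inequality at angles not
    below 1/R.\<close>
  define c2 where "c2 = 1 - exp (- (4 * L * (2 / pi)))"
  have c2: "c2 > 0" using \<open>L > 0\<close> by (simp add: c2_def)
  have slit: "k \<in> slit_plane L" if k: "Im k \<le> 0" "1 - exp (- (4 * \<i> * k * of_real L)) \<noteq> 0" for k
  proof (rule ccontr)
    assume "k \<notin> slit_plane L"
    then have im: "Im k = 0" and "sin (2 * L * Re k) = 0" using k by (auto simp: slit_plane_def)
    then obtain n :: int where "2 * L * Re k = of_int n * pi" unfolding sin_zero_iff_int2 by blast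
    then have "exp (- (4 * \<i> * k * of_real L)) = 1"
      unfolding exp_eq_1 using im by (auto intro!: exI[of _ "- n"] simp: algebra_simps)
    then show False using k by simp
  qed
  \<comment> \<open>At k = -i the denominator of the assumed bound is positive, which forces the
    sign of \<open>M\<close>.\<close>
  have M0: "0 \<le> M"
  proof (rule ccontr)
    assume "\<not> 0 \<le> M"
    have *: "1 - exp (- (4 * L * 1)) \<le> cmod (1 - exp (- (4 * \<i> * (- \<i>) * of_real L)))"
      by (rule one_minus_exp_lower_far) (use assms in auto)
    have "exp (- (4 * L * 1)) < 1" using assms by simp
    then have "0 < cmod (1 - exp (- (4 * \<i> * (- \<i>) * of_real L)))" using * by linarith
    moreover have "0 \<le> M / ((cmod (- \<i>))^2 * cmod (1 - exp (- (4 * \<i> * (- \<i>) * of_real L))))"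
      by (rule order_trans[OF norm_ge_zero asy]) (auto simp: slit_plane_def)
    ultimately show False using \<open>\<not> 0 \<le> M\<close> by (simp add: zero_le_divide_iff)
  qed
  define K where "K = M / c1 + M / c2 * (pi / 2) + cmod b * D"
  have "\<forall>\<^sub>F R in at_top. norm ((H (- of_real R * cis (\<psi> R)) - H (- \<i> * of_real R)) - (- \<i> * of_real pi * b / 2)) \<le> K / R"
    using ev eventually_ge_at_top[of "max 1 D"]
  proof eventually_elim
    case (elim R)
    then have R: "R \<ge> 1" "R \<ge> D" and psi: "0 \<le> \<psi> R" "\<psi> R \<le> D / R\<^sup>2" by auto
    have "R \<le> R\<^sup>2" using R by (simp add: power2_eq_square)
    then have psiR: "\<psi> R \<le> D / R" using psi(2) R \<open>D > 0\<close>
      by (intro order_trans[OF psi(2) divide_left_mono]) auto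
    have psi1: "\<psi> R \<le> 1 / R" using psi(2) R by (intro order_trans[OF psi(2)]) (auto simp: power2_eq_square field_simps)
    have R1: "1 / R \<le> pi / 2" "1 / R \<le> 1" proof -
      show "1 / R \<le> 1" using R by simp
      then show "1 / R \<le> pi / 2" using pi_gt3 by linarith
    qed
    have nR: "cmod (of_real R * cis \<theta>) = R" for \<theta> using R by (simp add: norm_mult)
    have quad: "Re (of_real R * cis (\<phi> - pi)) \<le> 0" "Im (of_real R * cis (\<phi> - pi)) \<le> 0"
      if "0 \<le> \<phi>" "\<phi> \<le> pi / 2" for \<phi>
      using that R by (auto intro!: mult_nonneg_nonneg cos_ge_zero sin_ge_zero)
    have near: "c1 / R \<le> cmod (1 - exp (- (4 * \<i> * (of_real R * cis (\<phi> - pi)) * of_real L)))"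
      if ph: "\<psi> R \<le> \<phi>" "\<phi> \<le> 1 / R" for \<phi>
    proof -
      have p0: "0 \<le> \<phi>" "\<phi> \<le> pi / 2" using ph psi R1 by linarith+
      have "R * sin \<phi> \<le> R * (1 / R)" using sin_x_le_x[OF p0(1)] ph R by (intro mult_left_mono) auto
      then have im: "- 1 \<le> Im (of_real R * cis (\<phi> - pi))" using R by simp
      have "c / (real n + 1) \<le> cmod (of_real R * cis (\<phi> - pi) - of_real (- (real n * pi / (2 * L))))" for n :: nat
      proof -
        \<comment> \<open>Moving along the arc away from the real axis lowers the cosine and
          increases the distance to every -x with x at least 0. The end point of the contour is thus
          the worst case, and there the distance is known.\<close>
        define x where "x = real n * pi / (2 * L)"
        have x0: "x \<ge> 0" using \<open>L > 0\<close> by (simp add: x_def)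
        have sq: "(cmod (- of_real R * cis \<theta> - of_real (- x)))\<^sup>2 = R\<^sup>2 + x\<^sup>2 - 2 * R * x * cos \<theta>" for \<theta>
        proof -
          have "(cmod (- of_real R * cis \<theta> - of_real (- x)))\<^sup>2 = R\<^sup>2 * ((sin \<theta>)\<^sup>2 + (cos \<theta>)\<^sup>2) + x\<^sup>2 - 2 * R * x * cos \<theta>"
            unfolding cmod_power2 by (simp add: power2_eq_square algebra_simps del: sin_cos_squared_add3)
          then show ?thesis by simp
        qed
        have "cos \<phi> \<le> cos (\<psi> R)" using ph psi p0 pi_gt_zero by (intro cos_monotone_0_pi_le) linarith+
        then have "2 * R * x * cos \<phi> \<le> 2 * R * x * cos (\<psi> R)" using R x0 by (intro mult_left_mono) auto
        then have "(cmod (- of_real R * cis (\<psi> R) - of_real (- x)))\<^sup>2 \<le> (cmod (- of_real R * cis \<phi> - of_real (- x)))\<^sup>2"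
          unfolding sq by simp
        then have "cmod (- of_real R * cis (\<psi> R) - of_real (- x)) \<le> cmod (- of_real R * cis \<phi> - of_real (- x))"
          by (rule power2_le_imp_le) simp
        moreover have "c / (real n + 1) \<le> cmod (- of_real R * cis (\<psi> R) - of_real (- x))"
          using elim unfolding x_def by blast
        moreover have pc: "of_real R * cis (\<phi> - pi) = - of_real R * cis \<phi>" by (simp add: complex_eq_iff)
        ultimately show ?thesis unfolding x_def[symmetric] pc by linarith
      qed
      from c1(2)[OF quad(2)[OF p0] im quad(1)[OF p0] _ this] show ?thesis using R nR by simp
    qed
    have far: "c2 \<le> cmod (1 - exp (- (4 * \<i> * (of_real R * cis (\<phi> - pi)) * of_real L)))"
      if ph: "1 / R \<le> \<phi>" "\<phi> \<le> pi / 2" for \<phi>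
    proof -
      have "0 < 1 / R" using R by simp
      then have ph0: "0 \<le> \<phi>" using ph by linarith
      have "R * (2 / pi * (1 / R)) \<le> R * (2 / pi * \<phi>)" using ph R by (intro mult_left_mono) auto
      also have "\<dots> \<le> R * sin \<phi>" using sin_ge_linear[OF ph0 ph(2)] R by (intro mult_left_mono) auto
      finally have "Im (of_real R * cis (\<phi> - pi)) \<le> - (2 / pi)" using R by simp
      from one_minus_exp_lower_far[OF \<open>L > 0\<close> this] show ?thesis unfolding c2_def .
    qed
    have est: "k \<in> slit_plane L \<and> cmod (f k - b / k) \<le> M / (R^2 * q)"
      if q: "q > 0" "q \<le> cmod (1 - exp (- (4 * \<i> * k * of_real L)))" 
        and k: "k = of_real R * cis (\<phi> - pi)" "0 \<le> \<phi>" "\<phi> \<le> pi / 2" for q k \<phi>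
    proof -
      have "1 - exp (- (4 * \<i> * k * of_real L)) \<noteq> 0" using q by auto
      then have s: "k \<in> slit_plane L" using slit quad(2)[OF k(2,3)] k(1) by blast
      have "cmod (f k - b / k) \<le> M / (R^2 * cmod (1 - exp (- (4 * \<i> * k * of_real L))))"
        using asy[of k] s quad[OF k(2,3)] R nR unfolding k(1) by simp
      also have "\<dots> \<le> M / (R^2 * q)" using q R M0 by (intro divide_left_mono mult_left_mono mult_pos_pos) auto
      finally show ?thesis using s by blast
    qed
    have e1: "norm (H (of_real R * cis (1 / R - pi)) - H (of_real R * cis (\<psi> R - pi)) - \<i> * b * of_real (1 / R - pi - (\<psi> R - pi)))
        \<le> M / (R^2 * (c1 / R)) * R * (1 / R - pi - (\<psi> R - pi))"
    proof (rule arc_bound[where f = f])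
      fix \<theta> assume th: "\<theta> \<in> {\<psi> R - pi..1 / R - pi}"
      have "of_real R * cis \<theta> \<in> slit_plane L \<and> cmod (f (of_real R * cis \<theta>) - b / (of_real R * cis \<theta>)) \<le> M / (R^2 * (c1 / R))"
        by (rule est[of _ _ "\<theta> + pi"]) (use near[of "\<theta> + pi"] th psi R1 c1(1) R in auto)
      then show "cmod (f (of_real R * cis \<theta>) - b / (of_real R * cis \<theta>)) \<le> M / (R^2 * (c1 / R))"
        "(H has_field_derivative f (of_real R * cis \<theta>)) (at (of_real R * cis \<theta>))" using H by auto
    qed (use R psi1 in auto)
    have e2: "norm (H (of_real R * cis (- pi / 2)) - H (of_real R * cis (1 / R - pi)) - \<i> * b * of_real (- pi / 2 - (1 / R - pi)))
        \<le> M / (R^2 * c2) * R * (- pi / 2 - (1 / R - pi))"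
    proof (rule arc_bound[where f = f])
      fix \<theta> assume th: "\<theta> \<in> {1 / R - pi..- pi / 2}"
      have "1 / R > 0" using R by simp
      then have "0 \<le> \<theta> + pi" using th unfolding atLeastAtMost_iff by linarith
      then have "of_real R * cis \<theta> \<in> slit_plane L \<and> cmod (f (of_real R * cis \<theta>) - b / (of_real R * cis \<theta>)) \<le> M / (R^2 * c2)"
        by (intro est[of _ _ "\<theta> + pi"]) (use far[of "\<theta> + pi"] th c2 R in auto)
      then show "cmod (f (of_real R * cis \<theta>) - b / (of_real R * cis \<theta>)) \<le> M / (R^2 * c2)"
        "(H has_field_derivative f (of_real R * cis \<theta>)) (at (of_real R * cis \<theta>))" using H by auto
    next
      show "1 / R - pi \<le> - pi / 2" using R1 by linarith
    qed (use R in auto)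
    define X1 X2 where "X1 = H (of_real R * cis (1 / R - pi)) - H (of_real R * cis (\<psi> R - pi)) - \<i> * b * of_real (1 / R - pi - (\<psi> R - pi))"
      and "X2 = H (of_real R * cis (- pi / 2)) - H (of_real R * cis (1 / R - pi)) - \<i> * b * of_real (- pi / 2 - (1 / R - pi))"
    have c: "of_real R * cis (- pi / 2) = - \<i> * of_real R" "of_real R * cis (\<psi> R - pi) = - of_real R * cis (\<psi> R)"
      by (auto simp: complex_eq_iff)
    have "(H (- of_real R * cis (\<psi> R)) - H (- \<i> * of_real R)) - (- \<i> * of_real pi * b / 2) = - X1 - X2 + \<i> * b * of_real (\<psi> R)"
      unfolding X1_def X2_def c by (simp add: algebra_simps)
    also have "norm \<dots> \<le> norm X1 + norm X2 + norm (\<i> * b * of_real (\<psi> R))"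
      using norm_triangle_ineq[of "- X1 - X2" "\<i> * b * of_real (\<psi> R)"] norm_triangle_ineq4[of "- X1" X2] by simp
    also have "\<dots> \<le> M / c1 * (1 / R - \<psi> R) + M / (R * c2) * (pi / 2 - 1 / R) + cmod b * \<psi> R"
      using e1 e2 psi R unfolding X1_def[symmetric] X2_def[symmetric] by (simp add: norm_mult power2_eq_square)
    also have "\<dots> \<le> M / c1 * (1 / R) + M / (R * c2) * (pi / 2) + cmod b * (D / R)"
      using psi psiR R M0 c1(1) c2 by (intro add_mono mult_left_mono) auto
    also have "\<dots> = K / R" using R by (simp add: K_def field_simps)
    finally show ?case .
  qed
  then have "((\<lambda>R. (H (- of_real R * cis (\<psi> R)) - H (- \<i> * of_real R)) - (- \<i> * of_real pi * b / 2)) \<longlongrightarrow> 0) at_top"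
    by (rule Lim_null_comparison) real_asymp
  from that[OF H LIM_zero_cancel[OF this]] show ?thesis .
qed

section \<open>Boundary values from the spectral data at a fixed time\<close>

definition star :: "(complex \<Rightarrow> complex) \<Rightarrow> complex \<Rightarrow> complex" where
  "star f k = cnj (f (cnj k))"

lemma star_entire:
  assumes "f holomorphic_on UNIV"
  shows "star f holomorphic_on UNIV"
proof -
  have s: "range cnj = UNIV" by (metis complex_cnj_cnj surjI)
  have "(cnj \<circ> f \<circ> cnj) holomorphic_on UNIV"
    by (rule holomorphic_on_compose_cnj_cnj) (use assms s in auto)
  then show ?thesis by (simp add: star_def[abs_def] o_def)
qed

text \<open>\<open>F\<close> has no constant term, so knowing \<open>G\<close> to first order
  suffices to determine the product up to O(k^-3). The predicate \<open>P\<close> leaves the region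
  of k open.\<close>

lemma product_expansion:
  assumes F: "\<And>k. P k \<Longrightarrow> cmod (F k - (a / k + b / k\<^sup>2)) \<le> M / cmod k ^ 3"
    and G: "\<And>k. P k \<Longrightarrow> cmod (G k - (1 + d / k)) \<le> N / (cmod k)\<^sup>2"
    and P: "\<And>k. P k \<Longrightarrow> 1 \<le> cmod k" and pos: "M \<ge> 0" "N \<ge> 0"
  obtains C where "C \<ge> 0" "\<And>k. P k \<Longrightarrow> cmod (F k * G k - (a / k + (b + a * d) / k\<^sup>2)) \<le> C / cmod k ^ 3"
proof
  define C where "C = M * (1 + cmod d + N) + cmod a * N + cmod b * (cmod d + N)"
  show "C \<ge> 0" using pos by (simp add: C_def)
  fix k assume k: "P k"
  define e where "e = inverse (cmod k)"
  have k0: "k \<noteq> 0" using P[OF k] by auto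
  have e: "0 \<le> e" "e \<le> 1" using P[OF k] by (auto simp: e_def inverse_le_1_iff)
  have ne: "cmod (inverse k) = e" by (simp add: e_def norm_inverse)
  have er: "x / cmod k ^ n = x * e ^ n" for x n by (simp add: e_def power_inverse divide_inverse)
  define u v where "u = F k - (a / k + b / k\<^sup>2)" and "v = G k - (1 + d / k)"
  have u: "cmod u \<le> M * e ^ 3" and v: "cmod v \<le> N * e\<^sup>2"
    using F[OF k] G[OF k] unfolding er u_def v_def by auto
  have "F k * G k - (a / k + (b + a * d) / k\<^sup>2) = u * (1 + d * inverse k + v) + a * inverse k * v + b * (inverse k)\<^sup>2 * (d * inverse k + v)"
    using k0 by (simp add: u_def v_def field_simps power2_eq_square)
  also have "cmod \<dots> \<le> (M * e ^ 3) * (1 + cmod d + N) + cmod a * e * (N * e\<^sup>2) + cmod b * e\<^sup>2 * ((cmod d + N) * e)"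
  proof (intro norm_triangle_le add_mono)
    have e2: "e\<^sup>2 \<le> e" "e\<^sup>2 \<le> 1" using e by (auto simp: power2_eq_square mult_left_le mult_le_one)
    have v1: "cmod v \<le> N" "cmod v \<le> N * e" using v mult_left_mono[OF e2(2) pos(2)] mult_left_mono[OF e2(1) pos(2)] by auto
    have d1: "cmod (d * inverse k) \<le> cmod d" using e by (simp add: norm_mult ne mult_left_le)
    have "cmod (1 + d * inverse k + v) \<le> 1 + cmod d + N"
      using v1 d1 by (intro norm_triangle_le add_mono) auto
    then show "cmod (u * (1 + d * inverse k + v)) \<le> (M * e ^ 3) * (1 + cmod d + N)"
      unfolding norm_mult using u pos e by (intro mult_mono) auto
    show "cmod (a * inverse k * v) \<le> cmod a * e * (N * e\<^sup>2)"
      unfolding norm_mult ne using v e by (intro mult_left_mono) auto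
    have "cmod (d * inverse k + v) \<le> cmod d * e + N * e"
      using v1 by (intro norm_triangle_le add_mono) (auto simp: norm_mult ne)
    then show "cmod (b * (inverse k)\<^sup>2 * (d * inverse k + v)) \<le> cmod b * e\<^sup>2 * ((cmod d + N) * e)"
      unfolding norm_mult norm_power ne distrib_right by (intro mult_left_mono) auto
  qed
  also have "\<dots> = C * e ^ 3" by (simp add: C_def algebra_simps power3_eq_cube power2_eq_square)
  finally show "cmod (F k * G k - (a / k + (b + a * d) / k\<^sup>2)) \<le> C / cmod k ^ 3" unfolding er .
qed

text \<open>\<open>F1\<close>, \<open>F2\<close>, \<open>f1\<close>, \<open>f2\<close> stand for $\Phi_1$, $\Phi_2$, $\varphi_1$, $\varphi_2$ at a fixed time.\<close>

locale boundary_spectral_data =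
  fixes L :: real and g0 g1 h0 h1 b \<beta> :: complex and F1 F2 f1 f2 :: "complex \<Rightarrow> complex"
  assumes L: "0 < L"
    and hol: "F1 holomorphic_on UNIV" "F2 holomorphic_on UNIV" "f1 holomorphic_on UNIV" "f2 holomorphic_on UNIV"
    and asyF1: "strip_bound K 3 (\<lambda>k. F1 k - (g0 / (2 * \<i>) / k + (g1 / 4 + g0 * b / (2 * \<i>)) / k\<^sup>2))"
    and asyF2: "strip_bound K 2 (\<lambda>k. F2 k - (1 + b / k))"
    and asyf1: "strip_bound K 3 (\<lambda>k. f1 k - (h0 / (2 * \<i>) / k + (h1 / 4 + h0 * \<beta> / (2 * \<i>)) / k\<^sup>2))"
    and asyf2: "strip_bound K 2 (\<lambda>k. f2 k - (1 + \<beta> / k))"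
    and imag: "cnj b = - b" "cnj \<beta> = - \<beta>"
    and exp_c: "exp_type (\<lambda>k. F1 k * star f2 k - star F2 k * f1 k * exp (2 * \<i> * k * of_real L))"
begin

section \<open>The connection coefficient and its expansion\<close>

definition "E k = exp (- (2 * \<i> * k * of_real L))"
text \<open>\<open>X\<close> and \<open>Y\<close> are the two products in the connection
  coefficient: c = X - Y / E.\<close>

definition "X k = F1 k * star f2 k"
definition "Y k = star F2 k * f1 k"
definition "a1 = g0 / (2 * \<i>)"
definition "a2 = g1 / 4 + g0 * b / (2 * \<i>)"
definition "\<alpha>1 = h0 / (2 * \<i>)"
definition "\<alpha>2 = h1 / 4 + h0 * \<beta> / (2 * \<i>)"
text \<open>Coefficients of k^-2 in \<open>X\<close> and \<open>Y\<close>. The minus signs come from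
  passing to the starred functions, because \<open>b\<close> and \<open>\<beta>\<close> are purely
  imaginary.\<close>

definition "A2 = a2 + a1 * (- \<beta>)"
definition "B2 = \<alpha>2 + \<alpha>1 * (- b)"
text \<open>With $E = e^{-2ikL}$, these are $E[Ec]_-$ and $E[Ec]_+$.\<close>

definition "Wm k = (E k)\<^sup>2 * X k - E k * Y k - (X (- k) - E k * Y (- k))"
definition "Wp k = (E k)\<^sup>2 * X k - E k * Y k + (X (- k) - E k * Y (- k))"

lemma E_minus: "E (- k) = inverse (E k)" "E k \<noteq> 0"
  by (simp_all add: E_def exp_minus)

lemma hol_XY: "X holomorphic_on UNIV" "Y holomorphic_on UNIV" "E holomorphic_on UNIV"
  unfolding X_def[abs_def] Y_def[abs_def] E_def[abs_def] by (intro holomorphic_intros hol star_entire)+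

lemma hol_XY_minus: "(\<lambda>k. X (- k)) holomorphic_on UNIV" "(\<lambda>k. Y (- k)) holomorphic_on UNIV"
proof -
  have u: "(\<lambda>k::complex. - k) holomorphic_on UNIV" by (intro holomorphic_intros)
  show "(\<lambda>k. X (- k)) holomorphic_on UNIV" "(\<lambda>k. Y (- k)) holomorphic_on UNIV"
    using holomorphic_on_compose[OF u holomorphic_on_subset[OF hol_XY(1)]]
      holomorphic_on_compose[OF u holomorphic_on_subset[OF hol_XY(2)]] by (auto simp: o_def)
qed

lemma hol_W: "Wm holomorphic_on UNIV" "Wp holomorphic_on UNIV"
  unfolding Wm_def[abs_def] Wp_def[abs_def] by (intro holomorphic_intros hol_XY hol_XY_minus)+

lemma exp_type_W: "exp_type Wm" "exp_type Wp"
proof -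
  define c where "c k = F1 k * star f2 k - star F2 k * f1 k * exp (2 * \<i> * k * of_real L)" for k
  have c: "exp_type c" using exp_c unfolding c_def[abs_def] .
  have E: "exp_type E" using exp_type_exp[of "- (2 * \<i> * of_real L)"] unfolding E_def[abs_def] by (simp add: mult_ac)
  have e: "exp (2 * \<i> * k * of_real L) = inverse (E k)" "exp (2 * \<i> * (- k) * of_real L) = E k" for k
    by (simp_all add: E_def exp_minus)
  have "c k = X k - Y k * inverse (E k)" "c (- k) = X (- k) - Y (- k) * E k" for k
    unfolding c_def X_def Y_def e by (simp_all add: E_minus)
  note cc = this
  have "E k ^ 2 * c k = (E k)\<^sup>2 * X k - E k * Y k" for k
    unfolding cc using E_minus(2)[of k] by (simp add: power2_eq_square field_simps)
  then have "Wm k = E k ^ 2 * c k - c (- k)" "Wp k = E k ^ 2 * c k + c (- k)" for k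
    unfolding Wm_def Wp_def cc(2) by (simp_all add: mult.commute)
  then have "Wm = (\<lambda>k. E k ^ 2 * c k - c (- k))" "Wp = (\<lambda>k. E k ^ 2 * c k + c (- k))" by auto
  then show "exp_type Wm" "exp_type Wp" by (auto intro!: exp_type_intros E c)
qed

text \<open>Conjugation of k reverses the sign of Re k Im k. Hence the expansions of
  \<open>F1\<close> and of the starred \<open>f2\<close> are available together only near the
  coordinate axes, and likewise for the other product.\<close>

lemma axis_expansion:
  obtains C where "C \<ge> 0"
    "\<And>k. 1 \<le> cmod k \<Longrightarrow> Re k * Im k = 0 \<Longrightarrow> cmod (X k - (a1 / k + A2 / k\<^sup>2)) \<le> C / cmod k ^ 3"
    "\<And>k. 1 \<le> cmod k \<Longrightarrow> Re k * Im k = 0 \<Longrightarrow> cmod (Y k - (\<alpha>1 / k + B2 / k\<^sup>2)) \<le> C / cmod k ^ 3"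
proof -
  define P where "P k \<longleftrightarrow> 1 \<le> cmod k \<and> Re k * Im k = 0" for k
  have pos: "0 \<le> M" if "\<And>k. P k \<Longrightarrow> cmod (f k) \<le> M / cmod k ^ n" for M f n
    using that[of 1] by (auto simp: P_def intro: order_trans[OF norm_ge_zero])
  obtain M1 where m1: "\<And>k. 1 \<le> cmod k \<Longrightarrow> Re k * Im k \<le> 0 \<Longrightarrow> cmod (F1 k - (a1 / k + a2 / k\<^sup>2)) \<le> M1 / cmod k ^ 3"
    using strip_boundE[OF asyF1[of 0]] unfolding a1_def[symmetric] a2_def[symmetric] by blast
  have M1: "cmod (F1 k - (a1 / k + a2 / k\<^sup>2)) \<le> M1 / cmod k ^ 3" if "P k" for k
    by (rule m1) (use that in \<open>auto simp: P_def\<close>)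
  obtain M2 where m2: "\<And>k. 1 \<le> cmod k \<Longrightarrow> Re k * Im k \<le> 0 \<Longrightarrow> cmod (f1 k - (\<alpha>1 / k + \<alpha>2 / k\<^sup>2)) \<le> M2 / cmod k ^ 3"
    using strip_boundE[OF asyf1[of 0]] unfolding \<alpha>1_def[symmetric] \<alpha>2_def[symmetric] by blast
  have M2: "cmod (f1 k - (\<alpha>1 / k + \<alpha>2 / k\<^sup>2)) \<le> M2 / cmod k ^ 3" if "P k" for k
    by (rule m2) (use that in \<open>auto simp: P_def\<close>)
  \<comment> \<open>For purely imaginary d the conjugate of 1 + d / cnj k is 1 - d/k.\<close>
  have st: "\<exists>M. \<forall>k. P k \<longrightarrow> cmod (star f k - (1 + (- d) / k)) \<le> M / (cmod k)\<^sup>2"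
    if ex: "strip_bound 0 2 (\<lambda>k. f k - (1 + d / k))" and "cnj d = - d" for f d
  proof -
    obtain M where M: "\<And>k. 1 \<le> cmod k \<Longrightarrow> Re k * Im k \<le> 0 \<Longrightarrow> cmod (f k - (1 + d / k)) \<le> M / (cmod k)\<^sup>2" using strip_boundE[OF ex] by blast
    have "cmod (star f k - (1 + (- d) / k)) \<le> M / (cmod k)\<^sup>2" if k: "P k" for k
    proof -
      have "star f k - (1 + (- d) / k) = cnj (f (cnj k) - (1 + d / cnj k))"
        unfolding star_def using \<open>cnj d = - d\<close> by simp
      then have "cmod (star f k - (1 + (- d) / k)) = cmod (f (cnj k) - (1 + d / cnj k))" by (simp only: complex_mod_cnj)
      also have "\<dots> \<le> M / (cmod (cnj k))\<^sup>2" by (rule M) (use k in \<open>auto simp: P_def\<close>)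
      finally show ?thesis by simp
    qed
    then show ?thesis by blast
  qed
  obtain N1 where N1: "\<And>k. P k \<Longrightarrow> cmod (star f2 k - (1 + (- \<beta>) / k)) \<le> N1 / (cmod k)\<^sup>2"
    using st[OF asyf2[of 0] imag(2)] by blast
  obtain N2 where N2: "\<And>k. P k \<Longrightarrow> cmod (star F2 k - (1 + (- b) / k)) \<le> N2 / (cmod k)\<^sup>2"
    using st[OF asyF2[of 0] imag(1)] by blast
  have P1: "1 \<le> cmod k" if "P k" for k using that by (simp add: P_def)
  obtain C1 where C1: "C1 \<ge> 0" "\<And>k. P k \<Longrightarrow> cmod (F1 k * star f2 k - (a1 / k + (a2 + a1 * (- \<beta>)) / k\<^sup>2)) \<le> C1 / cmod k ^ 3"
    using product_expansion[OF M1 N1 P1 pos[OF M1] pos[OF N1]] by blast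
  obtain C2 where C2: "C2 \<ge> 0" "\<And>k. P k \<Longrightarrow> cmod (f1 k * star F2 k - (\<alpha>1 / k + (\<alpha>2 + \<alpha>1 * (- b)) / k\<^sup>2)) \<le> C2 / cmod k ^ 3"
    using product_expansion[OF M2 N2 P1 pos[OF M2] pos[OF N2]] by blast
  have le: "C1 / cmod k ^ 3 \<le> (C1 + C2) / cmod k ^ 3" "C2 / cmod k ^ 3 \<le> (C1 + C2) / cmod k ^ 3" for k
    using C1(1) C2(1) by (auto intro!: divide_right_mono)
  show ?thesis
  proof (rule that[of "C1 + C2"])
    fix k :: complex assume "1 \<le> cmod k" "Re k * Im k = 0"
    then have k: "P k" by (simp add: P_def)
    show "cmod (X k - (a1 / k + A2 / k\<^sup>2)) \<le> (C1 + C2) / cmod k ^ 3"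
      unfolding X_def A2_def using order_trans[OF C1(2)[OF k] le(1)] .
    show "cmod (Y k - (\<alpha>1 / k + B2 / k\<^sup>2)) \<le> (C1 + C2) / cmod k ^ 3"
      unfolding Y_def B2_def using order_trans[OF C2(2)[OF k] le(2)] by (simp add: mult.commute)
  qed (use C1 C2 in auto)
qed

text \<open>The connection coefficient is of exponential type, and its large-\<open>k\<close> expansion is only known
  on the coordinate axes, where both pairs of eigenfunctions can be expanded. The
  Phragmen-Lindelof principle carries it into the third quadrant.\<close>

lemma entire_remainder_bounded:
  assumes f: "f holomorphic_on UNIV" "exp_type f"
    and le: "\<And>k. 1 \<le> cmod k \<Longrightarrow> Re k * Im k = 0 \<Longrightarrow> Re k \<le> 0 \<Longrightarrow> Im k \<le> 0 \<Longrightarrow> cmod (f k) \<le> M"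
  obtains C where "\<And>k. Re k \<le> 0 \<Longrightarrow> Im k \<le> 0 \<Longrightarrow> cmod (f k) \<le> C"
proof -
  have "bounded (f ` cball 0 1)"
    by (intro compact_imp_bounded compact_continuous_image holomorphic_on_imp_continuous_on[OF holomorphic_on_subset[OF f(1)]]) auto
  then obtain M' where "\<And>z. z \<in> f ` cball 0 1 \<Longrightarrow> cmod z \<le> M'" unfolding bounded_iff by blast
  then have M': "cmod (f z) \<le> M'" if "cmod z \<le> 1" for z using that by auto
  have ax: "cmod (f k) \<le> max M M'" if "Re k * Im k = 0" "Re k \<le> 0" "Im k \<le> 0" for k
    using le[of k] M'[of k] that by (cases "1 \<le> cmod k") auto
  have "cmod (f k) \<le> max M M'" if "Re k \<le> 0" "Im k \<le> 0" for k
    by (rule phragmen_lindelof_third_quadrant[OF f _ _ that]) (auto intro!: ax)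
  then show ?thesis using that by blast
qed

text \<open>|E| is at most 1 in the closed lower half-plane, so the four errors simply add up.
  Reflecting k reverses only the odd powers: \<open>B2\<close> drops out of \<open>Wm\<close>, and
  \<open>\<alpha>1\<close> out of \<open>Wp\<close>.\<close>

lemma W_axis:
  assumes C: "\<And>k. 1 \<le> cmod k \<Longrightarrow> Re k * Im k = 0 \<Longrightarrow> cmod (X k - (a1 / k + A2 / k\<^sup>2)) \<le> C / cmod k ^ 3"
    "\<And>k. 1 \<le> cmod k \<Longrightarrow> Re k * Im k = 0 \<Longrightarrow> cmod (Y k - (\<alpha>1 / k + B2 / k\<^sup>2)) \<le> C / cmod k ^ 3" and C0: "C \<ge> 0"
    and k: "1 \<le> cmod k" "Re k * Im k = 0" "Im k \<le> 0"
  shows "cmod (Wm k - (a1 / k * (1 + (E k)\<^sup>2) - A2 / k\<^sup>2 * (1 - (E k)\<^sup>2) - 2 * E k * \<alpha>1 / k)) \<le> 4 * C / cmod k ^ 3" (is ?A)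
    and "cmod (Wp k - (- (a1 / k) * (1 - (E k)\<^sup>2) + A2 / k\<^sup>2 * (1 + (E k)\<^sup>2) - 2 * E k * B2 / k\<^sup>2)) \<le> 4 * C / cmod k ^ 3" (is ?B)
proof -
  define x where "x k = X k - (a1 / k + A2 / k\<^sup>2)" for k
  define y where "y k = Y k - (\<alpha>1 / k + B2 / k\<^sup>2)" for k
  have k0: "k \<noteq> 0" using k by auto
  have E1: "cmod (E k) \<le> 1" using L k by (simp add: E_def mult_nonpos_nonneg)
  then have E2: "cmod ((E k)\<^sup>2) \<le> 1" by (simp add: norm_power power_le_one)
  define D where "D = C / cmod k ^ 3"
  have x: "cmod (x k) \<le> D" "cmod (x (- k)) \<le> D" "cmod (y k) \<le> D" "cmod (y (- k)) \<le> D"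
    using C(1)[of k] C(1)[of "- k"] C(2)[of k] C(2)[of "- k"] k unfolding x_def y_def D_def by simp_all
  have D0: "D \<ge> 0" using C0 by (simp add: D_def)
  have p: "cmod ((E k)\<^sup>2 * x k) \<le> D" "cmod (E k * y k) \<le> D" "cmod (E k * y (- k)) \<le> D"
    using mult_mono[OF E2 x(1)] mult_mono[OF E1 x(3)] mult_mono[OF E1 x(4)] D0 by (simp_all add: norm_mult)
  have "Wm k - (a1 / k * (1 + (E k)\<^sup>2) - A2 / k\<^sup>2 * (1 - (E k)\<^sup>2) - 2 * E k * \<alpha>1 / k)
     = (E k)\<^sup>2 * x k - E k * y k - x (- k) + E k * y (- k)"
    unfolding Wm_def x_def y_def using k0 by (simp add: field_simps power2_eq_square)
  also have "cmod \<dots> \<le> D + D + D + D"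
    by (intro norm_triangle_le norm_triangle_le_diff add_mono p x)
  finally show ?A
    by (simp add: D_def)
  have "Wp k - (- (a1 / k) * (1 - (E k)\<^sup>2) + A2 / k\<^sup>2 * (1 + (E k)\<^sup>2) - 2 * E k * B2 / k\<^sup>2)
     = (E k)\<^sup>2 * x k - E k * y k + x (- k) - E k * y (- k)"
    unfolding Wp_def x_def y_def using k0 by (simp add: field_simps power2_eq_square)
  also have "cmod \<dots> \<le> D + D + D + D"
    by (intro norm_triangle_le norm_triangle_le_diff add_mono p x)
  finally show ?B
    by (simp add: D_def)
qed

text \<open>The subtracted terms are the part of k Wm that does not decay; since a1 = -i g0/2 and
  \<open>\<alpha>1\<close> = -i h0/2, they are exactly what i g0 and i h0 contribute to the
  integrand. After division the leading term is -A2/k, and -a1/k for the Neumann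
  counterpart.\<close>

definition "dirichlet_pole_part k = (k * Wm k - a1 * (1 + (E k)\<^sup>2) + 2 * E k * \<alpha>1) / (1 - (E k)\<^sup>2)"
definition "neumann_pole_part k = Wp k / (1 - (E k)\<^sup>2)"

lemma exp_type_E: "exp_type E"
  using exp_type_exp[of "- (2 * \<i> * of_real L)"] unfolding E_def[abs_def] by (simp add: mult_ac)

lemma E_square: "(E k)\<^sup>2 = exp (- (4 * \<i> * k * of_real L))"
proof -
  have "- (4 * \<i> * k * of_real L) = - (2 * \<i> * k * of_real L) + - (2 * \<i> * k * of_real L)" by simp
  then show ?thesis unfolding E_def power2_eq_square by (simp only: exp_add)
qed

lemma one_minus_E_square:
  assumes "k \<in> slit_plane L"
  shows "1 - (E k)\<^sup>2 \<noteq> 0"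
proof
  assume "1 - (E k)\<^sup>2 = 0"
  then have "exp (- (4 * \<i> * k * of_real L)) = 1" unfolding E_square by simp
  then obtain n :: int where re: "Re (- (4 * \<i> * k * of_real L)) = 0" and "Im (- (4 * \<i> * k * of_real L)) = of_int (2 * n) * pi"
    unfolding exp_eq_1 by blast
  then have "Im k = 0" "2 * L * Re k = of_int (- n) * pi" using L by (auto simp: algebra_simps)
  moreover from this(2) have "sin (2 * L * Re k) = 0" unfolding sin_zero_iff_int2 by blast
  ultimately show False using assms by (simp add: slit_plane_def)
qed

text \<open>\<open>f\<close> is k^3 times the error in the expansion of \<open>Wm\<close>,
  multiplied out so as to be entire. It has exponential type and is bounded on the two negative
  half-axes by \<open>W_axis\<close>, hence in the whole quadrant.\<close>

lemma dirichlet_pole_part_bound: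
  obtains M where "\<And>k. 1 \<le> cmod k \<Longrightarrow> Re k \<le> 0 \<Longrightarrow> Im k \<le> 0 \<Longrightarrow> k \<in> slit_plane L \<Longrightarrow>
        cmod (dirichlet_pole_part k - (- A2) / k) \<le> M / ((cmod k)^2 * cmod (1 - exp (- (4 * \<i> * k * of_real L))))"
proof -
  obtain C where C: "C \<ge> 0"
    "\<And>k. 1 \<le> cmod k \<Longrightarrow> Re k * Im k = 0 \<Longrightarrow> cmod (X k - (a1 / k + A2 / k\<^sup>2)) \<le> C / cmod k ^ 3"
    "\<And>k. 1 \<le> cmod k \<Longrightarrow> Re k * Im k = 0 \<Longrightarrow> cmod (Y k - (\<alpha>1 / k + B2 / k\<^sup>2)) \<le> C / cmod k ^ 3"
    using axis_expansion by blast
  define f where "f k = k ^ 3 * Wm k - k\<^sup>2 * a1 * (1 + (E k)\<^sup>2) + k * A2 * (1 - (E k)\<^sup>2) + 2 * k\<^sup>2 * E k * \<alpha>1" for k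
  have "f holomorphic_on UNIV" unfolding f_def[abs_def] by (intro holomorphic_intros hol_W hol_XY)
  moreover have "exp_type f" unfolding f_def[abs_def] by (intro exp_type_intros exp_type_W exp_type_E)
  moreover have "cmod (f k) \<le> 4 * C" if k: "1 \<le> cmod k" "Re k * Im k = 0" "Im k \<le> 0" for k
  proof -
    have k0: "k \<noteq> 0" using k by auto
    have "f k = k ^ 3 * (Wm k - (a1 / k * (1 + (E k)\<^sup>2) - A2 / k\<^sup>2 * (1 - (E k)\<^sup>2) - 2 * E k * \<alpha>1 / k))"
      unfolding f_def using k0 by (simp add: field_simps power2_eq_square power3_eq_cube)
    then have "cmod (f k) \<le> cmod k ^ 3 * (4 * C / cmod k ^ 3)"
      unfolding norm_mult norm_power using W_axis(1)[OF C(2,3,1) k] by (simp add: norm_mult norm_power mult_left_mono del: times_divide_eq_right)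
    then show ?thesis using k0 by simp
  qed
  ultimately obtain M where M: "\<And>k. Re k \<le> 0 \<Longrightarrow> Im k \<le> 0 \<Longrightarrow> cmod (f k) \<le> M"
    using entire_remainder_bounded[of f "4 * C"] by blast
  show ?thesis
  proof (rule that[of M])
    fix k assume k: "1 \<le> cmod k" "Re k \<le> 0" "Im k \<le> 0" "k \<in> slit_plane L"
    have k0: "k \<noteq> 0" using k by auto
    have nz: "1 - (E k)\<^sup>2 \<noteq> 0" using one_minus_E_square[OF k(4)] .
    have "dirichlet_pole_part k - (- A2) / k = f k / (k\<^sup>2 * (1 - (E k)\<^sup>2))"
    proof -
      have "k\<^sup>2 * (1 - (E k)\<^sup>2) * (dirichlet_pole_part k - (- A2) / k) = k\<^sup>2 * ((1 - (E k)\<^sup>2) * dirichlet_pole_part k) + k * A2 * (1 - (E k)\<^sup>2)"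
        using k0 by (simp add: field_simps power2_eq_square)
      also have "(1 - (E k)\<^sup>2) * dirichlet_pole_part k = k * Wm k - a1 * (1 + (E k)\<^sup>2) + 2 * E k * \<alpha>1"
        unfolding dirichlet_pole_part_def using nz by simp
      also have "k\<^sup>2 * (k * Wm k - a1 * (1 + (E k)\<^sup>2) + 2 * E k * \<alpha>1) + k * A2 * (1 - (E k)\<^sup>2) = f k"
        unfolding f_def by (simp add: algebra_simps power2_eq_square power3_eq_cube)
      finally show ?thesis using k0 nz by (simp add: field_simps)
    qed
    then have "cmod (dirichlet_pole_part k - (- A2) / k) = cmod (f k) / ((cmod k)\<^sup>2 * cmod (1 - exp (- (4 * \<i> * k * of_real L))))"
      unfolding E_square by (simp add: norm_divide norm_mult norm_power)
    also have "\<dots> \<le> M / ((cmod k)\<^sup>2 * cmod (1 - exp (- (4 * \<i> * k * of_real L))))"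
      by (intro divide_right_mono M k) auto
    finally show "cmod (dirichlet_pole_part k - (- A2) / k) \<le> M / ((cmod k)^2 * cmod (1 - exp (- (4 * \<i> * k * of_real L))))" .
  qed
qed

text \<open>Only the coefficient of 1/k is wanted, so the factor k^2 suffices; the terms with
  \<open>A2\<close> and \<open>B2\<close> are then bounded and go into the constant.\<close>

lemma neumann_pole_part_bound:
  obtains M where "\<And>k. 1 \<le> cmod k \<Longrightarrow> Re k \<le> 0 \<Longrightarrow> Im k \<le> 0 \<Longrightarrow> k \<in> slit_plane L \<Longrightarrow>
        cmod (neumann_pole_part k - (- a1) / k) \<le> M / ((cmod k)^2 * cmod (1 - exp (- (4 * \<i> * k * of_real L))))"
proof -
  obtain C where C: "C \<ge> 0"
    "\<And>k. 1 \<le> cmod k \<Longrightarrow> Re k * Im k = 0 \<Longrightarrow> cmod (X k - (a1 / k + A2 / k\<^sup>2)) \<le> C / cmod k ^ 3"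
    "\<And>k. 1 \<le> cmod k \<Longrightarrow> Re k * Im k = 0 \<Longrightarrow> cmod (Y k - (\<alpha>1 / k + B2 / k\<^sup>2)) \<le> C / cmod k ^ 3"
    using axis_expansion by blast
  define f where "f k = k\<^sup>2 * Wp k + k * a1 * (1 - (E k)\<^sup>2)" for k
  have "f holomorphic_on UNIV" unfolding f_def[abs_def] by (intro holomorphic_intros hol_W hol_XY)
  moreover have "exp_type f" unfolding f_def[abs_def] by (intro exp_type_intros exp_type_W exp_type_E)
  moreover have "cmod (f k) \<le> 4 * C + (2 * cmod A2 + 2 * cmod B2)" if k: "1 \<le> cmod k" "Re k * Im k = 0" "Im k \<le> 0" for k
  proof -
    have k0: "k \<noteq> 0" using k by auto
    have E1: "cmod (E k) \<le> 1" using L k by (simp add: E_def mult_nonpos_nonneg)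
    have E2: "cmod ((E k)\<^sup>2) \<le> 1" using E1 by (simp add: norm_power power_le_one)
    define w where "w = Wp k - (- (a1 / k) * (1 - (E k)\<^sup>2) + A2 / k\<^sup>2 * (1 + (E k)\<^sup>2) - 2 * E k * B2 / k\<^sup>2)"
    have "f k = k\<^sup>2 * w + (A2 * (1 + (E k)\<^sup>2) - 2 * E k * B2)"
      unfolding f_def w_def using k0 by (simp add: field_simps power2_eq_square)
    also have "cmod \<dots> \<le> 4 * C + (2 * cmod A2 + 2 * cmod B2)"
    proof (intro norm_triangle_le norm_triangle_le_diff add_mono)
      have "cmod (k\<^sup>2 * w) \<le> (cmod k)\<^sup>2 * (4 * C / cmod k ^ 3)"
        unfolding norm_mult norm_power w_def by (intro mult_left_mono W_axis(2)[OF C(2,3,1) k]) auto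
      also have "\<dots> = 4 * C / cmod k" using k0 by (simp add: power2_eq_square power3_eq_cube)
      also have "\<dots> \<le> 4 * C" using C(1) k(1) by (simp add: divide_le_eq mult_left_le_one_le field_simps mult_le_cancel_left1)
      finally show "cmod (k\<^sup>2 * w) \<le> 4 * C" .
      have "cmod (1 + (E k)\<^sup>2) \<le> 2" using norm_triangle_ineq[of 1 "(E k)\<^sup>2"] E2 by simp
      from mult_right_mono[OF this, of "cmod A2"]
      show "cmod (A2 * (1 + (E k)\<^sup>2)) \<le> 2 * cmod A2" by (simp add: norm_mult mult.commute)
      show "cmod (2 * E k * B2) \<le> 2 * cmod B2" using mult_right_mono[OF E1, of "cmod B2"] by (simp add: norm_mult)
    qed
    finally show ?thesis .
  qed
  ultimately obtain M where M: "\<And>k. Re k \<le> 0 \<Longrightarrow> Im k \<le> 0 \<Longrightarrow> cmod (f k) \<le> M"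
    using entire_remainder_bounded[of f "4 * C + (2 * cmod A2 + 2 * cmod B2)"] by blast
  show ?thesis
  proof (rule that[of M])
    fix k assume k: "1 \<le> cmod k" "Re k \<le> 0" "Im k \<le> 0" "k \<in> slit_plane L"
    have k0: "k \<noteq> 0" using k by auto
    have nz: "1 - (E k)\<^sup>2 \<noteq> 0" using one_minus_E_square[OF k(4)] .
    have "neumann_pole_part k - (- a1) / k = f k / (k\<^sup>2 * (1 - (E k)\<^sup>2))"
      unfolding neumann_pole_part_def f_def using k0 nz by (simp add: field_simps power2_eq_square)
    then have "cmod (neumann_pole_part k - (- a1) / k) = cmod (f k) / ((cmod k)\<^sup>2 * cmod (1 - exp (- (4 * \<i> * k * of_real L))))"
      unfolding E_square by (simp add: norm_divide norm_mult norm_power)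
    also have "\<dots> \<le> M / ((cmod k)\<^sup>2 * cmod (1 - exp (- (4 * \<i> * k * of_real L))))"
      by (intro divide_right_mono M k) auto
    finally show "cmod (neumann_pole_part k - (- a1) / k) \<le> M / ((cmod k)^2 * cmod (1 - exp (- (4 * \<i> * k * of_real L))))" .
  qed
qed

lemma hol_poles: "dirichlet_pole_part holomorphic_on slit_plane L" "neumann_pole_part holomorphic_on slit_plane L"
  unfolding dirichlet_pole_part_def[abs_def] neumann_pole_part_def[abs_def] using one_minus_E_square
  by (auto intro!: holomorphic_intros holomorphic_on_subset[OF hol_W(1)] holomorphic_on_subset[OF hol_W(2)] holomorphic_on_subset[OF hol_XY(3)])

lemma Delta_E: "Delta L k = (1 - (E k)\<^sup>2) / E k" "Sigma_fun L k = (1 + (E k)\<^sup>2) / E k"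
proof -
  have "exp (2 * \<i> * k * of_real L) = inverse (E k)" by (simp add: E_def exp_minus)
  then show "Delta L k = (1 - (E k)\<^sup>2) / E k" "Sigma_fun L k = (1 + (E k)\<^sup>2) / E k"
    unfolding Delta_def Sigma_fun_def E_def[symmetric] using E_minus(2)[of k]
    by (simp_all add: field_simps power2_eq_square)
qed

section \<open>Splitting of the integrands at x = 0 and their limits\<close>

definition "dirichlet_integrand k = Sigma_fun L k / (2 * Delta L k) * (k * minus_part F1 k + \<i> * g0)
          - 1 / Delta L k * (k * minus_part f1 k + \<i> * h0)
          + g0 / (4 * \<i>) * minus_part f2 k
          + \<i> * g0 / 2 * minus_part F2 k
          + k / Delta L k * minus_part (\<lambda>l.
              (cnj (f2 (cnj l)) - 1) * F1 l * exp (- (2 * \<i> * l * of_real L))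
              - f1 l * (cnj (F2 (cnj l)) - 1)) k"

definition "neumann_integrand k = 1 / Delta L k *
          (Sigma_fun L k / 2 * plus_part F1 k - plus_part f1 k
          + plus_part (\<lambda>l.
              F1 l * (cnj (f2 (cnj l)) - 1) * exp (- (2 * \<i> * l * of_real L))
              - (cnj (F2 (cnj l)) - 1) * f1 l) k)"

text \<open>E Delta = 1 - E^2 is the common denominator, with numerator \<open>U\<close>. The two -1
  in the bracket cancel the terms k phi_{1-} and leave of Phi_1 the amount (1 - E^2)/2 times k
  (Phi_1(k) + Phi_1(-k)), which is the odd difference of k Phi_1; the rest is
  \<open>dirichlet_pole_part\<close>.\<close>

lemma dirichlet_integrand_split:
  assumes "k \<in> slit_plane L"
  shows "dirichlet_integrand k = (k * F1 k - (- k) * F1 (- k)) / 2 + dirichlet_pole_part k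
    + g0 / (4 * \<i>) * (f2 k - f2 (- k)) + \<i> * g0 / 2 * (F2 k - F2 (- k))"
proof -
  define e where "e = E k"
  have e: "e \<noteq> 0" "1 - e\<^sup>2 \<noteq> 0" unfolding e_def using E_minus(2) one_minus_E_square[OF assms] by auto
  have em: "E (- k) = inverse e" unfolding e_def by (rule E_minus)
  have a: "a1 = - (\<i> * g0 / 2)" "\<alpha>1 = - (\<i> * h0 / 2)" by (simp_all add: a1_def \<alpha>1_def)
  define B where "B = (star f2 k - 1) * F1 k * e - f1 k * (star F2 k - 1)
     - ((star f2 (- k) - 1) * F1 (- k) * inverse e - f1 (- k) * (star F2 (- k) - 1))"
  define U where "U = (1 + e\<^sup>2) * (k * (F1 k - F1 (- k)) + \<i> * g0) / 2 - e * (k * (f1 k - f1 (- k)) + \<i> * h0) + k * e * B"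
  have "U = (1 - e\<^sup>2) * ((k * F1 k - (- k) * F1 (- k)) / 2) + (k * Wm k - a1 * (1 + e\<^sup>2) + 2 * e * \<alpha>1)"
    unfolding U_def B_def Wm_def X_def Y_def e_def[symmetric] a using e(1) by (simp add: field_simps power2_eq_square)
  then have U: "U / (1 - e\<^sup>2) = (k * F1 k - (- k) * F1 (- k)) / 2 + dirichlet_pole_part k"
    unfolding dirichlet_pole_part_def e_def[symmetric] using e(2) by (simp add: add_divide_distrib)
  have "dirichlet_integrand k = U / (1 - e\<^sup>2) + g0 / (4 * \<i>) * (f2 k - f2 (- k)) + \<i> * g0 / 2 * (F2 k - F2 (- k))"
  proof -
    have "minus_part (\<lambda>l. (cnj (f2 (cnj l)) - 1) * F1 l * exp (- (2 * \<i> * l * of_real L)) - f1 l * (cnj (F2 (cnj l)) - 1)) k = B"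
      unfolding minus_part_def B_def star_def[symmetric] E_def[symmetric] em e_def ..
    then have "dirichlet_integrand k = (1 + e\<^sup>2) / e / (2 * ((1 - e\<^sup>2) / e)) * (k * (F1 k - F1 (- k)) + \<i> * g0)
          - 1 / ((1 - e\<^sup>2) / e) * (k * (f1 k - f1 (- k)) + \<i> * h0)
          + g0 / (4 * \<i>) * (f2 k - f2 (- k)) + \<i> * g0 / 2 * (F2 k - F2 (- k)) + k / ((1 - e\<^sup>2) / e) * B"
      unfolding dirichlet_integrand_def Delta_E e_def[symmetric] minus_part_def by simp
    moreover have "(1 + e\<^sup>2) / e / (2 * ((1 - e\<^sup>2) / e)) = (1 + e\<^sup>2) / 2 / (1 - e\<^sup>2)" "1 / ((1 - e\<^sup>2) / e) = e / (1 - e\<^sup>2)"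
      "k / ((1 - e\<^sup>2) / e) = k * e / (1 - e\<^sup>2)"
      using e by simp_all
    ultimately have i: "dirichlet_integrand k = (1 + e\<^sup>2) / 2 / (1 - e\<^sup>2) * (k * (F1 k - F1 (- k)) + \<i> * g0)
          - e / (1 - e\<^sup>2) * (k * (f1 k - f1 (- k)) + \<i> * h0)
          + g0 / (4 * \<i>) * (f2 k - f2 (- k)) + \<i> * g0 / 2 * (F2 k - F2 (- k)) + k * e / (1 - e\<^sup>2) * B"
      by (simp only:)
    have "(p * x / 2 - s * y + r * z) / d = p / 2 / d * x - s / d * y + r / d * z" for p x s y r z d :: complex
      by (simp add: add_divide_distrib diff_divide_distrib)
    then have "U / (1 - e\<^sup>2) = (1 + e\<^sup>2) / 2 / (1 - e\<^sup>2) * (k * (F1 k - F1 (- k)) + \<i> * g0)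
          - e / (1 - e\<^sup>2) * (k * (f1 k - f1 (- k)) + \<i> * h0) + k * e / (1 - e\<^sup>2) * B"
      unfolding U_def .
    then show ?thesis unfolding i by (simp only: add.assoc add.commute[of "k * e / (1 - e\<^sup>2) * B"])
  qed
  then show ?thesis unfolding U .
qed

text \<open>The same cancellation with sums in place of differences: the terms phi_{1+} disappear,
  and Phi_1 leaves (1 - E^2)/2 times its odd difference.\<close>

lemma neumann_integrand_split:
  assumes "k \<in> slit_plane L"
  shows "neumann_integrand k = (F1 k - F1 (- k)) / 2 + neumann_pole_part k"
proof -
  define e where "e = E k"
  have e: "e \<noteq> 0" "1 - e\<^sup>2 \<noteq> 0" unfolding e_def using E_minus(2) one_minus_E_square[OF assms] by auto
  have em: "E (- k) = inverse e" unfolding e_def by (rule E_minus)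
  define B where "B = F1 k * (star f2 k - 1) * e - (star F2 k - 1) * f1 k
     + (F1 (- k) * (star f2 (- k) - 1) * inverse e - (star F2 (- k) - 1) * f1 (- k))"
  define U where "U = (1 + e\<^sup>2) * (F1 k + F1 (- k)) / 2 - e * (f1 k + f1 (- k)) + e * B"
  have Usplit: "U = (1 - e\<^sup>2) * ((F1 k - F1 (- k)) / 2) + Wp k"
    unfolding U_def B_def Wp_def X_def Y_def e_def[symmetric] using e(1) by (simp add: field_simps power2_eq_square)
  have U: "U / (1 - e\<^sup>2) = (F1 k - F1 (- k)) / 2 + neumann_pole_part k"
  proof -
    have "((1 - e\<^sup>2) * x + w) / (1 - e\<^sup>2) = x + w / (1 - e\<^sup>2)" for x w using e(2) by (simp add: add_divide_distrib)
    then show ?thesis unfolding neumann_pole_part_def e_def[symmetric] Usplit .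
  qed
  have "plus_part (\<lambda>l. F1 l * (cnj (f2 (cnj l)) - 1) * exp (- (2 * \<i> * l * of_real L)) - (cnj (F2 (cnj l)) - 1) * f1 l) k = B"
    unfolding plus_part_def B_def star_def[symmetric] E_def[symmetric] em e_def ..
  then have "neumann_integrand k = 1 / ((1 - e\<^sup>2) / e) * ((1 + e\<^sup>2) / e / 2 * (F1 k + F1 (- k)) - (f1 k + f1 (- k)) + B)"
    unfolding neumann_integrand_def Delta_E e_def[symmetric] plus_part_def by simp
  also have "\<dots> = U / (1 - e\<^sup>2)"
    unfolding U_def using e by (simp add: divide_simps) (simp add: algebra_simps)
  finally show ?thesis unfolding U .
qed

lemma boundary_values:
  assumes \<gamma>: "deformed_bdry_D3 L \<gamma>"
  shows "\<exists>J. has_improper_integral \<gamma> dirichlet_integrand J \<and> g1 = 4 / (of_real pi * \<i>) * J" (is ?D)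
    and "\<exists>J. has_improper_integral \<gamma> neumann_integrand J \<and> g0 = 2 / of_real pi * J" (is ?N)
proof -
  obtain \<psi> :: "real \<Rightarrow> real" and D c where Dc: "D > 0" "c > 0"
    and ev: "\<forall>\<^sub>F R in at_top. 0 \<le> \<psi> R \<and> \<psi> R \<le> D / R\<^sup>2 \<and>
      (\<forall>n::nat. c / (real n + 1) \<le> cmod (- of_real R * cis (\<psi> R) - of_real (- (real n * pi / (2 * L))))) \<and>
      (\<forall>f H U. open U \<longrightarrow> range \<gamma> \<subseteq> U \<longrightarrow> (\<forall>z\<in>U. (H has_field_derivative f z) (at z)) \<longrightarrow>
          truncated_integral \<gamma> R f = H (- of_real R * cis (\<psi> R)) - H (- \<i> * of_real R))"
    using truncated_contour_end[OF \<gamma>] by blast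
  have ev1: "\<forall>\<^sub>F R in at_top. 0 \<le> \<psi> R \<and> \<psi> R \<le> D / R\<^sup>2" using ev by eventually_elim auto
  have ev2: "\<forall>\<^sub>F R in at_top. 0 \<le> \<psi> R \<and> \<psi> R \<le> D / R\<^sup>2 \<and>
      (\<forall>n::nat. c / (real n + 1) \<le> cmod (- of_real R * cis (\<psi> R) - of_real (- (real n * pi / (2 * L)))))"
    using ev by eventually_elim auto
  have fin: "has_improper_integral \<gamma> f J"
    if H: "\<And>z. z \<in> slit_plane L \<Longrightarrow> (H has_field_derivative f z) (at z)"
      and lim: "((\<lambda>R. H (- of_real R * cis (\<psi> R)) - H (- \<i> * of_real R)) \<longlongrightarrow> J) at_top" for f H J
    unfolding has_improper_integral_def
  proof (rule Lim_transform_eventually[OF lim])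
    show "\<forall>\<^sub>F R in at_top. H (- of_real R * cis (\<psi> R)) - H (- \<i> * of_real R) = truncated_integral \<gamma> R f"
      using ev
    proof eventually_elim
      case (elim R)
      then have "open (slit_plane L) \<longrightarrow> range \<gamma> \<subseteq> slit_plane L \<longrightarrow> (\<forall>z\<in>slit_plane L. (H has_field_derivative f z) (at z)) \<longrightarrow>
          truncated_integral \<gamma> R f = H (- of_real R * cis (\<psi> R)) - H (- \<i> * of_real R)" by blast
      then show ?case using open_slit_plane contour_in_slit_plane[OF \<gamma> L] H by auto
    qed
  qed
  \<comment> \<open>Multiplication by k moves a1 into the constant term, which the odd difference
    does not see, and a2 into the coefficient of 1/k.\<close>
  have asyG: "strip_bound D 2 (\<lambda>k. k * F1 k - (a1 + a2 / k))"
    and asyF1': "strip_bound D 2 (\<lambda>k. F1 k - (0 + a1 / k))"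
  proof -
    define r where "r k = F1 k - (a1 / k + a2 / k\<^sup>2)" for k
    have r: "strip_bound D (Suc 2) r"
      using asyF1[of D] unfolding r_def[abs_def] a1_def a2_def by (simp add: eval_nat_numeral)
    have "k * r k = k * F1 k - (a1 + a2 / k)" "r k + a2 / k\<^sup>2 = F1 k - (0 + a1 / k)" if "k \<noteq> 0" for k
      using that by (simp_all add: r_def field_simps power2_eq_square)
    note eqs = this
    show "strip_bound D 2 (\<lambda>k. k * F1 k - (a1 + a2 / k))"
      by (rule iffD1[OF strip_bound_cong[OF eqs(1)] strip_bound_lower(1)[OF r less_imp_le[OF Dc(1)]]])
    show "strip_bound D 2 (\<lambda>k. F1 k - (0 + a1 / k))"
      by (rule iffD1[OF strip_bound_cong[OF eqs(2)] strip_bound_add_inverse_power[OF strip_bound_lower(2)[OF r less_imp_le[OF Dc(1)]]]])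
  qed
  have holG: "(\<lambda>k. k * F1 k) holomorphic_on UNIV" by (intro holomorphic_intros hol)
  obtain HG where HG: "\<And>z. (HG has_field_derivative z * F1 z - (- z) * F1 (- z)) (at z)"
    "((\<lambda>R. HG (- of_real R * cis (\<psi> R)) - HG (- \<i> * of_real R)) \<longlongrightarrow> \<i> * of_real pi * a2) at_top"
    using odd_difference_limit[OF Dc(1) ev1 holG asyG] by blast
  obtain HF where HF: "\<And>z. (HF has_field_derivative F1 z - F1 (- z)) (at z)"
    "((\<lambda>R. HF (- of_real R * cis (\<psi> R)) - HF (- \<i> * of_real R)) \<longlongrightarrow> \<i> * of_real pi * a1) at_top"
    using odd_difference_limit[OF Dc(1) ev1 hol(1) asyF1'] by blast
  obtain H1 where H1: "\<And>z. (H1 has_field_derivative F2 z - F2 (- z)) (at z)"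
    "((\<lambda>R. H1 (- of_real R * cis (\<psi> R)) - H1 (- \<i> * of_real R)) \<longlongrightarrow> \<i> * of_real pi * b) at_top"
    using odd_difference_limit[OF Dc(1) ev1 hol(2) asyF2] by blast
  obtain H2 where H2: "\<And>z. (H2 has_field_derivative f2 z - f2 (- z)) (at z)"
    "((\<lambda>R. H2 (- of_real R * cis (\<psi> R)) - H2 (- \<i> * of_real R)) \<longlongrightarrow> \<i> * of_real pi * \<beta>) at_top"
    using odd_difference_limit[OF Dc(1) ev1 hol(4) asyf2] by blast
  obtain MD where MD: "\<And>k. 1 \<le> cmod k \<Longrightarrow> Re k \<le> 0 \<Longrightarrow> Im k \<le> 0 \<Longrightarrow> k \<in> slit_plane L \<Longrightarrow>
        cmod (dirichlet_pole_part k - (- A2) / k) \<le> MD / ((cmod k)^2 * cmod (1 - exp (- (4 * \<i> * k * of_real L))))"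
    using dirichlet_pole_part_bound by blast
  obtain MN where MN: "\<And>k. 1 \<le> cmod k \<Longrightarrow> Re k \<le> 0 \<Longrightarrow> Im k \<le> 0 \<Longrightarrow> k \<in> slit_plane L \<Longrightarrow>
        cmod (neumann_pole_part k - (- a1) / k) \<le> MN / ((cmod k)^2 * cmod (1 - exp (- (4 * \<i> * k * of_real L))))"
    using neumann_pole_part_bound by blast
  obtain HD where HD: "\<And>z. z \<in> slit_plane L \<Longrightarrow> (HD has_field_derivative dirichlet_pole_part z) (at z)"
    "((\<lambda>R. HD (- of_real R * cis (\<psi> R)) - HD (- \<i> * of_real R)) \<longlongrightarrow> - \<i> * of_real pi * (- A2) / 2) at_top"
    using pole_part_limit[OF L Dc ev2 hol_poles(1) MD] by blast
  obtain HN where HN: "\<And>z. z \<in> slit_plane L \<Longrightarrow> (HN has_field_derivative neumann_pole_part z) (at z)"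
    "((\<lambda>R. HN (- of_real R * cis (\<psi> R)) - HN (- \<i> * of_real R)) \<longlongrightarrow> - \<i> * of_real pi * (- a1) / 2) at_top"
    using pole_part_limit[OF L Dc ev2 hol_poles(2) MN] by blast
  \<comment> \<open>The first two summands give i pi (a2 - a1 beta/2). With a1 = g0/(2i) and a2 =
    g1/4 + g0 b/(2i), the third cancels the contribution of beta and the fourth that of b, which
    leaves i pi g1/4.\<close>
  define JD where "JD = (\<i> * of_real pi * a2) / 2 + (- \<i> * of_real pi * (- A2) / 2)
      + g0 / (4 * \<i>) * (\<i> * of_real pi * \<beta>) + \<i> * g0 / 2 * (\<i> * of_real pi * b)"
  have "has_improper_integral \<gamma> dirichlet_integrand JD"
  proof (rule fin[where H = "\<lambda>z. HG z / 2 + HD z + g0 / (4 * \<i>) * H2 z + \<i> * g0 / 2 * H1 z"])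
    show "((\<lambda>z. HG z / 2 + HD z + g0 / (4 * \<i>) * H2 z + \<i> * g0 / 2 * H1 z) has_field_derivative dirichlet_integrand z) (at z)"
      if z: "z \<in> slit_plane L" for z
      unfolding dirichlet_integrand_split[OF z]
      by (intro DERIV_add DERIV_cmult DERIV_cdivide HG(1) HD(1) H1(1) H2(1) z)
    have "((\<lambda>R. (HG (- of_real R * cis (\<psi> R)) - HG (- \<i> * of_real R)) / 2 + (HD (- of_real R * cis (\<psi> R)) - HD (- \<i> * of_real R))
         + g0 / (4 * \<i>) * (H2 (- of_real R * cis (\<psi> R)) - H2 (- \<i> * of_real R))
         + \<i> * g0 / 2 * (H1 (- of_real R * cis (\<psi> R)) - H1 (- \<i> * of_real R))) \<longlongrightarrow> JD) at_top"
      unfolding JD_def by (intro tendsto_add tendsto_divide tendsto_mult tendsto_const HG HD H1 H2) auto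
    then show "((\<lambda>R. (HG (- of_real R * cis (\<psi> R)) / 2 + HD (- of_real R * cis (\<psi> R)) + g0 / (4 * \<i>) * H2 (- of_real R * cis (\<psi> R))
         + \<i> * g0 / 2 * H1 (- of_real R * cis (\<psi> R)))
        - (HG (- \<i> * of_real R) / 2 + HD (- \<i> * of_real R) + g0 / (4 * \<i>) * H2 (- \<i> * of_real R) + \<i> * g0 / 2 * H1 (- \<i> * of_real R))) \<longlongrightarrow> JD) at_top"
      by (rule Lim_transform_eventually) (simp add: diff_divide_distrib right_diff_distrib)
  qed
  moreover have "g1 = 4 / (of_real pi * \<i>) * JD"
    unfolding JD_def A2_def a2_def a1_def by (simp add: field_simps)
  ultimately show ?D by blast
  \<comment> \<open>The odd difference and the part with poles contribute i pi a1/2 each, altogether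
    pi g0/2.\<close>
  define JN where "JN = (\<i> * of_real pi * a1) / 2 + (- \<i> * of_real pi * (- a1) / 2)"
  have "has_improper_integral \<gamma> neumann_integrand JN"
  proof (rule fin[where H = "\<lambda>z. HF z / 2 + HN z"])
    show "((\<lambda>z. HF z / 2 + HN z) has_field_derivative neumann_integrand z) (at z)"
      if z: "z \<in> slit_plane L" for z
      unfolding neumann_integrand_split[OF z]
      by (intro DERIV_add DERIV_cdivide HF(1) HN(1) z)
    have "((\<lambda>R. (HF (- of_real R * cis (\<psi> R)) - HF (- \<i> * of_real R)) / 2 + (HN (- of_real R * cis (\<psi> R)) - HN (- \<i> * of_real R))) \<longlongrightarrow> JN) at_top"
      unfolding JN_def by (intro tendsto_add tendsto_divide tendsto_const HF HN) auto
    then show "((\<lambda>R. (HF (- of_real R * cis (\<psi> R)) / 2 + HN (- of_real R * cis (\<psi> R)))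
        - (HF (- \<i> * of_real R) / 2 + HN (- \<i> * of_real R))) \<longlongrightarrow> JN) at_top"
      by (rule Lim_transform_eventually) (simp add: diff_divide_distrib)
  qed
  moreover have "g0 = 2 / of_real pi * JN"
    unfolding JN_def a1_def by (simp add: field_simps)
  ultimately show ?N by blast
qed

text \<open>The reflection x -> L - x, combined with k -> -k, exchanges the two ends: q_x changes
  sign, (Phi_1, Phi_2)(k) becomes (-phi_1, phi_2)(-k), and the connection coefficient becomes exp
  (2ikL) c(-k).\<close>

lemma reflected: "boundary_spectral_data L h0 (- h1) g0 (- g1) (- \<beta>) (- b) (\<lambda>k. - f1 (- k)) (\<lambda>k. f2 (- k)) (\<lambda>k. - F1 (- k)) (\<lambda>k. F2 (- k))"
proof
  show "0 < L" by (rule L)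
  have holm: "(\<lambda>k. f (- k)) holomorphic_on UNIV" if "f holomorphic_on UNIV" for f :: "complex \<Rightarrow> complex"
  proof -
    have "(\<lambda>k::complex. - k) holomorphic_on UNIV" by (intro holomorphic_intros)
    from holomorphic_on_compose[OF this holomorphic_on_subset[OF that]] show ?thesis by (simp add: o_def)
  qed
  show "(\<lambda>k. - f1 (- k)) holomorphic_on UNIV" "(\<lambda>k. f2 (- k)) holomorphic_on UNIV"
    "(\<lambda>k. - F1 (- k)) holomorphic_on UNIV" "(\<lambda>k. F2 (- k)) holomorphic_on UNIV"
    by (intro holomorphic_on_minus holm hol)+
  have eqs: "- f (- k) - (x / (2 * \<i>) / k + (- y / 4 + x * (- z) / (2 * \<i>)) / k\<^sup>2)
        = - (f (- k) - (x / (2 * \<i>) / (- k) + (y / 4 + x * z / (2 * \<i>)) / (- k)\<^sup>2))"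
    "f (- k) - (1 + (- z) / k) = f (- k) - (1 + z / (- k))" for f :: "complex \<Rightarrow> complex" and k x y z
    by (simp_all add: add_divide_distrib diff_divide_distrib)
  show "strip_bound K 3 (\<lambda>k. - f1 (- k) - (h0 / (2 * \<i>) / k + (- h1 / 4 + h0 * (- \<beta>) / (2 * \<i>)) / k\<^sup>2))" for K
    unfolding eqs(1)[where f = f1 and x = h0 and y = h1 and z = \<beta>] by (rule strip_bound_reflect(2)[OF asyf1])
  show "strip_bound K 3 (\<lambda>k. - F1 (- k) - (g0 / (2 * \<i>) / k + (- g1 / 4 + g0 * (- b) / (2 * \<i>)) / k\<^sup>2))" for K
    unfolding eqs(1)[where f = F1 and x = g0 and y = g1 and z = b] by (rule strip_bound_reflect(2)[OF asyF1])
  show "strip_bound K 2 (\<lambda>k. f2 (- k) - (1 + (- \<beta>) / k))" for K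
    unfolding eqs(2)[where f = f2 and z = \<beta>] by (rule strip_bound_reflect(1)[OF asyf2])
  show "strip_bound K 2 (\<lambda>k. F2 (- k) - (1 + (- b) / k))" for K
    unfolding eqs(2)[where f = F2 and z = b] by (rule strip_bound_reflect(1)[OF asyF2])
  show "cnj (- \<beta>) = - (- \<beta>)" "cnj (- b) = - (- b)" using imag by auto
  define c where "c k = F1 k * star f2 k - star F2 k * f1 k * exp (2 * \<i> * k * of_real L)" for k
  have c: "exp_type c" using exp_c unfolding c_def[abs_def] .
  have "exp_type (\<lambda>k. exp ((2 * \<i> * of_real L) * k) * c (- k))" by (intro exp_type_intros c)
  moreover have "(\<lambda>k. exp ((2 * \<i> * of_real L) * k) * c (- k)) = (\<lambda>k. - f1 (- k) * star (\<lambda>k. F2 (- k)) k - star (\<lambda>k. f2 (- k)) k * - F1 (- k) * exp (2 * \<i> * k * of_real L))"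
  proof
    fix k
    have "exp (2 * \<i> * (- k) * of_real L) * exp (2 * \<i> * k * of_real L) = 1" by (simp add: exp_add[symmetric])
    moreover have "(2 * \<i> * of_real L) * k = 2 * \<i> * k * of_real L" by simp
    ultimately show "exp ((2 * \<i> * of_real L) * k) * c (- k) = - f1 (- k) * star (\<lambda>k. F2 (- k)) k - star (\<lambda>k. f2 (- k)) k * - F1 (- k) * exp (2 * \<i> * k * of_real L)"
      unfolding c_def star_def by (simp only: complex_cnj_minus) algebra
  qed
  ultimately show "exp_type (\<lambda>k. - f1 (- k) * star (\<lambda>k. F2 (- k)) k - star (\<lambda>k. f2 (- k)) k * - F1 (- k) * exp (2 * \<i> * k * of_real L))"
    by simp
qed

end

section \<open>Large \<open>k\<close> behaviour of the time evolution\<close>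

text \<open>The differential form of the Volterra equations, one-sided at the ends of the interval.
  |g0|^2 is written as a product with the conjugate, so that identities between solutions are
  polynomial.\<close>

definition t_part_system :: "complex \<Rightarrow> real \<Rightarrow> (real \<Rightarrow> complex) \<Rightarrow> (real \<Rightarrow> complex) \<Rightarrow> complex \<Rightarrow> (real \<Rightarrow> complex) \<Rightarrow> (real \<Rightarrow> complex) \<Rightarrow> bool" where
  "t_part_system lam T g0 g1 k f1 f2 \<longleftrightarrow> (\<forall>t\<in>{0..T}.
     (f1 has_vector_derivative (- 4 * \<i> * k\<^sup>2 * f1 t - \<i> * lam * (g0 t * cnj (g0 t)) * f1 t
        + (2 * k * g0 t + \<i> * g1 t) * f2 t)) (at t within {0..T}) \<and>
     (f2 has_vector_derivative (lam * ((2 * k * cnj (g0 t) - \<i> * cnj (g1 t)) * f1 t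
        + \<i> * (g0 t * cnj (g0 t)) * f2 t))) (at t within {0..T}))"

lemma gronwall:
  fixes u :: "real \<Rightarrow> real"
  assumes cont: "continuous_on {0..T} u" and "C \<ge> 0"
    and le: "\<And>t. t \<in> {0..T} \<Longrightarrow> u t \<le> a + C * integral {0..t} u"
    and t: "t \<in> {0..T}"
  shows "u t \<le> a * exp (C * t)"
proof -
  define W where "W s = a + C * integral {0..s} u" for s
  have W: "(W has_real_derivative C * u s) (at s within {0..T})" if "s \<in> {0..T}" for s
    unfolding W_def using integral_has_real_derivative[OF cont that]
    by (auto intro!: derivative_eq_intros)
  define V where "V s = exp (- C * s) * W s" for s
  have V: "(V has_real_derivative exp (- C * s) * (C * u s - C * W s)) (at s within {0..T})" if "s \<in> {0..T}" for s
    unfolding V_def by (rule derivative_eq_intros W[OF that] refl)+ (simp add: algebra_simps)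
  have "V t \<le> V 0"
  proof (rule DERIV_nonpos_imp_decreasing_open[of 0 t V])
    show "0 \<le> t" using t by simp
    show "continuous_on {0..t} V"
      by (rule continuous_on_subset[OF DERIV_continuous_on[OF V]]) (use t in auto)
    fix x assume x: "0 < x" "x < t"
    then have "(V has_real_derivative exp (- C * x) * (C * u x - C * W x)) (at x)"
      using V[of x] t by (simp add: at_within_Icc_at)
    moreover have "C * u x \<le> C * W x" unfolding W_def using le[of x] x t \<open>C \<ge> 0\<close> by (intro mult_left_mono) auto
    ultimately show "\<exists>y. (V has_real_derivative y) (at x) \<and> y \<le> 0" by (intro exI conjI) (auto intro: mult_nonneg_nonpos)
  qed
  then have "exp (C * t) * V t \<le> exp (C * t) * a" unfolding V_def[of 0] W_def by (intro mult_left_mono) auto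
  moreover have "exp (C * t) * V t = W t" by (simp add: V_def exp_minus)
  moreover have "u t \<le> W t" unfolding W_def using le[OF t] .
  ultimately show ?thesis unfolding mult.commute[of a] by linarith
qed

text \<open>Variation of constants. An upper bound on Re w alone controls exp (w (t - s)) for s up
  to t; for w = -4ik^2 this makes the estimate uniform over all k with Re k Im k bounded
  above.\<close>

lemma duhamel_bound:
  fixes f F :: "real \<Rightarrow> complex"
  assumes d: "\<And>t. t \<in> {0..T} \<Longrightarrow> (f has_vector_derivative w * f t + F t) (at t within {0..T})"
    and cF: "continuous_on {0..T} F" and cG: "continuous_on {0..T} G"
    and FG: "\<And>t. t \<in> {0..T} \<Longrightarrow> cmod (F t) \<le> G t"
    and w: "Re w \<le> \<kappa>" "0 \<le> \<kappa>" and t: "t \<in> {0..T}"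
  shows "cmod (f t) \<le> exp (\<kappa> * T) * (cmod (f 0) + integral {0..t} G)"
proof -
  define h where "h s = exp (- w * of_real s) * f s" for s
  have sub: "{0..t} \<subseteq> {0..T}" using t by auto
  have "((\<lambda>s. exp (- w * of_real s) * F s) has_integral (h t - h 0)) {0..t}"
  proof (rule fundamental_theorem_of_calculus)
    show "0 \<le> t" using t by simp
    fix s assume s: "s \<in> {0..t}"
    have e: "((\<lambda>s. exp (- w * of_real s)) has_vector_derivative - w * exp (- w * of_real s)) (at s within {0..t})"
      by (rule has_vector_derivative_real_field[THEN has_vector_derivative_at_within]) (auto intro!: derivative_eq_intros)
    have "(f has_vector_derivative w * f s + F s) (at s within {0..t})"
      using has_vector_derivative_within_subset[OF d sub] s t by auto
    from has_vector_derivative_mult[OF e this]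
    show "(h has_vector_derivative exp (- w * of_real s) * F s) (at s within {0..t})"
      unfolding h_def by (simp add: algebra_simps)
  qed
  then have eq: "h t = h 0 + integral {0..t} (\<lambda>s. exp (- w * of_real s) * F s)" by (simp add: integral_unique)
  have "f t = exp (w * of_real t) * h t" by (simp add: h_def mult.assoc[symmetric] exp_add[symmetric])
  also have "\<dots> = exp (w * of_real t) * f 0 + exp (w * of_real t) * integral {0..t} (\<lambda>s. exp (- w * of_real s) * F s)"
    unfolding eq by (simp add: h_def algebra_simps)
  also have "exp (w * of_real t) * integral {0..t} (\<lambda>s. exp (- w * of_real s) * F s)
     = integral {0..t} (\<lambda>s. exp (w * of_real (t - s)) * F s)"
    unfolding integral_mult_right[symmetric]
  proof (rule integral_cong)
    fix s
    have "exp (w * of_real (t - s)) = exp (w * of_real t) * exp (- w * of_real s)"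
      unfolding exp_add[symmetric] by (simp add: algebra_simps)
    then show "exp (w * of_real t) * (exp (- w * of_real s) * F s) = exp (w * of_real (t - s)) * F s" by simp
  qed
  finally have ft: "f t = exp (w * of_real t) * f 0 + integral {0..t} (\<lambda>s. exp (w * of_real (t - s)) * F s)" .
  have eb: "cmod (exp (w * of_real s)) \<le> exp (\<kappa> * T)" if "s \<in> {0..T}" for s
  proof -
    have "Re w * s \<le> \<kappa> * s" using w that by (intro mult_right_mono) auto
    also have "\<dots> \<le> \<kappa> * T" using w that by (intro mult_left_mono) auto
    finally have "Re w * s \<le> \<kappa> * T" .
    then show ?thesis by simp
  qed
  have "cmod (integral {0..t} (\<lambda>s. exp (w * of_real (t - s)) * F s)) \<le> integral {0..t} (\<lambda>s. exp (\<kappa> * T) * G s)"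
  proof (rule integral_norm_bound_integral)
    show "(\<lambda>s. exp (w * of_real (t - s)) * F s) integrable_on {0..t}"
      by (intro integrable_continuous_interval continuous_intros continuous_on_subset[OF cF sub])
    show "(\<lambda>s. exp (\<kappa> * T) * G s) integrable_on {0..t}"
      by (intro integrable_continuous_interval continuous_intros continuous_on_subset[OF cG sub])
    show "cmod (exp (w * of_real (t - s)) * F s) \<le> exp (\<kappa> * T) * G s" if "s \<in> {0..t}" for s
      unfolding norm_mult using that t by (intro mult_mono eb FG) auto
  qed
  also have "\<dots> = exp (\<kappa> * T) * integral {0..t} G" by simp
  finally have "cmod (f t) \<le> cmod (exp (w * of_real t) * f 0) + exp (\<kappa> * T) * integral {0..t} G"
    unfolding ft by (intro norm_triangle_le add_left_mono)
  also have "cmod (exp (w * of_real t) * f 0) \<le> exp (\<kappa> * T) * cmod (f 0)"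
    unfolding norm_mult using t by (intro mult_right_mono eb) auto
  finally show ?thesis by (simp add: algebra_simps)
qed

section \<open>Coefficients of class C^1 in time, with powers of 1/k\<close>

definition C1_fun :: "real \<Rightarrow> (real \<Rightarrow> complex) \<Rightarrow> bool" where
  "C1_fun T f \<longleftrightarrow> (\<exists>f'. continuous_on {0..T} f' \<and> (\<forall>t\<in>{0..T}. (f has_vector_derivative f' t) (at t within {0..T})))"

lemma has_vector_derivative_imp_continuous_on:
  fixes f :: "real \<Rightarrow> complex"
  assumes "\<And>t. t \<in> {0..T} \<Longrightarrow> (f has_vector_derivative f' t) (at t within {0..T})"
  shows "continuous_on {0..T} f"
  using assms has_vector_derivative_continuous by (fastforce simp: continuous_on_eq_continuous_within)

lemma C1_fun_continuous: "C1_fun T f \<Longrightarrow> continuous_on {0..T} f"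
  unfolding C1_fun_def using has_vector_derivative_imp_continuous_on by blast

lemma C1_fun_const: "C1_fun T (\<lambda>t. c)"
  unfolding C1_fun_def by (intro exI[of _ "\<lambda>t. 0"]) auto

lemma C1_fun_mult:
  assumes "C1_fun T f" "C1_fun T g"
  shows "C1_fun T (\<lambda>t. f t * g t)"
proof -
  obtain f' where f': "continuous_on {0..T} f'" "\<forall>t\<in>{0..T}. (f has_vector_derivative f' t) (at t within {0..T})"
    using assms(1) unfolding C1_fun_def by blast
  obtain g' where g': "continuous_on {0..T} g'" "\<forall>t\<in>{0..T}. (g has_vector_derivative g' t) (at t within {0..T})"
    using assms(2) unfolding C1_fun_def by blast
  show ?thesis unfolding C1_fun_def
    by (rule exI[of _ "\<lambda>t. f t * g' t + f' t * g t"])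
      (use f' g' C1_fun_continuous[OF assms(1)] C1_fun_continuous[OF assms(2)] in \<open>auto intro!: continuous_intros has_vector_derivative_mult\<close>)
qed

lemma C1_fun_add:
  assumes "C1_fun T f" "C1_fun T g"
  shows "C1_fun T (\<lambda>t. f t + g t)"
proof -
  obtain f' where f': "continuous_on {0..T} f'" "\<forall>t\<in>{0..T}. (f has_vector_derivative f' t) (at t within {0..T})"
    using assms(1) unfolding C1_fun_def by blast
  obtain g' where g': "continuous_on {0..T} g'" "\<forall>t\<in>{0..T}. (g has_vector_derivative g' t) (at t within {0..T})"
    using assms(2) unfolding C1_fun_def by blast
  show ?thesis unfolding C1_fun_def
    by (rule exI[of _ "\<lambda>t. f' t + g' t"]) (use f' g' in \<open>auto intro!: continuous_intros has_vector_derivative_add\<close>)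
qed

lemma C1_fun_minus: "C1_fun T f \<Longrightarrow> C1_fun T (\<lambda>t. - f t)"
  using C1_fun_mult[OF C1_fun_const[of T "-1"], of f] by simp

lemma C1_fun_diff: "C1_fun T f \<Longrightarrow> C1_fun T g \<Longrightarrow> C1_fun T (\<lambda>t. f t - g t)"
  using C1_fun_add[OF _ C1_fun_minus, of T f g] by simp

lemma C1_fun_cnj:
  assumes "C1_fun T f"
  shows "C1_fun T (\<lambda>t. cnj (f t))"
proof -
  obtain f' where f': "continuous_on {0..T} f'" "\<forall>t\<in>{0..T}. (f has_vector_derivative f' t) (at t within {0..T})"
    using assms(1) unfolding C1_fun_def by blast
  show ?thesis unfolding C1_fun_def
    by (rule exI[of _ "\<lambda>t. cnj (f' t)"]) (use f' in \<open>auto intro!: continuous_intros has_vector_derivative_cnj\<close>)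
qed

lemmas C1_fun_intros = C1_fun_const C1_fun_mult C1_fun_add C1_fun_minus C1_fun_diff C1_fun_cnj

lemma continuous_bounded_Icc:
  fixes f :: "real \<Rightarrow> complex"
  assumes "continuous_on {0..T} f"
  obtains M where "M \<ge> 0" "\<And>t. t \<in> {0..T} \<Longrightarrow> cmod (f t) \<le> M"
proof -
  have "bounded (f ` {0..T})" using assms by (intro compact_imp_bounded compact_continuous_image) auto
  then obtain M where "\<And>t. t \<in> {0..T} \<Longrightarrow> cmod (f t) \<le> M" unfolding bounded_iff by blast
  then have "\<And>t. t \<in> {0..T} \<Longrightarrow> cmod (f t) \<le> max M 0" by fastforce
  then show ?thesis using that[of "max M 0"] by simp
qed

text \<open>Meant for polynomials in 1/k without constant term, such as the coefficients left over
  by the gauge below. The time derivative is controlled too, because the forcing is differentiated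
  once in the second step of the asymptotics.\<close>

definition small_family :: "real \<Rightarrow> (complex \<Rightarrow> real \<Rightarrow> complex) \<Rightarrow> bool" where
  "small_family T \<beta> \<longleftrightarrow> (\<exists>C \<beta>'. C \<ge> 0 \<and> (\<forall>k. 1 \<le> cmod k \<longrightarrow> continuous_on {0..T} (\<beta>' k) \<and>
     (\<forall>t\<in>{0..T}. (\<beta> k has_vector_derivative \<beta>' k t) (at t within {0..T}) \<and>
       cmod (\<beta> k t) \<le> C * cmod (inverse k) \<and> cmod (\<beta>' k t) \<le> C * cmod (inverse k))))"

lemma small_family_monom:
  assumes "C1_fun T f"
  shows "small_family T (\<lambda>k t. f t * inverse k ^ Suc m)"
proof -
  obtain f' where f': "continuous_on {0..T} f'" "\<forall>t\<in>{0..T}. (f has_vector_derivative f' t) (at t within {0..T})"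
    using assms(1) unfolding C1_fun_def by blast
  obtain A where A: "A \<ge> 0" "\<And>t. t \<in> {0..T} \<Longrightarrow> cmod (f t) \<le> A"
    using continuous_bounded_Icc[OF C1_fun_continuous[OF assms]] by blast
  obtain B where B: "B \<ge> 0" "\<And>t. t \<in> {0..T} \<Longrightarrow> cmod (f' t) \<le> B"
    using continuous_bounded_Icc[OF f'(1)] by blast
  have kb: "cmod (inverse k ^ Suc m) \<le> cmod (inverse k)" if "1 \<le> cmod k" for k :: complex
    using power_le_one[of "cmod (inverse k)" m] that
    by (simp add: norm_mult norm_power norm_inverse mult_left_le inverse_le_1_iff)
  show ?thesis unfolding small_family_def
  proof (intro exI[of _ "max A B"] exI[of _ "\<lambda>k t. f' t * inverse k ^ Suc m"] conjI allI impI ballI)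
    fix k :: complex and t assume k: "1 \<le> cmod k" and t: "t \<in> {0..T}"
    show "((\<lambda>t. f t * inverse k ^ Suc m) has_vector_derivative f' t * inverse k ^ Suc m) (at t within {0..T})"
      using f'(2) t by (intro has_vector_derivative_mult_left) auto
    show "cmod (f t * inverse k ^ Suc m) \<le> max A B * cmod (inverse k)"
      unfolding norm_mult using A(1) A(2)[OF t] kb[OF k] by (intro mult_mono) auto
    show "cmod (f' t * inverse k ^ Suc m) \<le> max A B * cmod (inverse k)"
      unfolding norm_mult using A(1) B(2)[OF t] kb[OF k] by (intro mult_mono) auto
  qed (use A B f' in \<open>auto intro!: continuous_intros\<close>)
qed

lemma small_family_add:
  assumes "small_family T \<alpha>" "small_family T \<beta>"
  shows "small_family T (\<lambda>k t. \<alpha> k t + \<beta> k t)"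
proof -
  obtain A \<alpha>' where A: "A \<ge> 0" "\<And>k. 1 \<le> cmod k \<Longrightarrow> continuous_on {0..T} (\<alpha>' k)"
    "\<And>k t. 1 \<le> cmod k \<Longrightarrow> t \<in> {0..T} \<Longrightarrow> (\<alpha> k has_vector_derivative \<alpha>' k t) (at t within {0..T}) \<and>
       cmod (\<alpha> k t) \<le> A * cmod (inverse k) \<and> cmod (\<alpha>' k t) \<le> A * cmod (inverse k)"
    using assms(1) unfolding small_family_def by blast
  obtain B \<beta>' where B: "B \<ge> 0" "\<And>k. 1 \<le> cmod k \<Longrightarrow> continuous_on {0..T} (\<beta>' k)"
    "\<And>k t. 1 \<le> cmod k \<Longrightarrow> t \<in> {0..T} \<Longrightarrow> (\<beta> k has_vector_derivative \<beta>' k t) (at t within {0..T}) \<and>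
       cmod (\<beta> k t) \<le> B * cmod (inverse k) \<and> cmod (\<beta>' k t) \<le> B * cmod (inverse k)"
    using assms(2) unfolding small_family_def by blast
  show ?thesis unfolding small_family_def
  proof (intro exI[of _ "A + B"] exI[of _ "\<lambda>k t. \<alpha>' k t + \<beta>' k t"] conjI allI impI ballI)
    fix k :: complex and t assume k: "1 \<le> cmod k" and t: "t \<in> {0..T}"
    show "((\<lambda>t. \<alpha> k t + \<beta> k t) has_vector_derivative \<alpha>' k t + \<beta>' k t) (at t within {0..T})"
      using A(3)[OF k t] B(3)[OF k t] by (intro has_vector_derivative_add) auto
    show "cmod (\<alpha> k t + \<beta> k t) \<le> (A + B) * cmod (inverse k)"
      unfolding distrib_right using A(3)[OF k t] B(3)[OF k t] by (intro norm_triangle_le add_mono) auto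
    show "cmod (\<alpha>' k t + \<beta>' k t) \<le> (A + B) * cmod (inverse k)"
      unfolding distrib_right using A(3)[OF k t] B(3)[OF k t] by (intro norm_triangle_le add_mono) auto
  qed (use A B in \<open>auto intro!: continuous_intros\<close>)
qed

text \<open>\<open>v\<close>, \<open>i\<close>, \<open>G0\<close>, \<open>G1\<close> stand for 1/k,
  the imaginary unit and the conjugates of g0 and g1, and \<open>h0\<close>, \<open>h1\<close> for
  the time derivatives of g0 and g1. As independent variables they turn the gauge transformation
  into polynomial identities modulo \<open>k * v = 1\<close> and \<open>i * i = - 1\<close>: the
  first for the derivative of f2, the second for that of the gauged f1.\<close>

lemma gauge_identities:
  fixes k v i lam g0 G0 g1 G1 f1 f2 h0 h1 :: complex
  assumes "k * v = 1" "i * i = - 1"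
  shows "lam * ((2 * k * G0 - i * G1) * f1 + i * (g0 * G0) * f2)
      = lam * (2 * k * G0 - i * G1) * (f1 - (- (i / 2) * v * g0 + v\<^sup>2 * g1 / 4) * f2)
        + (lam * (G0 * g1 - g0 * G1) / 2 * v ^ Suc 0 + - (i * lam * (g1 * G1)) / 4 * v ^ Suc 1) * f2" (is ?A)
    and "(- 4 * i * k\<^sup>2 * f1 - i * lam * (g0 * G0) * f1 + (2 * k * g0 + i * g1) * f2)
        - ((- (i / 2) * v * g0 + v\<^sup>2 * g1 / 4) * (lam * ((2 * k * G0 - i * G1) * f1 + i * (g0 * G0) * f2))
          + (- (i / 2) * v * h0 + v\<^sup>2 * h1 / 4) * f2)
      = - 4 * i * k\<^sup>2 * (f1 - (- (i / 2) * v * g0 + v\<^sup>2 * g1 / 4) * f2)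
        + (- (lam * (G0 * g1 - g0 * G1) / 2 * v ^ Suc 0 + - (i * lam * (g1 * G1)) / 4 * v ^ Suc 1)
            * (f1 - (- (i / 2) * v * g0 + v\<^sup>2 * g1 / 4) * f2)
          + ((i * h0 / 2 - lam * (g0 * g0 * G0) / 2) * v ^ Suc 0 + (- (i * lam * (g0 * g0 * G1)) / 4 - h1 / 4) * v ^ Suc 1
            + (lam * (g0 * g1 * G1) / 8 - lam * (g1 * (G0 * g1 - g0 * G1)) / 8) * v ^ Suc 2
            + i * lam * (g1 * g1 * G1) / 16 * v ^ Suc 3) * f2)" (is ?B)
proof -
  \<comment> \<open>Replacing all fractions by powers of h with 2h = 1 leaves a pure ring problem
    for \<open>algebra\<close>.\<close>
  define h :: complex where "h = 1 / 2"
  have h: "2 * h = 1" by (simp add: h_def)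
  have halves: "x / 2 = x * h" "x / 4 = x * h\<^sup>2" "x / 8 = x * h ^ 3" "x / 16 = x * h ^ 4" for x
    by (auto simp: h_def power_divide)
  have powers: "v ^ Suc 0 = v" "v ^ Suc 1 = v\<^sup>2" "v ^ Suc 2 = v ^ 3" "v ^ Suc 3 = v ^ 4"
    by (simp_all add: eval_nat_numeral)
  show ?A
    unfolding halves powers using assms h by algebra
  show ?B
    unfolding halves powers using assms h by algebra
qed

text \<open>The gauge $z = \Phi_1 - (g_0/(2ik) + g_1/(4k^2))\Phi_2$ removes the growing coefficient $2kg_0$ and
  leaves coefficients of size $1/k$, so that Gronwall's inequality bounds $kz$ and $\Phi_2$ uniformly.
  Passing to $z + i\beta\Phi_2/(4k^2)$ then replaces an integration by parts and yields
  $z = O(k^{-3})$.\<close>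

lemma t_part_asymptotics:
  fixes g0 g1 g0' g1' :: "real \<Rightarrow> complex" and f1 f2 :: "complex \<Rightarrow> real \<Rightarrow> complex" and K :: real
  assumes lam: "cmod lam = 1"
    and g0d: "\<And>t. t \<in> {0..T} \<Longrightarrow> (g0 has_vector_derivative g0' t) (at t within {0..T})"
    and g1d: "\<And>t. t \<in> {0..T} \<Longrightarrow> (g1 has_vector_derivative g1' t) (at t within {0..T})"
    and C1: "C1_fun T g0'" "C1_fun T g1'" and g00: "g0 0 = 0" "g1 0 = 0"
    and sys: "\<And>k. t_part_system lam T g0 g1 k (f1 k) (f2 k)" and init: "\<And>k. f1 k 0 = 0" "\<And>k. f2 k 0 = 1"
    and t: "t \<in> {0..T}"
  defines "b \<equiv> \<lambda>t. integral {0..t} (\<lambda>s. lam * (cnj (g0 s) * g1 s - g0 s * cnj (g1 s)) / 2)"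
  shows "strip_bound K 3 (\<lambda>k. f1 k t - (g0 t / (2 * \<i>) / k + (g1 t / 4 + g0 t * b t / (2 * \<i>)) / k\<^sup>2))"
    and "strip_bound K 2 (\<lambda>k. f2 k t - (1 + b t / k))"
proof -
  have T: "0 \<le> T" using t by simp
  have C1g: "C1_fun T g0" "C1_fun T g1"
    unfolding C1_fun_def using C1_fun_continuous[OF C1(1)] C1_fun_continuous[OF C1(2)] g0d g1d by blast+
  define d1 where "d1 s = lam * (cnj (g0 s) * g1 s - g0 s * cnj (g1 s)) / 2" for s
  define d2 where "d2 s = - (\<i> * lam * (g1 s * cnj (g1 s))) / 4" for s
  define dd where "dd k s = d1 s * inverse k ^ Suc 0 + d2 s * inverse k ^ Suc 1" for k s
  define b1 where "b1 s = \<i> * g0' s / 2 - lam * (g0 s * g0 s * cnj (g0 s)) / 2" for s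
  define b2 where "b2 s = - (\<i> * lam * (g0 s * g0 s * cnj (g1 s))) / 4 - g1' s / 4" for s
  define b3 where "b3 s = lam * (g0 s * g1 s * cnj (g1 s)) / 8 - lam * (g1 s * (cnj (g0 s) * g1 s - g0 s * cnj (g1 s))) / 8" for s
  define b4 where "b4 s = \<i> * lam * (g1 s * g1 s * cnj (g1 s)) / 16" for s
  define \<beta> where "\<beta> k s = b1 s * inverse k ^ Suc 0 + b2 s * inverse k ^ Suc 1 + b3 s * inverse k ^ Suc 2 + b4 s * inverse k ^ Suc 3" for k s
  have C1d: "C1_fun T d1" "C1_fun T d2" unfolding d1_def[abs_def] d2_def[abs_def] divide_inverse by (intro C1_fun_intros C1g C1)+
  have C1b: "C1_fun T b1" "C1_fun T b2" "C1_fun T b3" "C1_fun T b4"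
    unfolding b1_def[abs_def] b2_def[abs_def] b3_def[abs_def] b4_def[abs_def] divide_inverse by (intro C1_fun_intros C1g C1)+
  have "small_family T dd" unfolding dd_def[abs_def] by (intro small_family_add small_family_monom C1d)
  then obtain A dd' where A: "A \<ge> 0" and A2: "\<And>k s. 1 \<le> cmod k \<Longrightarrow> s \<in> {0..T} \<Longrightarrow> (dd k has_vector_derivative dd' k s) (at s within {0..T})"
    "\<And>k s. 1 \<le> cmod k \<Longrightarrow> s \<in> {0..T} \<Longrightarrow> cmod (dd k s) \<le> A * cmod (inverse k)"
    unfolding small_family_def by metis
  have "small_family T \<beta>" unfolding \<beta>_def[abs_def] by (intro small_family_add small_family_monom C1b)
  then obtain B \<beta>' where B: "B \<ge> 0" and B1: "\<And>k. 1 \<le> cmod k \<Longrightarrow> continuous_on {0..T} (\<beta>' k)"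
    and B2: "\<And>k s. 1 \<le> cmod k \<Longrightarrow> s \<in> {0..T} \<Longrightarrow> (\<beta> k has_vector_derivative \<beta>' k s) (at s within {0..T})"
    and B3: "\<And>k s. 1 \<le> cmod k \<Longrightarrow> s \<in> {0..T} \<Longrightarrow> cmod (\<beta> k s) \<le> B * cmod (inverse k)"
    and B4: "\<And>k s. 1 \<le> cmod k \<Longrightarrow> s \<in> {0..T} \<Longrightarrow> cmod (\<beta>' k s) \<le> B * cmod (inverse k)"
    unfolding small_family_def by metis
  obtain G where G: "G \<ge> 0" "\<And>s. s \<in> {0..T} \<Longrightarrow> cmod (g0 s) \<le> G" "\<And>s. s \<in> {0..T} \<Longrightarrow> cmod (g1 s) \<le> G"
  proof -
    obtain G1 where G1: "G1 \<ge> 0" "\<And>s. s \<in> {0..T} \<Longrightarrow> cmod (g0 s) \<le> G1"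
      using continuous_bounded_Icc[OF C1_fun_continuous[OF C1g(1)]] by blast
    obtain G2 where G2: "G2 \<ge> 0" "\<And>s. s \<in> {0..T} \<Longrightarrow> cmod (g1 s) \<le> G2"
      using continuous_bounded_Icc[OF C1_fun_continuous[OF C1g(2)]] by blast
    show ?thesis
      by (rule that[of "G1 + G2"]) (use G1 G2 in \<open>auto intro: add_increasing add_increasing2\<close>)
  qed
  obtain D1 where D1: "D1 \<ge> 0" "\<And>s. s \<in> {0..T} \<Longrightarrow> cmod (d1 s) \<le> D1"
    using continuous_bounded_Icc[OF C1_fun_continuous[OF C1d(1)]] by blast
  obtain D2 where D2: "D2 \<ge> 0" "\<And>s. s \<in> {0..T} \<Longrightarrow> cmod (d2 s) \<le> D2"
    using continuous_bounded_Icc[OF C1_fun_continuous[OF C1d(2)]] by blast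
  \<comment> \<open>\<open>p\<close> solves -4ik^2 p + 2k g0 + i g1 = 0, the balance of the large
    terms in the equation for f1. The same choice cancels the |g0|^2 term in the equation for
    f2.\<close>
  define p where "p k s = - (\<i> / 2) * inverse k * g0 s + (inverse k)\<^sup>2 * g1 s / 4" for k s
  define z where "z k s = f1 k s - p k s * f2 k s" for k s
  define w where "w k = - 4 * \<i> * k\<^sup>2" for k :: complex
  define l where "l k s = lam * (2 * k * cnj (g0 s) - \<i> * cnj (g1 s))" for k s
  \<comment> \<open>Re (-4ik^2) = 8 Re k Im k. The maximum with 0 lets
    \<open>exp (\<kappa> * T)\<close> dominate on the whole time interval.\<close>
  define \<kappa> where "\<kappa> = max (8 * K) 0"
  define E where "E = exp (\<kappa> * T)"
  have E1: "E \<ge> 1" using T by (simp add: E_def \<kappa>_def)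
  \<comment> \<open>All constants are fixed before k. \<open>U\<close> bounds k z and f2,
    \<open>F\<close> the derivative of f2, and \<open>c\<close> the forcing of order k^-3 in the
    equation for \<open>h\<close>; \<open>c3\<close> bounds k^3 z, while \<open>c4\<close> and
    \<open>c5\<close> bound the errors of f2 at orders 1/k and 1/k^2.\<close>
  define Ca where "Ca = E * (A + B + (3 * G + A))"
  define U where "U = E * exp (Ca * T)"
  define F where "F = (3 * G + A) * U"
  define c where "c = B * (U + F) / 4"
  define c3 where "c3 = (E * (B / 4 + T * c) + B * U / 4) * exp (E * A * T)"
  define c4 where "c4 = T * (3 * G * c3 + A * U)"
  define c5 where "c5 = T * (3 * G * c3 + D2 * U + D1 * c4)"
  have pos: "Ca \<ge> 0" "U \<ge> 0" "F \<ge> 0" "c \<ge> 0" "c3 \<ge> 0" "c4 \<ge> 0" "c5 \<ge> 0"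
  proof -
    show "Ca \<ge> 0" using E1 A B G by (simp add: Ca_def)
    show U: "U \<ge> 0" using E1 by (simp add: U_def)
    show F: "F \<ge> 0" using U A G by (simp add: F_def)
    show c: "c \<ge> 0" using U F B by (simp add: c_def)
    show c3: "c3 \<ge> 0" using U c B T E1 by (simp add: c3_def)
    show c4: "c4 \<ge> 0" using U c3 G A T by (simp add: c4_def)
    show "c5 \<ge> 0" using U c3 c4 G D1 D2 T by (simp add: c5_def)
  qed
  have main: "cmod (z k t) \<le> c3 * cmod (inverse k) ^ 3 \<and> cmod (f2 k t - (1 + b t * inverse k)) \<le> c5 * (cmod (inverse k))\<^sup>2"
    if k1: "1 \<le> cmod k" and kK: "Re k * Im k \<le> K" for k
  proof -
    define e where "e = cmod (inverse k)"
    have e: "0 \<le> e" "e \<le> 1" "cmod k * e = 1" "e * cmod k = 1"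
    proof -
      have "cmod k \<noteq> 0" using k1 by linarith
      then show "cmod k * e = 1" "e * cmod k = 1" by (auto simp: e_def norm_inverse)
    qed (use k1 in \<open>auto simp: e_def norm_inverse inverse_le_1_iff\<close>)
    have k0: "k \<noteq> 0" using k1 by auto
    have kk: "k * inverse k = 1" using k0 by simp
    have ii: "\<i> * \<i> = - 1" by simp
    have pd: "(p k has_vector_derivative (- (\<i> / 2) * inverse k * g0' s + (inverse k)\<^sup>2 * g1' s / 4)) (at s within {0..T})"
      if s: "s \<in> {0..T}" for s
      unfolding p_def using g0d[OF s] g1d[OF s] by (auto intro!: derivative_eq_intros)
    have f1d: "(f1 k has_vector_derivative (- 4 * \<i> * k\<^sup>2 * f1 k s - \<i> * lam * (g0 s * cnj (g0 s)) * f1 k s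
        + (2 * k * g0 s + \<i> * g1 s) * f2 k s)) (at s within {0..T})" if "s \<in> {0..T}" for s
      using sys[of k] that unfolding t_part_system_def by blast
    have f2d0: "(f2 k has_vector_derivative (lam * ((2 * k * cnj (g0 s) - \<i> * cnj (g1 s)) * f1 k s
        + \<i> * (g0 s * cnj (g0 s)) * f2 k s))) (at s within {0..T})" if "s \<in> {0..T}" for s
      using sys[of k] that unfolding t_part_system_def by blast
    have f2d: "(f2 k has_vector_derivative (l k s * z k s + dd k s * f2 k s)) (at s within {0..T})" if s: "s \<in> {0..T}" for s
    proof -
      have "lam * ((2 * k * cnj (g0 s) - \<i> * cnj (g1 s)) * f1 k s + \<i> * (g0 s * cnj (g0 s)) * f2 k s)
        = l k s * z k s + dd k s * f2 k s"
        unfolding l_def z_def p_def dd_def d1_def d2_def by (rule gauge_identities(1)[OF kk ii])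
      then show ?thesis using f2d0[OF s] by simp
    qed
    have zd: "(z k has_vector_derivative (w k * z k s + (- dd k s * z k s + \<beta> k s * f2 k s))) (at s within {0..T})" if s: "s \<in> {0..T}" for s
    proof -
      have "((- 4 * \<i> * k\<^sup>2 * f1 k s - \<i> * lam * (g0 s * cnj (g0 s)) * f1 k s + (2 * k * g0 s + \<i> * g1 s) * f2 k s)
         - (p k s * (lam * ((2 * k * cnj (g0 s) - \<i> * cnj (g1 s)) * f1 k s + \<i> * (g0 s * cnj (g0 s)) * f2 k s))
         + (- (\<i> / 2) * inverse k * g0' s + (inverse k)\<^sup>2 * g1' s / 4) * f2 k s))
        = w k * z k s + (- dd k s * z k s + \<beta> k s * f2 k s)"
        unfolding w_def z_def p_def dd_def d1_def d2_def \<beta>_def b1_def b2_def b3_def b4_def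
        by (rule gauge_identities(2)[OF kk ii])
      then show ?thesis unfolding z_def using has_vector_derivative_diff[OF f1d[OF s] has_vector_derivative_mult[OF pd[OF s] f2d0[OF s]]]
        by simp
    qed
    have cz: "continuous_on {0..T} (z k)" by (rule has_vector_derivative_imp_continuous_on[OF zd])
    have cf2: "continuous_on {0..T} (f2 k)" by (rule has_vector_derivative_imp_continuous_on[OF f2d])
    have lb: "cmod (l k s) \<le> 3 * G * cmod k" if s: "s \<in> {0..T}" for s
    proof -
      have "cmod (2 * k * cnj (g0 s) - \<i> * cnj (g1 s)) \<le> 2 * cmod k * G + 1 * G"
        using G(2)[OF s] G(3)[OF s] by (intro norm_triangle_le_diff add_mono) (auto simp: norm_mult mult_left_mono)
      also have "\<dots> \<le> 2 * cmod k * G + cmod k * G" using k1 G(1) by (intro add_left_mono mult_right_mono) auto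
      also have "\<dots> = 3 * G * cmod k" by simp
      finally show ?thesis unfolding l_def norm_mult[of lam] lam by simp
    qed
    have "Re (w k) = 8 * (Re k * Im k)" by (simp add: w_def power2_eq_square)
    then have wk: "Re (w k) \<le> \<kappa>" "0 \<le> \<kappa>" using kK by (auto simp: \<kappa>_def)
    \<comment> \<open>g0 and g1 vanish at time 0, so the gauge is trivial there and no multiple of
      exp (-4ik^2 t) is started.\<close>
    have z0: "z k 0 = 0" using g00 init by (simp add: z_def p_def)
    have ddb: "cmod (dd k s) \<le> A * e" "cmod (dd k s) \<le> A" if "s \<in> {0..T}" for s
      using A2(2)[OF k1 that] mult_left_mono[OF e(2) A] by (auto simp: e_def)
    have bb: "cmod (\<beta> k s) \<le> B * e" "cmod (\<beta>' k s) \<le> B * e" if "s \<in> {0..T}" for s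
      using B3[OF k1 that] B4[OF k1 that] by (auto simp: e_def)

    \<comment> \<open>Weighting z by k balances the system: the coefficient \<open>l\<close> of z in
      the equation for f2 is O(k), and the forcing of k z is O(1) times f2, so Gronwall's constant
      does not depend on k.\<close>
    define u where "u s = cmod (k * z k s) + cmod (f2 k s)" for s
    have cu: "continuous_on {0..T} u" unfolding u_def by (intro continuous_intros cz cf2)
    have uU: "u s \<le> U" if s: "s \<in> {0..T}" for s
    proof -
      have "u s \<le> E + Ca * integral {0..s} u" if s: "s \<in> {0..T}" for s
      proof -
        have i1: "cmod (k * z k s) \<le> E * (cmod (k * z k 0) + integral {0..s} (\<lambda>s. (A + B) * u s))"
          unfolding E_def
        proof (rule duhamel_bound[where F = "\<lambda>s. k * (- dd k s * z k s + \<beta> k s * f2 k s)" and w = "w k"])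
          fix s assume s: "s \<in> {0..T}"
          show "((\<lambda>s. k * z k s) has_vector_derivative w k * (k * z k s) + k * (- dd k s * z k s + \<beta> k s * f2 k s)) (at s within {0..T})"
            using has_vector_derivative_mult_right[OF zd[OF s], of k] by (simp add: algebra_simps)
          have "cmod (k * (- dd k s * z k s + \<beta> k s * f2 k s)) = cmod (- dd k s * (k * z k s) + (k * \<beta> k s) * f2 k s)"
            by (simp add: algebra_simps)
          also have "\<dots> \<le> A * cmod (k * z k s) + B * cmod (f2 k s)"
          proof (intro norm_triangle_le add_mono)
            show "cmod (- dd k s * (k * z k s)) \<le> A * cmod (k * z k s)"
              unfolding norm_mult norm_minus_cancel using ddb(2)[OF s] by (intro mult_right_mono) auto
            have "cmod (k * \<beta> k s) \<le> cmod k * (B * e)" unfolding norm_mult using bb(1)[OF s] by (intro mult_left_mono) auto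
            also have "\<dots> = B" using e(3) by (simp add: algebra_simps)
            finally show "cmod (k * \<beta> k s * f2 k s) \<le> B * cmod (f2 k s)" unfolding norm_mult[of "k * \<beta> k s"] by (intro mult_right_mono) auto
          qed
          also have "\<dots> \<le> (A + B) * u s" using A B by (simp add: u_def algebra_simps)
          finally show "cmod (k * (- dd k s * z k s + \<beta> k s * f2 k s)) \<le> (A + B) * u s" .
        qed (use s wk cz cf2 cu has_vector_derivative_imp_continuous_on[OF A2(1)[OF k1]] has_vector_derivative_imp_continuous_on[OF B2[OF k1]] in \<open>auto intro!: continuous_intros\<close>)
        have i2: "cmod (f2 k s) \<le> E * (cmod (f2 k 0) + integral {0..s} (\<lambda>s. (3 * G + A) * u s))"
          unfolding E_def
        proof (rule duhamel_bound[where F = "\<lambda>s. l k s * z k s + dd k s * f2 k s" and w = 0])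
          fix s assume s: "s \<in> {0..T}"
          show "(f2 k has_vector_derivative 0 * f2 k s + (l k s * z k s + dd k s * f2 k s)) (at s within {0..T})"
            using f2d[OF s] by simp
          have "cmod (l k s * z k s) \<le> 3 * G * cmod k * cmod (z k s)"
            unfolding norm_mult using lb[OF s] by (intro mult_right_mono) auto
          moreover have "cmod (dd k s * f2 k s) \<le> A * cmod (f2 k s)"
            unfolding norm_mult using ddb(2)[OF s] by (intro mult_right_mono) auto
          ultimately have "cmod (l k s * z k s + dd k s * f2 k s) \<le> 3 * G * cmod (k * z k s) + A * cmod (f2 k s)"
            by (intro norm_triangle_le add_mono) (auto simp: norm_mult mult.assoc)
          also have "\<dots> \<le> (3 * G + A) * u s" using A G(1) by (simp add: u_def algebra_simps)
          finally show "cmod (l k s * z k s + dd k s * f2 k s) \<le> (3 * G + A) * u s" .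
        qed (use s wk cz cf2 cu has_vector_derivative_imp_continuous_on[OF A2(1)[OF k1]] C1_fun_continuous[OF C1g(1)] C1_fun_continuous[OF C1g(2)] in \<open>auto intro!: continuous_intros simp: l_def\<close>)
        have "u s \<le> E * (0 + integral {0..s} (\<lambda>s. (A + B) * u s)) + E * (1 + integral {0..s} (\<lambda>s. (3 * G + A) * u s))"
          using i1 i2 init z0 by (simp add: u_def)
        also have "\<dots> = E + Ca * integral {0..s} u" unfolding integral_mult_right by (simp add: Ca_def algebra_simps)
        finally show ?thesis .
      qed
      from gronwall[OF cu pos(1) this s] have "u s \<le> E * exp (Ca * s)" by simp
      also have "\<dots> \<le> U"
      proof -
        have "Ca * s \<le> Ca * T" using s pos(1) by (intro mult_left_mono) auto
        then show ?thesis unfolding U_def using E1 by (intro mult_left_mono) auto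
      qed
      finally show ?thesis .
    qed
    have f2U: "cmod (f2 k s) \<le> U" and zU: "cmod (k * z k s) \<le> U" if "s \<in> {0..T}" for s
      using uU[OF that] norm_ge_zero[of "f2 k s"] norm_ge_zero[of "k * z k s"] unfolding u_def by linarith+
    have f2F: "cmod (l k s * z k s + dd k s * f2 k s) \<le> F" if s: "s \<in> {0..T}" for s
    proof -
      have "cmod (l k s * z k s) \<le> 3 * G * cmod (k * z k s)"
        unfolding norm_mult using lb[OF s] by (simp add: mult.assoc[symmetric] mult_right_mono)
      also have "\<dots> \<le> 3 * G * U" using zU[OF s] G(1) by (intro mult_left_mono) auto
      finally have "cmod (l k s * z k s) \<le> 3 * G * U" .
      moreover have "cmod (dd k s * f2 k s) \<le> A * U"
        unfolding norm_mult using ddb(2)[OF s] f2U[OF s] A by (intro mult_mono) auto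
      ultimately show ?thesis unfolding F_def distrib_right by (intro norm_triangle_le add_mono)
    qed

    define h where "h s = z k s + (\<i> / 4) * (inverse k)\<^sup>2 * (\<beta> k s * f2 k s)" for s
    define R where "R s = - dd k s * z k s + (\<i> / 4) * (inverse k)\<^sup>2 * (\<beta> k s * (l k s * z k s + dd k s * f2 k s) + \<beta>' k s * f2 k s)" for s
    have cR: "continuous_on {0..T} R" unfolding R_def l_def
      by (intro continuous_intros cz cf2 B1[OF k1] has_vector_derivative_imp_continuous_on[OF A2(1)[OF k1]] has_vector_derivative_imp_continuous_on[OF B2[OF k1]]
        C1_fun_continuous[OF C1g(1)] C1_fun_continuous[OF C1g(2)])
    have hd: "(h has_vector_derivative w k * h s + R s) (at s within {0..T})" if s: "s \<in> {0..T}" for s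
    proof -
      \<comment> \<open>The factor i/(4k^2) is 1/w. Hence w h contains the forcing beta f2 in full,
        and \<open>R\<close> keeps only -dd z and the time derivative of beta f2 divided by
        w.\<close>
      have kw: "w k * ((\<i> / 4) * (inverse k)\<^sup>2) = 1" using k0 by (simp add: w_def field_simps power2_eq_square)
      have "(h has_vector_derivative (w k * z k s + (- dd k s * z k s + \<beta> k s * f2 k s)) + (\<i> / 4) * (inverse k)\<^sup>2 *
         (\<beta> k s * (l k s * z k s + dd k s * f2 k s) + \<beta>' k s * f2 k s)) (at s within {0..T})"
        unfolding h_def
        by (intro has_vector_derivative_add zd[OF s] has_vector_derivative_mult_right has_vector_derivative_mult B2[OF k1 s] f2d[OF s])
      also have "(w k * z k s + (- dd k s * z k s + \<beta> k s * f2 k s)) + (\<i> / 4) * (inverse k)\<^sup>2 *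
         (\<beta> k s * (l k s * z k s + dd k s * f2 k s) + \<beta>' k s * f2 k s) = w k * h s + R s"
      proof -
        have "w k * h s = w k * z k s + (w k * ((\<i> / 4) * (inverse k)\<^sup>2)) * (\<beta> k s * f2 k s)"
          unfolding h_def by (simp only: distrib_left mult.assoc)
        then show ?thesis unfolding kw R_def by (simp add: algebra_simps)
      qed
      finally show ?thesis .
    qed
    have e2: "cmod ((\<i> / 4) * (inverse k)\<^sup>2) = e\<^sup>2 / 4" by (simp add: e_def norm_mult norm_power)
    have Rb: "cmod (R s) \<le> A * cmod (z k s) + c * e ^ 3" if s: "s \<in> {0..T}" for s
    proof -
      have "cmod (\<beta> k s * (l k s * z k s + dd k s * f2 k s) + \<beta>' k s * f2 k s) \<le> (B * e) * F + (B * e) * U"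
        unfolding norm_mult using bb[OF s] f2F[OF s] f2U[OF s] B e
        by (intro norm_triangle_le add_mono) (auto simp: norm_mult intro!: mult_mono)
      then have "e\<^sup>2 / 4 * cmod (\<beta> k s * (l k s * z k s + dd k s * f2 k s) + \<beta>' k s * f2 k s) \<le> e\<^sup>2 / 4 * ((B * e) * F + (B * e) * U)"
        by (intro mult_left_mono) auto
      also have "\<dots> = c * e ^ 3" by (simp add: c_def power3_eq_cube power2_eq_square algebra_simps)
      finally have "cmod ((\<i> / 4) * (inverse k)\<^sup>2 * (\<beta> k s * (l k s * z k s + dd k s * f2 k s) + \<beta>' k s * f2 k s)) \<le> c * e ^ 3"
        unfolding norm_mult[of "(\<i> / 4) * (inverse k)\<^sup>2"] e2 .
      moreover have "cmod (- dd k s * z k s) \<le> A * cmod (z k s)"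
        unfolding norm_mult norm_minus_cancel using ddb(2)[OF s] by (intro mult_right_mono) auto
      ultimately show ?thesis unfolding R_def by (intro norm_triangle_le add_mono)
    qed
    have bfb: "cmod ((\<i> / 4) * (inverse k)\<^sup>2 * (\<beta> k s * f2 k s)) \<le> B * V / 4 * e ^ 3" if s: "s \<in> {0..T}" and V: "cmod (f2 k s) \<le> V" for s V
    proof -
      have "cmod ((\<i> / 4) * (inverse k)\<^sup>2 * (\<beta> k s * f2 k s)) \<le> e\<^sup>2 / 4 * ((B * e) * V)"
        unfolding norm_mult[of "(\<i> / 4) * (inverse k)\<^sup>2"] e2 norm_mult[of "\<beta> k s"]
        using bb(1)[OF s] V B e by (intro mult_mono) auto
      then show ?thesis by (simp add: power3_eq_cube power2_eq_square algebra_simps)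
    qed
    have z3: "cmod (z k s) \<le> c3 * e ^ 3" if s: "s \<in> {0..T}" for s
    proof -
      have "cmod (z k s) \<le> ((E * (B / 4 + T * c) + B * U / 4) * e ^ 3) + (E * A) * integral {0..s} (\<lambda>s. cmod (z k s))"
        if s: "s \<in> {0..T}" for s
      proof -
        have sub: "{0..s} \<subseteq> {0..T}" using s by auto
        have "cmod (h s) \<le> E * (cmod (h 0) + integral {0..s} (\<lambda>s. A * cmod (z k s) + c * e ^ 3))"
          unfolding E_def by (rule duhamel_bound[OF hd cR _ Rb wk s]) (auto intro!: continuous_intros cz)
        also have "integral {0..s} (\<lambda>s. A * cmod (z k s) + c * e ^ 3) = A * integral {0..s} (\<lambda>s. cmod (z k s)) + s * (c * e ^ 3)"
          using s by (subst integral_add) (auto intro!: integrable_continuous_interval continuous_intros continuous_on_subset[OF cz sub])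
        \<comment> \<open>z vanishes at time 0, but beta f2 need not; its contribution to h is
          already of order k^-3.\<close>
        also have "cmod (h 0) \<le> B * 1 / 4 * e ^ 3" unfolding h_def z0 add_0_left
          by (rule bfb) (use T init in auto)
        finally have "cmod (h s) \<le> E * (B * 1 / 4 * e ^ 3 + (A * integral {0..s} (\<lambda>s. cmod (z k s)) + s * (c * e ^ 3)))"
          using E1 by simp
        also have "\<dots> \<le> E * (B * 1 / 4 * e ^ 3 + (A * integral {0..s} (\<lambda>s. cmod (z k s)) + T * (c * e ^ 3)))"
          using E1 s pos e by (intro mult_left_mono add_left_mono mult_right_mono) auto
        finally have hb: "cmod (h s) \<le> E * (B * 1 / 4 * e ^ 3 + (A * integral {0..s} (\<lambda>s. cmod (z k s)) + T * (c * e ^ 3)))" .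
        have "cmod (z k s) \<le> cmod (h s) + cmod ((\<i> / 4) * (inverse k)\<^sup>2 * (\<beta> k s * f2 k s))"
          using norm_triangle_ineq4[of "h s" "(\<i> / 4) * (inverse k)\<^sup>2 * (\<beta> k s * f2 k s)"] by (simp add: h_def)
        also have "\<dots> \<le> E * (B * 1 / 4 * e ^ 3 + (A * integral {0..s} (\<lambda>s. cmod (z k s)) + T * (c * e ^ 3))) + B * U / 4 * e ^ 3"
          by (intro add_mono hb bfb s f2U)
        finally show ?thesis by (simp add: algebra_simps)
      qed
      from gronwall[OF _ _ this s] have "cmod (z k s) \<le> ((E * (B / 4 + T * c) + B * U / 4) * e ^ 3) * exp (E * A * s)"
        using E1 A cz by (auto intro!: continuous_intros)
      also have "\<dots> \<le> ((E * (B / 4 + T * c) + B * U / 4) * e ^ 3) * exp (E * A * T)"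
      proof -
        have "E * A * s \<le> E * A * T" using s E1 A by (intro mult_left_mono) auto
        moreover have "0 \<le> (E * (B / 4 + T * c) + B * U / 4) * e ^ 3" using E1 B T pos e by simp
        ultimately show ?thesis by (intro mult_left_mono) auto
      qed
      finally show ?thesis by (simp add: c3_def mult_ac)
    qed
    have lz: "cmod (l k s * z k s) \<le> 3 * G * c3 * e\<^sup>2" if s: "s \<in> {0..T}" for s
    proof -
      have "cmod (l k s * z k s) \<le> (3 * G * cmod k) * (c3 * e ^ 3)"
        unfolding norm_mult using lb[OF s] z3[OF s] G(1) by (intro mult_mono) auto
      also have "\<dots> = 3 * G * c3 * e\<^sup>2 * (cmod k * e)" by (simp add: power3_eq_cube power2_eq_square)
      finally show ?thesis using e by simp
    qed
    have ee: "e\<^sup>2 \<le> e" using e by (simp add: power2_eq_square mult_left_le)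
    have f21: "cmod (f2 k s - 1) \<le> c4 * e" if s: "s \<in> {0..T}" for s
    proof -
      have "cmod (f2 k s - f2 k 0) \<le> (3 * G * c3 + A * U) * e * \<bar>s - 0\<bar>"
      proof (rule vector_derivative_bound[OF f2d])
        fix s assume s: "s \<in> {0..T}"
        have "cmod (dd k s * f2 k s) \<le> (A * e) * U"
          unfolding norm_mult using ddb(1)[OF s] f2U[OF s] A e by (intro mult_mono) auto
        moreover have "cmod (l k s * z k s) \<le> 3 * G * c3 * e"
          by (rule order_trans[OF lz[OF s]]) (use ee G(1) pos in \<open>auto intro!: mult_left_mono\<close>)
        ultimately have "cmod (l k s * z k s + dd k s * f2 k s) \<le> 3 * G * c3 * e + (A * e) * U"
          by (intro norm_triangle_le add_mono)
        then show "cmod (l k s * z k s + dd k s * f2 k s) \<le> (3 * G * c3 + A * U) * e" by (simp add: algebra_simps)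
      qed (use s in auto)
      also have "\<dots> \<le> (3 * G * c3 + A * U) * e * T" using s A G(1) pos e by (intro mult_left_mono) auto
      finally show ?thesis using init by (simp add: c4_def mult_ac)
    qed
    have bd: "(b has_vector_derivative d1 s) (at s within {0..T})" if s: "s \<in> {0..T}" for s
      unfolding b_def d1_def[symmetric] using integral_has_vector_derivative[OF C1_fun_continuous[OF C1d(1)] s] .
    \<comment> \<open>Since f2 - 1 is known to be O(1/k), replacing f2 by 1 in the term d1 f2/k of
      its derivative costs only O(k^-2), and the integral of d1 is b.\<close>
    define r where "r s = f2 k s - (1 + b s * inverse k)" for s
    have "cmod (r t - r 0) \<le> (3 * G * c3 + D2 * U + D1 * c4) * e\<^sup>2 * \<bar>t - 0\<bar>"
    proof (rule vector_derivative_bound)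
      fix s assume s: "s \<in> {0..T}"
      have "(r has_vector_derivative (l k s * z k s + dd k s * f2 k s) - (0 + d1 s * inverse k)) (at s within {0..T})"
        unfolding r_def by (intro has_vector_derivative_diff f2d[OF s] has_vector_derivative_add has_vector_derivative_const
            has_vector_derivative_mult_left bd[OF s])
      also have "(l k s * z k s + dd k s * f2 k s) - (0 + d1 s * inverse k)
         = l k s * z k s + d2 s * (inverse k)\<^sup>2 * f2 k s + d1 s * inverse k * (f2 k s - 1)"
        by (simp add: dd_def power2_eq_square algebra_simps)
      finally show "(r has_vector_derivative l k s * z k s + d2 s * (inverse k)\<^sup>2 * f2 k s + d1 s * inverse k * (f2 k s - 1)) (at s within {0..T})" .
      have "cmod (d2 s * (inverse k)\<^sup>2 * f2 k s) \<le> D2 * e\<^sup>2 * U"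
        unfolding norm_mult norm_power e_def[symmetric] using D2 D2(2)[OF s] f2U[OF s] by (intro mult_mono) auto
      moreover have "cmod (d1 s * inverse k * (f2 k s - 1)) \<le> D1 * e * (c4 * e)"
        unfolding norm_mult e_def[symmetric] using D1 D1(2)[OF s] f21[OF s] e by (intro mult_mono) auto
      ultimately have "cmod (l k s * z k s + d2 s * (inverse k)\<^sup>2 * f2 k s + d1 s * inverse k * (f2 k s - 1)) \<le> 3 * G * c3 * e\<^sup>2 + D2 * e\<^sup>2 * U + D1 * e * (c4 * e)"
        by (intro norm_triangle_le add_mono lz s)
      then show "cmod (l k s * z k s + d2 s * (inverse k)\<^sup>2 * f2 k s + d1 s * inverse k * (f2 k s - 1)) \<le> (3 * G * c3 + D2 * U + D1 * c4) * e\<^sup>2"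
        by (simp add: algebra_simps power2_eq_square)
    qed (use t in auto)
    also have "\<dots> \<le> (3 * G * c3 + D2 * U + D1 * c4) * e\<^sup>2 * T" using t G(1) D1(1) D2(1) pos e by (intro mult_left_mono) auto
    also have "r 0 = 0" using init by (simp add: r_def b_def)
    finally have "cmod (r t) \<le> c5 * e\<^sup>2" by (simp add: c5_def mult_ac)
    then show ?thesis using z3[OF t] unfolding r_def e_def by simp
  qed
  define M where "M = c3 + c5 + G * cmod (b t) + 2 * G * c5"
  have cG: "0 \<le> G * cmod (b t)" "0 \<le> G * c5" using G(1) pos by auto
  have bnd: "cmod (f1 k t - (g0 t / (2 * \<i>) / k + (g1 t / 4 + g0 t * b t / (2 * \<i>)) / k\<^sup>2)) \<le> M / cmod k ^ 3" (is ?A)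
    "cmod (f2 k t - (1 + b t / k)) \<le> M / (cmod k)\<^sup>2" (is ?B) if k: "1 \<le> cmod k" "Re k * Im k \<le> K" for k
  proof -
    define e where "e = cmod (inverse k)"
    have e: "0 \<le> e" "e \<le> 1" using k by (auto simp: e_def norm_inverse inverse_le_1_iff)
    have k0: "k \<noteq> 0" using k by auto
    have er: "x / cmod k ^ n = x * e ^ n" for x n by (simp add: e_def norm_inverse power_inverse divide_inverse)
    define r where "r = f2 k t - (1 + b t * inverse k)"
    have r: "cmod r \<le> c5 * e\<^sup>2" and z: "cmod (z k t) \<le> c3 * e ^ 3" using main[OF k] by (auto simp: r_def e_def)
    show ?B
      unfolding er using r cG pos mult_right_mono[of c5 M "e\<^sup>2"] by (simp add: r_def M_def divide_inverse)
    \<comment> \<open>f1 = z + p f2 with f2 = 1 + b/k + r. The k^-2 part of p times b/k is the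
      middle term, already of order k^-3.\<close>
    have "f1 k t - (g0 t / (2 * \<i>) / k + (g1 t / 4 + g0 t * b t / (2 * \<i>)) / k\<^sup>2)
       = z k t + inverse k ^ 3 * (g1 t * b t / 4) + p k t * r"
      using k0 unfolding z_def p_def r_def by (simp add: field_simps power2_eq_square power3_eq_cube)
    also have "cmod \<dots> \<le> c3 * e ^ 3 + e ^ 3 * (G * cmod (b t)) + (2 * G * e) * (c5 * e\<^sup>2)"
    proof (intro norm_triangle_le add_mono z)
      show "cmod (inverse k ^ 3 * (g1 t * b t / 4)) \<le> e ^ 3 * (G * cmod (b t))"
      proof -
        have "cmod (g1 t * b t / 4) \<le> G * cmod (b t)" using G(3)[OF t] mult_right_mono[OF G(3)[OF t], of "cmod (b t)"] cG
          by (simp add: norm_mult norm_divide)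
        then show ?thesis unfolding norm_mult norm_power e_def[symmetric] using e by (intro mult_left_mono) auto
      qed
      have "cmod (p k t) \<le> e * G + e * G"
      proof -
        have "cmod (- (\<i> / 2) * inverse k * g0 t) \<le> e * G"
        proof -
          have "cmod (- (\<i> / 2) * inverse k * g0 t) = (e * cmod (g0 t)) / 2" by (simp add: norm_mult e_def)
          also have "\<dots> \<le> e * cmod (g0 t)" using e by simp
          also have "\<dots> \<le> e * G" using e G(2)[OF t] by (intro mult_left_mono) auto
          finally show ?thesis .
        qed
        moreover have "cmod ((inverse k)\<^sup>2 * g1 t / 4) \<le> e * G"
        proof -
          have "cmod ((inverse k)\<^sup>2 * g1 t / 4) = (e\<^sup>2 * cmod (g1 t)) / 4" by (simp add: norm_mult norm_power norm_divide e_def)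
          also have "\<dots> \<le> e\<^sup>2 * cmod (g1 t)" by simp
          also have "\<dots> \<le> e * G" using e G(3)[OF t] by (intro mult_mono) (auto simp: power2_eq_square mult_left_le)
          finally show ?thesis .
        qed
        ultimately show ?thesis unfolding p_def by (intro norm_triangle_le add_mono)
      qed
      then show "cmod (p k t * r) \<le> (2 * G * e) * (c5 * e\<^sup>2)"
        unfolding norm_mult using r e G(1) pos by (intro mult_mono) (auto simp: algebra_simps)
    qed
    also have "\<dots> = (c3 + G * cmod (b t) + 2 * G * c5) * e ^ 3" by (simp add: algebra_simps power3_eq_cube power2_eq_square)
    also have "\<dots> \<le> M * e ^ 3" using pos e by (intro mult_right_mono) (auto simp: M_def)
    finally show ?A
      unfolding er .
  qed
  show "strip_bound K 3 (\<lambda>k. f1 k t - (g0 t / (2 * \<i>) / k + (g1 t / 4 + g0 t * b t / (2 * \<i>)) / k\<^sup>2))"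
    "strip_bound K 2 (\<lambda>k. f2 k t - (1 + b t / k))"
    by (rule strip_boundI[OF bnd(1)] strip_boundI[OF bnd(2)]; assumption)+
qed

section \<open>Analytic dependence on the spectral parameter\<close>

text \<open>Contains the Picard iterates: polynomials in \<open>k\<close> with coefficients continuous in \<open>t\<close>.\<close>

inductive poly_family :: "real \<Rightarrow> (complex \<Rightarrow> real \<Rightarrow> complex) \<Rightarrow> bool" for T where
  coeff: "continuous_on {0..T} g \<Longrightarrow> poly_family T (\<lambda>k. g)"
| add: "poly_family T F \<Longrightarrow> poly_family T G \<Longrightarrow> poly_family T (\<lambda>k t. F k t + G k t)"
| shift: "poly_family T F \<Longrightarrow> poly_family T (\<lambda>k t. k * F k t)"

lemma poly_family_continuous: "poly_family T F \<Longrightarrow> continuous_on {0..T} (F k)"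
  by (induction rule: poly_family.induct) (auto intro!: continuous_intros)

lemma poly_family_holomorphic: "poly_family T F \<Longrightarrow> (\<lambda>k. F k t) holomorphic_on S"
  by (induction rule: poly_family.induct) (auto intro!: holomorphic_intros)

lemma poly_family_mult:
  assumes "continuous_on {0..T} g" "poly_family T F"
  shows "poly_family T (\<lambda>k t. g t * F k t)"
  using assms(2)
proof (induction rule: poly_family.induct)
  case (coeff h)
  then show ?case using assms(1) by (intro poly_family.coeff continuous_intros)
next
  case (add F G)
  then show ?case using poly_family.add[OF add.IH] by (simp add: distrib_left)
next
  case (shift F)
  then show ?case using poly_family.shift[OF shift.IH] by (simp add: mult.left_commute)
qed

lemma poly_family_integral:
  assumes "poly_family T F"
  shows "\<exists>G. poly_family T G \<and> (\<forall>k. \<forall>t\<in>{0..T}. integral {0..t} (F k) = G k t)"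
  using assms
proof (induction rule: poly_family.induct)
  case (coeff g)
  have "continuous_on {0..T} (\<lambda>t. integral {0..t} g)"
    by (rule indefinite_integral_continuous_1) (rule integrable_continuous_interval[OF coeff])
  then show ?case by (intro exI[of _ "\<lambda>k t. integral {0..t} g"]) (auto intro: poly_family.coeff)
next
  case (add F G)
  then obtain F' G' where "poly_family T F'" "poly_family T G'"
    and FG: "\<And>k t. t \<in> {0..T} \<Longrightarrow> integral {0..t} (F k) = F' k t" "\<And>k t. t \<in> {0..T} \<Longrightarrow> integral {0..t} (G k) = G' k t"
    by blast
  moreover have "integral {0..t} (\<lambda>s. F k s + G k s) = F' k t + G' k t" if "t \<in> {0..T}" for k t
  proof -
    have "{0..t} \<subseteq> {0..T}" using that by auto
    then show ?thesis unfolding FG[OF that, symmetric]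
      using add.hyps by (intro integral_add integrable_continuous_interval)
         (auto intro: continuous_on_subset[OF poly_family_continuous])
  qed
  ultimately show ?case by (intro exI[of _ "\<lambda>k t. F' k t + G' k t"]) (auto intro: poly_family.add)
next
  case (shift F)
  then obtain F' where "poly_family T F'" "\<And>k t. t \<in> {0..T} \<Longrightarrow> integral {0..t} (F k) = F' k t" by blast
  then show ?case by (intro exI[of _ "\<lambda>k t. k * F' k t"]) (auto intro: poly_family.shift)
qed

lemma t_part_system_integral:
  assumes "t_part_system lam T g0 g1 k f1 f2" "t \<in> {0..T}"
  shows "f1 t = f1 0 + integral {0..t} (\<lambda>s. - 4 * \<i> * k\<^sup>2 * f1 s - \<i> * lam * (g0 s * cnj (g0 s)) * f1 s + (2 * k * g0 s + \<i> * g1 s) * f2 s)" (is ?A)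
    and "f2 t = f2 0 + integral {0..t} (\<lambda>s. lam * ((2 * k * cnj (g0 s) - \<i> * cnj (g1 s)) * f1 s + \<i> * (g0 s * cnj (g0 s)) * f2 s))" (is ?B)
proof -
  have sub: "{0..t} \<subseteq> {0..T}" using assms by auto
  note t_part_system = assms(1)[unfolded t_part_system_def, rule_format]
  have "((\<lambda>s. - 4 * \<i> * k\<^sup>2 * f1 s - \<i> * lam * (g0 s * cnj (g0 s)) * f1 s + (2 * k * g0 s + \<i> * g1 s) * f2 s) has_integral f1 t - f1 0) {0..t}"
  proof (rule fundamental_theorem_of_calculus)
    fix s assume "s \<in> {0..t}"
    then have "s \<in> {0..T}" using sub by blast
    from has_vector_derivative_within_subset[OF conjunct1[OF t_part_system[OF this]] sub]
    show "(f1 has_vector_derivative - 4 * \<i> * k\<^sup>2 * f1 s - \<i> * lam * (g0 s * cnj (g0 s)) * f1 s + (2 * k * g0 s + \<i> * g1 s) * f2 s) (at s within {0..t})" .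
  qed (use assms(2) in simp)
  note i = this
  show ?A
    unfolding integral_unique[OF i] by simp
  have "((\<lambda>s. lam * ((2 * k * cnj (g0 s) - \<i> * cnj (g1 s)) * f1 s + \<i> * (g0 s * cnj (g0 s)) * f2 s)) has_integral f2 t - f2 0) {0..t}"
  proof (rule fundamental_theorem_of_calculus)
    fix s assume "s \<in> {0..t}"
    then have "s \<in> {0..T}" using sub by blast
    from has_vector_derivative_within_subset[OF conjunct2[OF t_part_system[OF this]] sub]
    show "(f2 has_vector_derivative lam * ((2 * k * cnj (g0 s) - \<i> * cnj (g1 s)) * f1 s + \<i> * (g0 s * cnj (g0 s)) * f2 s)) (at s within {0..t})" .
  qed (use assms(2) in simp)
  note i = this
  show ?B
    unfolding integral_unique[OF i] by simp
qed

text \<open>Picard iterates are polynomials in k and converge to the given solution uniformly on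
  every disc, at the rate (C t)^n / n!. Locally uniform limits of holomorphic functions are
  holomorphic.\<close>

lemma t_part_system_entire:
  fixes f1 f2 :: "complex \<Rightarrow> real \<Rightarrow> complex"
  assumes cg: "continuous_on {0..T} g0" "continuous_on {0..T} g1" and lam: "cmod lam = 1"
    and sys: "\<And>k. t_part_system lam T g0 g1 k (f1 k) (f2 k)" and init: "\<And>k. f1 k 0 = 0" "\<And>k. f2 k 0 = 1"
    and t: "t \<in> {0..T}"
  shows "(\<lambda>k. f1 k t) holomorphic_on UNIV" "(\<lambda>k. f2 k t) holomorphic_on UNIV"
proof -
  define R1 where "R1 k s a b = - 4 * \<i> * k\<^sup>2 * a - \<i> * lam * (g0 s * cnj (g0 s)) * a + (2 * k * g0 s + \<i> * g1 s) * b" for k s a b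
  define R2 where "R2 k s a b = lam * ((2 * k * cnj (g0 s) - \<i> * cnj (g1 s)) * a + \<i> * (g0 s * cnj (g0 s)) * b)" for k s a b
  have Rdiff: "R1 k s a b - R1 k s a' b' = R1 k s (a - a') (b - b')" "R2 k s a b - R2 k s a' b' = R2 k s (a - a') (b - b')" for k s a b a' b'
    unfolding R1_def R2_def by (simp_all add: algebra_simps)
  have cf: "continuous_on {0..T} (f1 k)" "continuous_on {0..T} (f2 k)" for k
    by (rule has_vector_derivative_imp_continuous_on; use sys[of k] in \<open>auto simp: t_part_system_def\<close>)+
  have cR: "continuous_on {0..T} (\<lambda>s. R1 k s (a s) (b s))" "continuous_on {0..T} (\<lambda>s. R2 k s (a s) (b s))"
    if "continuous_on {0..T} a" "continuous_on {0..T} b" for a b k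
    unfolding R1_def R2_def by (intro continuous_intros cg that)+
  have f1: "f1 k t = integral {0..t} (\<lambda>s. R1 k s (f1 k s) (f2 k s))"
    and f2: "f2 k t = 1 + integral {0..t} (\<lambda>s. R2 k s (f1 k s) (f2 k s))" if "t \<in> {0..T}" for k t
    using t_part_system_integral[OF sys[of k] that] init unfolding R1_def R2_def by simp_all
  obtain G where G: "G \<ge> 0" "\<And>s. s \<in> {0..T} \<Longrightarrow> cmod (g0 s) \<le> G" "\<And>s. s \<in> {0..T} \<Longrightarrow> cmod (g1 s) \<le> G"
  proof -
    obtain G1 where G1: "G1 \<ge> 0" "\<And>s. s \<in> {0..T} \<Longrightarrow> cmod (g0 s) \<le> G1"
      using continuous_bounded_Icc[OF cg(1)] by blast
    obtain G2 where G2: "G2 \<ge> 0" "\<And>s. s \<in> {0..T} \<Longrightarrow> cmod (g1 s) \<le> G2"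
      using continuous_bounded_Icc[OF cg(2)] by blast
    show ?thesis
      by (rule that[of "G1 + G2"]) (use G1 G2 in \<open>auto intro: add_increasing add_increasing2\<close>)
  qed
  have hol_ball: "(\<lambda>k. f1 k t) holomorphic_on ball 0 r \<and> (\<lambda>k. f2 k t) holomorphic_on ball 0 r" if r: "r > 0" for r
  proof -
    define B where "B = 2 * r * G + G"
    \<comment> \<open>Bounds the coefficient matrix for |k| up to r, in the sum norm of the two
      components.\<close>
    define C where "C = 4 * r\<^sup>2 + G * G + B + (B + G * G)"
    have B0: "B \<ge> 0" using r G by (simp add: B_def)
    have C0: "C \<ge> 0" using r G B0 by (simp add: C_def)
    have Rb: "cmod (R1 k s a b) + cmod (R2 k s a b) \<le> C * (cmod a + cmod b)" if k: "cmod k \<le> r" and s: "s \<in> {0..T}" for k s a b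
    proof -
      have gg: "cmod (g0 s * cnj (g0 s)) \<le> G * G" unfolding norm_mult using G(1) G(2)[OF s] by (intro mult_mono) auto
      have kg: "2 * cmod k * cmod (g0 s) \<le> 2 * r * G" using G(1) G(2)[OF s] k r by (intro mult_mono) auto
      have k2: "cmod (- 4 * \<i> * k\<^sup>2 * a) \<le> 4 * r\<^sup>2 * cmod a"
        using power_mono[OF k, of 2] by (simp add: norm_mult norm_power mult_right_mono)
      have bb: "cmod (2 * k * g0 s + \<i> * g1 s) \<le> B" "cmod (2 * k * cnj (g0 s) - \<i> * cnj (g1 s)) \<le> B"
        unfolding B_def using kg G(3)[OF s] by (auto intro!: norm_triangle_le norm_triangle_le_diff add_mono simp: norm_mult)
      have "cmod (R1 k s a b) \<le> 4 * r\<^sup>2 * cmod a + (G * G) * cmod a + B * cmod b"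
        unfolding R1_def
      proof (intro norm_triangle_le norm_triangle_le_diff add_mono k2)
        show "cmod (\<i> * lam * (g0 s * cnj (g0 s)) * a) \<le> (G * G) * cmod a"
          unfolding norm_mult[of _ a] using gg by (intro mult_right_mono) (auto simp: norm_mult lam)
        show "cmod ((2 * k * g0 s + \<i> * g1 s) * b) \<le> B * cmod b"
          unfolding norm_mult[of _ b] using bb by (intro mult_right_mono) auto
      qed
      moreover have "cmod (R2 k s a b) \<le> B * cmod a + (G * G) * cmod b"
      proof -
        have "cmod ((2 * k * cnj (g0 s) - \<i> * cnj (g1 s)) * a + \<i> * (g0 s * cnj (g0 s)) * b) \<le> B * cmod a + (G * G) * cmod b"
        proof (intro norm_triangle_le add_mono)
          show "cmod ((2 * k * cnj (g0 s) - \<i> * cnj (g1 s)) * a) \<le> B * cmod a"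
            unfolding norm_mult[of _ a] using bb by (intro mult_right_mono) auto
          show "cmod (\<i> * (g0 s * cnj (g0 s)) * b) \<le> (G * G) * cmod b"
            unfolding norm_mult[of _ b] using gg by (intro mult_right_mono) (auto simp: norm_mult)
        qed
        then show ?thesis by (simp add: R2_def norm_mult lam)
      qed
      ultimately have "cmod (R1 k s a b) + cmod (R2 k s a b)
          \<le> (4 * r\<^sup>2 + G * G + B) * cmod a + (B + G * G) * cmod b" by (simp add: algebra_simps)
      also have "\<dots> \<le> C * cmod a + C * cmod b"
      proof (intro add_mono mult_right_mono norm_ge_zero)
        have "0 \<le> G * G" "0 \<le> r\<^sup>2" using G(1) by auto
        then show "4 * r\<^sup>2 + G * G + B \<le> C" "B + G * G \<le> C" unfolding C_def using B0 by linarith+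
      qed
      finally show ?thesis by (simp add: algebra_simps)
    qed
    have step: "cmod (integral {0..s} (\<lambda>s. R1 k s (a s) (b s))) + cmod (integral {0..s} (\<lambda>s. R2 k s (a s) (b s)))
        \<le> integral {0..s} (\<lambda>s. C * h s)"
      if k: "cmod k \<le> r" and s: "s \<in> {0..T}" and c: "continuous_on {0..T} a" "continuous_on {0..T} b" "continuous_on {0..T} h"
        and le: "\<And>s. s \<in> {0..T} \<Longrightarrow> cmod (a s) + cmod (b s) \<le> h s" for k s a b h
    proof -
      have sub: "{0..s} \<subseteq> {0..T}" using s by auto
      have int: "(\<lambda>s. R1 k s (a s) (b s)) integrable_on {0..s}" "(\<lambda>s. R2 k s (a s) (b s)) integrable_on {0..s}"
        "(\<lambda>s. cmod (R1 k s (a s) (b s))) integrable_on {0..s}" "(\<lambda>s. cmod (R2 k s (a s) (b s))) integrable_on {0..s}"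
        by (intro integrable_continuous_interval continuous_intros continuous_on_subset[OF cR(1)[OF c(1,2)] sub] continuous_on_subset[OF cR(2)[OF c(1,2)] sub])+
      have "cmod (integral {0..s} (\<lambda>s. R1 k s (a s) (b s))) + cmod (integral {0..s} (\<lambda>s. R2 k s (a s) (b s)))
         \<le> integral {0..s} (\<lambda>s. cmod (R1 k s (a s) (b s))) + integral {0..s} (\<lambda>s. cmod (R2 k s (a s) (b s)))"
        by (intro add_mono integral_norm_bound_integral int order_refl)
      also have "\<dots> = integral {0..s} (\<lambda>s. cmod (R1 k s (a s) (b s)) + cmod (R2 k s (a s) (b s)))"
        by (rule integral_add[symmetric]) (rule int)+
      also have "\<dots> \<le> integral {0..s} (\<lambda>s. C * h s)"
      proof (rule integral_le)
        show "(\<lambda>s. cmod (R1 k s (a s) (b s)) + cmod (R2 k s (a s) (b s))) integrable_on {0..s}" by (intro integrable_add int)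
        show "(\<lambda>s. C * h s) integrable_on {0..s}" by (intro integrable_continuous_interval continuous_intros continuous_on_subset[OF c(3) sub])
        fix u assume u: "u \<in> {0..s}"
        then have u': "u \<in> {0..T}" using sub by auto
        have "cmod (R1 k u (a u) (b u)) + cmod (R2 k u (a u) (b u)) \<le> C * (cmod (a u) + cmod (b u))" by (rule Rb[OF k u'])
        also have "\<dots> \<le> C * h u" using le[OF u'] C0 by (intro mult_left_mono) auto
        finally show "cmod (R1 k u (a u) (b u)) + cmod (R2 k u (a u) (b u)) \<le> C * h u" .
      qed
      finally show ?thesis .
    qed
    define M where "M = exp (C * T)"
    have fM: "cmod (f1 k s) + cmod (f2 k s) \<le> M" if k: "cmod k \<le> r" and s: "s \<in> {0..T}" for k s
    proof -
      define u where "u s = cmod (f1 k s) + cmod (f2 k s)" for s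
      have cu: "continuous_on {0..T} u" unfolding u_def by (intro continuous_intros cf)
      have "u s \<le> 1 + C * integral {0..s} u" if s: "s \<in> {0..T}" for s
      proof -
        have "u s \<le> 1 + (cmod (integral {0..s} (\<lambda>s. R1 k s (f1 k s) (f2 k s))) + cmod (integral {0..s} (\<lambda>s. R2 k s (f1 k s) (f2 k s))))"
          unfolding u_def using f1[OF s, of k] f2[OF s, of k]
            norm_triangle_ineq[of 1 "integral {0..s} (\<lambda>s. R2 k s (f1 k s) (f2 k s))"] by simp
        also have "\<dots> \<le> 1 + integral {0..s} (\<lambda>s. C * u s)"
          by (intro add_left_mono step[OF k s cf cu]) (simp add: u_def)
        finally show ?thesis by simp
      qed
      from gronwall[OF cu C0 this s] have "u s \<le> exp (C * s)" by simp
      also have "\<dots> \<le> M" unfolding M_def using s C0 by (simp add: mult_left_mono)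
      finally show ?thesis by (simp add: u_def)
    qed
    \<comment> \<open>The iteration starts from zero, so at n = 0 the error is the solution itself,
      bounded by \<open>M\<close>. Only the second component picks up the initial value 1 in each
      step.\<close>
    have "\<exists>Y1 Y2. poly_family T Y1 \<and> poly_family T Y2 \<and> (\<forall>k s. cmod k \<le> r \<longrightarrow> s \<in> {0..T} \<longrightarrow>
        cmod (f1 k s - Y1 k s) + cmod (f2 k s - Y2 k s) \<le> M * ((C * s) ^ n / fact n))" for n
    proof (induction n)
      case 0
      show ?case using fM by (intro exI[of _ "\<lambda>k s. 0"]) (auto intro!: poly_family.coeff)
    next
      case (Suc n)
      then obtain Y1 Y2 where Y: "poly_family T Y1" "poly_family T Y2"
        and Yb: "\<And>k s. cmod k \<le> r \<Longrightarrow> s \<in> {0..T} \<Longrightarrow> cmod (f1 k s - Y1 k s) + cmod (f2 k s - Y2 k s) \<le> M * ((C * s) ^ n / fact n)"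
        by blast
      have "poly_family T (\<lambda>k s. k * (k * ((- 4 * \<i>) * Y1 k s)) + ((- \<i> * lam * (g0 s * cnj (g0 s))) * Y1 k s
             + (k * ((2 * g0 s) * Y2 k s) + (\<i> * g1 s) * Y2 k s)))"
        by (intro poly_family.add poly_family.shift poly_family_mult Y continuous_intros cg)
      moreover have "(\<lambda>k s. k * (k * ((- 4 * \<i>) * Y1 k s)) + ((- \<i> * lam * (g0 s * cnj (g0 s))) * Y1 k s
             + (k * ((2 * g0 s) * Y2 k s) + (\<i> * g1 s) * Y2 k s))) = (\<lambda>k s. R1 k s (Y1 k s) (Y2 k s))"
        unfolding R1_def by (intro ext) (simp add: power2_eq_square algebra_simps)
      ultimately have "poly_family T (\<lambda>k s. R1 k s (Y1 k s) (Y2 k s))" by simp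
      from poly_family_integral[OF this] obtain Z1 where Z1: "poly_family T Z1"
        "\<And>k t. t \<in> {0..T} \<Longrightarrow> integral {0..t} (\<lambda>s. R1 k s (Y1 k s) (Y2 k s)) = Z1 k t" by blast
      have "poly_family T (\<lambda>k s. k * ((2 * lam * cnj (g0 s)) * Y1 k s) + ((- lam * \<i> * cnj (g1 s)) * Y1 k s
             + (lam * \<i> * (g0 s * cnj (g0 s))) * Y2 k s))"
        by (intro poly_family.add poly_family.shift poly_family_mult Y continuous_intros cg)
      moreover have "(\<lambda>k s. k * ((2 * lam * cnj (g0 s)) * Y1 k s) + ((- lam * \<i> * cnj (g1 s)) * Y1 k s
             + (lam * \<i> * (g0 s * cnj (g0 s))) * Y2 k s)) = (\<lambda>k s. R2 k s (Y1 k s) (Y2 k s))"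
        unfolding R2_def by (intro ext) (simp add: algebra_simps)
      ultimately have "poly_family T (\<lambda>k s. R2 k s (Y1 k s) (Y2 k s))" by simp
      from poly_family_integral[OF this] obtain Z2 where Z2: "poly_family T Z2"
        "\<And>k t. t \<in> {0..T} \<Longrightarrow> integral {0..t} (\<lambda>s. R2 k s (Y1 k s) (Y2 k s)) = Z2 k t" by blast
      show ?case
      proof (intro exI conjI allI impI)
        show "poly_family T Z1" by (rule Z1)
        show "poly_family T (\<lambda>k s. 1 + Z2 k s)" using Z2(1) by (intro poly_family.add poly_family.coeff continuous_intros)
        fix k s assume k: "cmod k \<le> r" and s: "s \<in> {0..T}"
        have sub: "{0..s} \<subseteq> {0..T}" using s by auto
        note cY = poly_family_continuous[OF Y(1), of k] poly_family_continuous[OF Y(2), of k]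
        have "f1 k s - Z1 k s = integral {0..s} (\<lambda>s. R1 k s (f1 k s) (f2 k s) - R1 k s (Y1 k s) (Y2 k s))"
          unfolding f1[OF s] Z1(2)[OF s, symmetric]
          by (intro integral_diff[symmetric] integrable_continuous_interval continuous_on_subset[OF cR(1)[OF cf] sub] continuous_on_subset[OF cR(1)[OF cY] sub])
        moreover have "f2 k s - (1 + Z2 k s) = integral {0..s} (\<lambda>s. R2 k s (f1 k s) (f2 k s) - R2 k s (Y1 k s) (Y2 k s))"
          unfolding f2[OF s] Z2(2)[OF s, symmetric] add_diff_cancel_left
          by (intro integral_diff[symmetric] integrable_continuous_interval continuous_on_subset[OF cR(2)[OF cf] sub] continuous_on_subset[OF cR(2)[OF cY] sub])
        ultimately have "cmod (f1 k s - Z1 k s) + cmod (f2 k s - (1 + Z2 k s))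
            \<le> integral {0..s} (\<lambda>s. C * (M * ((C * s) ^ n / fact n)))"
          using step[OF k s continuous_on_diff[OF cf(1) cY(1)] continuous_on_diff[OF cf(2) cY(2)] _ Yb[OF k]]
          unfolding Rdiff by (simp add: continuous_intros)
        also have "\<dots> = M * ((C * s) ^ Suc n / fact (Suc n))"
        proof (rule integral_unique)
          have "((\<lambda>s. C * (M * ((C * s) ^ n / fact n))) has_integral
              M * ((C * s) ^ Suc n / fact (Suc n)) - M * ((C * 0) ^ Suc n / fact (Suc n))) {0..s}"
          proof (rule fundamental_theorem_of_calculus)
            show "0 \<le> s" using s by simp
            fix u
            define K where "K = M / fact (Suc n)"
            have "((\<lambda>s. K * (C * s) ^ Suc n) has_real_derivative K * (real (Suc n) * (C * u) ^ n * C)) (at u within {0..s})"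
              by (rule derivative_eq_intros refl)+ simp
            moreover have "K * (real (Suc n) * (C * u) ^ n * C) = C * (M * ((C * u) ^ n / fact n))"
              by (simp add: K_def field_simps del: of_nat_Suc)
            moreover have "(\<lambda>s. K * (C * s) ^ Suc n) = (\<lambda>s. M * ((C * s) ^ Suc n / fact (Suc n)))"
              by (simp add: K_def)
            ultimately have "((\<lambda>s. M * ((C * s) ^ Suc n / fact (Suc n))) has_real_derivative C * (M * ((C * u) ^ n / fact n))) (at u within {0..s})"
              by simp
            then show "((\<lambda>s. M * ((C * s) ^ Suc n / fact (Suc n))) has_vector_derivative C * (M * ((C * u) ^ n / fact n))) (at u within {0..s})"
              by (rule has_real_derivative_iff_has_vector_derivative[THEN iffD1])
          qed
          then show "((\<lambda>s. C * (M * ((C * s) ^ n / fact n))) has_integral M * ((C * s) ^ Suc n / fact (Suc n))) {0..s}" by simp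
        qed
        finally show "cmod (f1 k s - Z1 k s) + cmod (f2 k s - (1 + Z2 k s)) \<le> M * ((C * s) ^ Suc n / fact (Suc n))" .
      qed
    qed
    then obtain Y1 Y2 where Y: "\<And>n. poly_family T (Y1 n)" "\<And>n. poly_family T (Y2 n)"
      and Yb: "\<And>n k s. cmod k \<le> r \<Longrightarrow> s \<in> {0..T} \<Longrightarrow> cmod (f1 k s - Y1 n k s) + cmod (f2 k s - Y2 n k s) \<le> M * ((C * s) ^ n / fact n)"
      by metis
    have lim: "(\<lambda>n. M * ((C * t) ^ n / fact n)) \<longlonglongrightarrow> 0"
      using tendsto_mult_right_zero[OF summable_LIMSEQ_zero[OF summable_exp[of "C * t"]], of M] by (simp add: divide_inverse mult.commute)
    have ul: "uniform_limit (cball x d) (\<lambda>n k. Y n k t) (\<lambda>k. f k t) sequentially"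
      if "\<And>n k. cmod k \<le> r \<Longrightarrow> cmod (f k t - Y n k t) \<le> M * ((C * t) ^ n / fact n)" "cball x d \<subseteq> ball 0 r"
      for Y :: "nat \<Rightarrow> complex \<Rightarrow> real \<Rightarrow> complex" and f x d
      unfolding uniform_limit_iff
    proof (intro allI impI)
      fix e :: real assume "e > 0"
      from order_tendstoD(2)[OF lim this]
      show "\<forall>\<^sub>F n in sequentially. \<forall>k\<in>cball x d. dist (Y n k t) (f k t) < e"
      proof eventually_elim
        case (elim n)
        show ?case
        proof
          fix k assume "k \<in> cball x d"
          then have "cmod k \<le> r" using that(2) by force
          from that(1)[OF this, of n] elim show "dist (Y n k t) (f k t) < e" by (simp add: dist_norm norm_minus_commute)
        qed
      qed
    qed
    have b1: "cmod (f1 k t - Y1 n k t) \<le> M * ((C * t) ^ n / fact n)" and b2: "cmod (f2 k t - Y2 n k t) \<le> M * ((C * t) ^ n / fact n)"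
      if "cmod k \<le> r" for n k
      using Yb[OF that t, of n] norm_ge_zero[of "f1 k t - Y1 n k t"] norm_ge_zero[of "f2 k t - Y2 n k t"] by linarith+
    have cb: "\<exists>d>0. cball x d \<subseteq> ball 0 r" if "x \<in> ball 0 r" for x :: complex
      using open_contains_cball that open_ball by blast
    show ?thesis
    proof
      show "(\<lambda>k. f1 k t) holomorphic_on ball 0 r"
        by (rule holomorphic_uniform_sequence[where f = "\<lambda>n k. Y1 n k t", OF open_ball poly_family_holomorphic[OF Y(1)]])
           (use cb ul[where f = f1 and Y = Y1, OF b1] in blast)
      show "(\<lambda>k. f2 k t) holomorphic_on ball 0 r"
        by (rule holomorphic_uniform_sequence[where f = "\<lambda>n k. Y2 n k t", OF open_ball poly_family_holomorphic[OF Y(2)]])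
           (use cb ul[where f = f2 and Y = Y2, OF b2] in blast)
    qed
  qed
  have "f holomorphic_on UNIV" if "\<And>r. r > 0 \<Longrightarrow> f holomorphic_on ball 0 r" for f :: "complex \<Rightarrow> complex"
  proof -
    have "f field_differentiable at z" for z
      using holomorphic_on_imp_differentiable_at[OF that[of "cmod z + 1"] open_ball, of z] by (auto simp: add_nonneg_pos)
    then show ?thesis by (simp add: holomorphic_on_def field_differentiable_at_within)
  qed
  then show "(\<lambda>k. f1 k t) holomorphic_on UNIV" "(\<lambda>k. f2 k t) holomorphic_on UNIV" using hol_ball by blast+
qed

section \<open>Wronskians and the connection coefficient\<close>

lemma zero_derivative_eq:
  fixes f :: "real \<Rightarrow> complex"
  assumes "\<And>x. x \<in> {0..T} \<Longrightarrow> (f has_vector_derivative 0) (at x within {0..T})" "s \<in> {0..T}" "t \<in> {0..T}"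
  shows "f s = f t"
  using vector_derivative_bound[of 0 T f "\<lambda>x. 0" 0 s t] assms by simp

text \<open>Liouville's formula: the coefficient matrix has trace -4ik^2, because the two |g0|^2
  entries cancel.\<close>

lemma wronskian_constant:
  assumes f: "t_part_system lam T g0 g1 k f1 f2" and h: "t_part_system lam T g0 g1 k h1 h2" and st: "s \<in> {0..T}" "t \<in> {0..T}"
  shows "exp (4 * \<i> * k\<^sup>2 * of_real s) * (f1 s * h2 s - f2 s * h1 s) = exp (4 * \<i> * k\<^sup>2 * of_real t) * (f1 t * h2 t - f2 t * h1 t)"
proof (rule zero_derivative_eq[OF _ st])
  fix x assume x: "x \<in> {0..T}"
  note fd = f[unfolded t_part_system_def, rule_format, OF x] and hd = h[unfolded t_part_system_def, rule_format, OF x]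
  have e: "((\<lambda>x. exp (4 * \<i> * k\<^sup>2 * of_real x)) has_vector_derivative (4 * \<i> * k\<^sup>2) * exp (4 * \<i> * k\<^sup>2 * of_real x)) (at x within {0..T})"
    by (rule has_vector_derivative_real_field[THEN has_vector_derivative_at_within]) (auto intro!: derivative_eq_intros)
  show "((\<lambda>x. exp (4 * \<i> * k\<^sup>2 * of_real x) * (f1 x * h2 x - f2 x * h1 x)) has_vector_derivative 0) (at x within {0..T})"
    by (rule has_vector_derivative_eq_rhs[OF has_vector_derivative_mult[OF e has_vector_derivative_diff[OF
        has_vector_derivative_mult[OF conjunct1[OF fd] conjunct2[OF hd]] has_vector_derivative_mult[OF conjunct2[OF fd] conjunct1[OF hd]]]]])
       algebra
qed

text \<open>For real \<open>lam\<close> the symmetry of the Lax pair turns a second column h at cnj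
  k into the first column (cnj h2, lam cnj h1) at k. The expression is the determinant of the matrix
  with this column and f, constant because \<open>Qtilde\<close> is trace free.\<close>

lemma wronskian_star_constant:
  assumes f: "t_part_system lam T g0 g1 k f1 f2" and h: "t_part_system lam T g0 g1 (cnj k) h1 h2" and lam: "cnj lam = lam"
    and st: "s \<in> {0..T}" "t \<in> {0..T}"
  shows "f2 s * cnj (h2 s) - lam * f1 s * cnj (h1 s) = f2 t * cnj (h2 t) - lam * f1 t * cnj (h1 t)"
proof (rule zero_derivative_eq[OF _ st])
  fix x assume x: "x \<in> {0..T}"
  note fd = f[unfolded t_part_system_def, rule_format, OF x] and hd = h[unfolded t_part_system_def, rule_format, OF x]
  note h1 = has_vector_derivative_cnj[OF conjunct1[OF hd]] and h2 = has_vector_derivative_cnj[OF conjunct2[OF hd]]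
  show "((\<lambda>x. f2 x * cnj (h2 x) - lam * f1 x * cnj (h1 x)) has_vector_derivative 0) (at x within {0..T})"
    by (rule has_vector_derivative_eq_rhs[OF has_vector_derivative_diff[OF has_vector_derivative_mult[OF conjunct2[OF fd] h2]
        has_vector_derivative_mult[OF has_vector_derivative_mult_right[OF conjunct1[OF fd]] h1]]])
       (simp add: lam algebra_simps)
qed

text \<open>The coefficient is the first component, at x = 0, of the solution of the x-part that
  equals (0, 1) at x = L. The x-part is linear in k, so Gronwall's inequality yields order one,
  whereas the k^2 in the t-part would only yield order two.\<close>

lemma space_connection_exp_type:
  fixes M1 M2 :: "real \<Rightarrow> complex \<Rightarrow> complex" and q :: "real \<Rightarrow> complex"
  assumes L: "0 \<le> L" and cq: "continuous_on {0..L} q" and lam: "cnj lam = lam" "cmod lam = 1"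
    and d1: "\<And>k x. x \<in> {0..L} \<Longrightarrow> ((\<lambda>x. M1 x k) has_vector_derivative - 2 * \<i> * k * M1 x k + q x * M2 x k) (at x within {0..L})"
    and d2: "\<And>k x. x \<in> {0..L} \<Longrightarrow> ((\<lambda>x. M2 x k) has_vector_derivative lam * (cnj (q x) * M1 x k)) (at x within {0..L})"
    and det: "\<And>k. M2 L k * cnj (M2 L (cnj k)) - lam * M1 L k * cnj (M1 L (cnj k)) = 1"
  shows "exp_type (\<lambda>k. M1 0 k * cnj (M2 L (cnj k)) - cnj (M2 0 (cnj k)) * M1 L k * exp (2 * \<i> * k * of_real L))"
proof -
  obtain B where B: "B \<ge> 0" "\<And>x. x \<in> {0..L} \<Longrightarrow> cmod (q x) \<le> B" using continuous_bounded_Icc[OF cq] by blast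
  define c where "c k = M1 0 k * cnj (M2 L (cnj k)) - cnj (M2 0 (cnj k)) * M1 L k * exp (2 * \<i> * k * of_real L)" for k
  have main: "cmod (c k) \<le> exp ((2 * cmod k + 2 * B) * L)" for k
  proof -
    \<comment> \<open>\<open>(v1, v2)\<close> combines the given column with its symmetric partner
      and equals (0, 1) at x = L by the determinant condition. The factor exp (2ik(L - x)) turns the
      equation of a first column into that of a second one.\<close>
    define v1 where "v1 x = M1 x k * cnj (M2 L (cnj k)) - cnj (M2 x (cnj k)) * (M1 L k * exp (2 * \<i> * k * of_real (L - x)))" for x
    define v2 where "v2 x = M2 x k * cnj (M2 L (cnj k)) - (lam * cnj (M1 x (cnj k))) * (M1 L k * exp (2 * \<i> * k * of_real (L - x)))" for x
    have e: "((\<lambda>x. M1 L k * exp (2 * \<i> * k * of_real (L - x))) has_vector_derivative (- 2 * \<i> * k) * (M1 L k * exp (2 * \<i> * k * of_real (L - x)))) (at x within {0..L})" for x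
      unfolding of_real_diff by (rule has_vector_derivative_real_field[THEN has_vector_derivative_at_within]) (auto intro!: derivative_eq_intros)
    have v1d: "(v1 has_vector_derivative - 2 * \<i> * k * v1 x + q x * v2 x) (at x within {0..L})" if x: "x \<in> {0..L}" for x
      unfolding v1_def
      by (rule has_vector_derivative_eq_rhs[OF has_vector_derivative_diff[OF has_vector_derivative_mult_left[OF d1[OF x]]
          has_vector_derivative_mult[OF has_vector_derivative_cnj[OF d2[OF x]] e]]])
         (simp add: v1_def v2_def lam algebra_simps)
    have v2d: "(v2 has_vector_derivative lam * cnj (q x) * v1 x) (at x within {0..L})" if x: "x \<in> {0..L}" for x
      unfolding v2_def
      by (rule has_vector_derivative_eq_rhs[OF has_vector_derivative_diff[OF has_vector_derivative_mult_left[OF d2[OF x]]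
          has_vector_derivative_mult[OF has_vector_derivative_mult_right[OF has_vector_derivative_cnj[OF d1[OF x]]] e]]])
         (simp add: v1_def v2_def lam algebra_simps)
    define C where "C = 2 * cmod k + 2 * B"
    have C0: "C \<ge> 0" using B by (simp add: C_def)
    \<comment> \<open>The distance from L is the variable, so that Gronwall's inequality starts from
      the known value.\<close>
    define u where "u x = cmod (v1 (L - x)) + cmod (v2 (L - x))" for x
    have refl: "((\<lambda>x. f (L - x)) has_vector_derivative - f' (L - x)) (at x within {0..L})"
      if "\<And>x. x \<in> {0..L} \<Longrightarrow> (f has_vector_derivative f' x) (at x within {0..L})" "x \<in> {0..L}" for f f' :: "real \<Rightarrow> complex" and x
    proof -
      have img: "(\<lambda>x. L - x) ` {0..L} \<subseteq> {0..L}" by auto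
      have "((\<lambda>x. L - x) has_vector_derivative - 1) (at x within {0..L})" by (auto intro!: derivative_eq_intros)
      moreover have "(f has_vector_derivative f' (L - x)) (at (L - x) within (\<lambda>x. L - x) ` {0..L})"
        by (rule has_vector_derivative_within_subset[OF that(1) img]) (use that(2) in auto)
      ultimately show ?thesis using vector_diff_chain_within[of "\<lambda>x. L - x" "-1" x "{0..L}" f] by (simp add: o_def)
    qed
    have cq': "continuous_on {0..L} (\<lambda>x. q (L - x))" by (rule continuous_on_compose2[OF cq]) (auto intro!: continuous_intros)
    have cv: "continuous_on {0..L} (\<lambda>x. v1 (L - x))" "continuous_on {0..L} (\<lambda>x. v2 (L - x))"
      by (rule has_vector_derivative_imp_continuous_on, rule refl[OF v1d], assumption+) (rule has_vector_derivative_imp_continuous_on, rule refl[OF v2d], assumption+)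
    have cu: "continuous_on {0..L} u" unfolding u_def by (intro continuous_intros cv)
    have v0: "v1 L = 0" "v2 L = 1" using det[of k] by (simp_all add: v1_def v2_def mult_ac)
    have "u x \<le> 1 + C * integral {0..x} u" if x: "x \<in> {0..L}" for x
    proof -
      have "cmod (v1 (L - x)) \<le> exp (0 * L) * (cmod (v1 (L - 0)) + integral {0..x} (\<lambda>x. 2 * cmod k * cmod (v1 (L - x)) + B * u x))"
      proof (rule duhamel_bound[where F = "\<lambda>x. - (- 2 * \<i> * k * v1 (L - x) + q (L - x) * v2 (L - x))" and w = 0])
        fix x assume x: "x \<in> {0..L}"
        show "((\<lambda>x. v1 (L - x)) has_vector_derivative 0 * v1 (L - x) + - (- 2 * \<i> * k * v1 (L - x) + q (L - x) * v2 (L - x))) (at x within {0..L})"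
          using refl[OF v1d x] by simp
        have "cmod (q (L - x) * v2 (L - x)) \<le> B * u x"
          unfolding norm_mult u_def using B(1) B(2)[of "L - x"] x by (intro mult_mono) auto
        then show "cmod (- (- 2 * \<i> * k * v1 (L - x) + q (L - x) * v2 (L - x))) \<le> 2 * cmod k * cmod (v1 (L - x)) + B * u x"
          unfolding norm_minus_cancel by (intro norm_triangle_le add_mono) (auto simp: norm_mult)
      qed (use x in \<open>auto intro!: continuous_intros cv cq' cu\<close>)
      moreover have "cmod (v2 (L - x)) \<le> exp (0 * L) * (cmod (v2 (L - 0)) + integral {0..x} (\<lambda>x. B * u x))"
      proof (rule duhamel_bound[where F = "\<lambda>x. - (lam * cnj (q (L - x)) * v1 (L - x))" and w = 0])
        fix x assume x: "x \<in> {0..L}"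
        show "((\<lambda>x. v2 (L - x)) has_vector_derivative 0 * v2 (L - x) + - (lam * cnj (q (L - x)) * v1 (L - x))) (at x within {0..L})"
          using refl[OF v2d x] by simp
        show "cmod (- (lam * cnj (q (L - x)) * v1 (L - x))) \<le> B * u x"
          unfolding norm_minus_cancel norm_mult u_def lam using B(1) B(2)[of "L - x"] x by (auto intro!: mult_mono)
      qed (use x in \<open>auto intro!: continuous_intros cv cq' cu\<close>)
      ultimately have "u x \<le> 1 + (integral {0..x} (\<lambda>x. 2 * cmod k * cmod (v1 (L - x)) + B * u x) + integral {0..x} (\<lambda>x. B * u x))"
        using v0 by (simp add: u_def)
      also have "integral {0..x} (\<lambda>x. 2 * cmod k * cmod (v1 (L - x)) + B * u x) \<le> integral {0..x} (\<lambda>x. (2 * cmod k + B) * u x)"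
      proof (rule integral_le)
        have sub: "{0..x} \<subseteq> {0..L}" using x by auto
        show "(\<lambda>x. 2 * cmod k * cmod (v1 (L - x)) + B * u x) integrable_on {0..x}" "(\<lambda>x. (2 * cmod k + B) * u x) integrable_on {0..x}"
          by (intro integrable_continuous_interval continuous_intros continuous_on_subset[OF cv(1) sub] continuous_on_subset[OF cu sub])+
        show "2 * cmod k * cmod (v1 (L - y)) + B * u y \<le> (2 * cmod k + B) * u y" for y
          unfolding distrib_right by (intro add_right_mono mult_left_mono) (auto simp: u_def)
      qed
      finally show ?thesis unfolding integral_mult_right by (simp add: C_def algebra_simps)
    qed
    from gronwall[OF cu C0 this, of L] have "u L \<le> exp (C * L)" using L by simp
    moreover have "cmod (v1 0) \<le> u L" by (simp add: u_def)
    moreover have "v1 0 = c k" by (simp add: v1_def c_def mult_ac)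
    ultimately show ?thesis by (simp add: C_def)
  qed
  show ?thesis unfolding c_def[symmetric] exp_type_def
  proof (intro exI[of _ "2 * L + exp (2 * B * L)"] allI)
    fix k
    have "cmod (c k) \<le> exp (2 * B * L) * exp (2 * L * cmod k)"
      using main[of k] by (simp add: exp_add[symmetric] algebra_simps)
    also have "\<dots> \<le> (2 * L + exp (2 * B * L)) * exp ((2 * L + exp (2 * B * L)) * cmod k)"
      using L by (intro mult_mono) (auto intro!: mult_right_mono)
    finally show "cmod (c k) \<le> (2 * L + exp (2 * B * L)) * exp ((2 * L + exp (2 * B * L)) * cmod k)" .
  qed
qed

section \<open>The eigenfunctions along polygonal paths\<close>

text \<open>For n > 0 the definition does not state joint continuity of the function itself. By
  induction the partial derivatives are continuous, hence bounded on the rectangle, and moving along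
  one coordinate at a time makes the function Lipschitz.\<close>

lemma C_on_rect_continuous:
  assumes "0 < L" "0 < T" "C_on_rect n L T f"
  shows "continuous_on (rect L T) (\<lambda>(x, t). f x t)"
  using assms(3)
proof (induction n arbitrary: f)
  case 0 then show ?case by simp
next
  case (Suc n)
  have comp: "compact (rect L T)" unfolding rect_def by (intro compact_Times) auto
  have bnd: "\<exists>M. \<forall>x\<in>{0..L}. \<forall>t\<in>{0..T}. cmod (g x t) \<le> M" if "continuous_on (rect L T) (\<lambda>(x, t). g x t)" for g
  proof -
    have "bounded ((\<lambda>(x, t). g x t) ` rect L T)"
      using comp that by (intro compact_imp_bounded compact_continuous_image)
    then obtain M where M: "\<And>y. y \<in> (\<lambda>(x, t). g x t) ` rect L T \<Longrightarrow> cmod y \<le> M" unfolding bounded_iff by blast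
    have "cmod (g x t) \<le> M" if "x \<in> {0..L}" "t \<in> {0..T}" for x t
      using M[of "g x t"] that by (force simp: rect_def)
    then show ?thesis by blast
  qed
  have "\<exists>M. \<forall>x\<in>{0..L}. \<forall>t\<in>{0..T}. cmod (dx L f x t) \<le> M" using Suc by (intro bnd Suc.IH) auto
  then obtain M1 where M1: "\<And>x t. x \<in> {0..L} \<Longrightarrow> t \<in> {0..T} \<Longrightarrow> cmod (dx L f x t) \<le> M1" by blast
  have "\<exists>M. \<forall>x\<in>{0..L}. \<forall>t\<in>{0..T}. cmod (dt T f x t) \<le> M" using Suc by (intro bnd Suc.IH) auto
  then obtain M2 where M2: "\<And>x t. x \<in> {0..L} \<Longrightarrow> t \<in> {0..T} \<Longrightarrow> cmod (dt T f x t) \<le> M2" by blast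
  have pos: "0 \<le> M1" "0 \<le> M2" using M1[of 0 0] M2[of 0 0] assms by (auto intro: order_trans[OF norm_ge_zero])
  have d: "((\<lambda>y. f y t) has_vector_derivative dx L f x t) (at x within {0..L})"
    "((\<lambda>s. f x s) has_vector_derivative dt T f x t) (at t within {0..T})" if "x \<in> {0..L}" "t \<in> {0..T}" for x t
    using Suc.prems that unfolding dx_def dt_def C_on_rect.simps vector_derivative_works[symmetric] by blast+
  have "(M1 + M2)-lipschitz_on (rect L T) (\<lambda>(x, t). f x t)"
  proof (rule lipschitz_onI)
    fix P Q assume PQ: "P \<in> rect L T" "Q \<in> rect L T"
    obtain x t where P: "P = (x, t)" by fastforce
    obtain y s where Q: "Q = (y, s)" by fastforce
    have r: "x \<in> {0..L}" "t \<in> {0..T}" "y \<in> {0..L}" "s \<in> {0..T}" using PQ by (auto simp: P Q rect_def)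
    have "cmod (f x t - f y t) \<le> M1 * \<bar>x - y\<bar>"
      by (rule vector_derivative_bound[OF d(1)]) (use r M1 in auto)
    moreover have "cmod (f y t - f y s) \<le> M2 * \<bar>t - s\<bar>"
      by (rule vector_derivative_bound[OF d(2)]) (use r M2 in auto)
    moreover have "cmod (f x t - f y s) \<le> cmod (f x t - f y t) + cmod (f y t - f y s)"
      using norm_triangle_ineq[of "f x t - f y t" "f y t - f y s"] by simp
    moreover have "\<bar>x - y\<bar> \<le> dist P Q" "\<bar>t - s\<bar> \<le> dist P Q"
      using dist_fst_le[of P Q] dist_snd_le[of P Q] by (auto simp: P Q dist_real_def)
    then have "M1 * \<bar>x - y\<bar> + M2 * \<bar>t - s\<bar> \<le> M1 * dist P Q + M2 * dist P Q"
      using pos by (intro add_mono mult_left_mono) auto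
    ultimately show "dist (case P of (x, t) \<Rightarrow> f x t) (case Q of (x, t) \<Rightarrow> f x t) \<le> (M1 + M2) * dist P Q"
      by (simp add: P Q dist_norm algebra_simps)
  qed (use pos in auto)
  then show ?case by (rule lipschitz_on_continuous_on)
qed

lemma C_on_rect_time_derivative:
  assumes "0 < L" "0 < T" "C_on_rect (Suc (Suc n)) L T f" "x \<in> {0..L}"
  shows "\<And>t. t \<in> {0..T} \<Longrightarrow> ((\<lambda>s. f x s) has_vector_derivative dt T f x t) (at t within {0..T})"
    and "C1_fun T (\<lambda>t. dt T f x t)"
proof -
  show "((\<lambda>s. f x s) has_vector_derivative dt T f x t) (at t within {0..T})" if "t \<in> {0..T}" for t
    using assms(3,4) that unfolding dt_def C_on_rect.simps vector_derivative_works[symmetric] by blast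
  have "C_on_rect n L T (dt T (dt T f))" using assms(3) by simp
  then have c: "continuous_on (rect L T) (\<lambda>(x, t). dt T (dt T f) x t)" by (rule C_on_rect_continuous[OF assms(1,2)])
  have "continuous_on {0..T} (\<lambda>t. (\<lambda>(x, t). dt T (dt T f) x t) (x, t))"
    by (rule continuous_on_compose2[OF c]) (use assms(4) in \<open>auto intro!: continuous_intros simp: rect_def\<close>)
  moreover have "((\<lambda>s. dt T f x s) has_vector_derivative dt T (dt T f) x t) (at t within {0..T})" if "t \<in> {0..T}" for t
  proof -
    have "(\<lambda>s. dt T f x s) differentiable (at t within {0..T})" using assms(3,4) that by simp
    then show ?thesis unfolding dt_def[of T "dt T f"] vector_derivative_works .
  qed
  ultimately show "C1_fun T (\<lambda>t. dt T f x t)" unfolding C1_fun_def by auto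
qed

text \<open>An oriented substitution: t1 may lie below t0, hence the difference of two integrals
  starting at 0.\<close>

lemma segment_integral:
  fixes F :: "real \<Rightarrow> complex"
  assumes F: "continuous_on {0..T} F" and t: "t0 \<in> {0..T}" "t1 \<in> {0..T}"
  shows "of_real (t1 - t0) * integral {0..1} (\<lambda>s. F (t0 + s * (t1 - t0))) = integral {0..t1} F - integral {0..t0} F"
proof -
  define W where "W s = integral {0..s} F" for s
  have "((\<lambda>s. of_real (t1 - t0) * F (t0 + s * (t1 - t0))) has_integral
      (W \<circ> (\<lambda>s. t0 + s * (t1 - t0))) 1 - (W \<circ> (\<lambda>s. t0 + s * (t1 - t0))) 0) {0..1}"
  proof (rule fundamental_theorem_of_calculus)
    fix s :: real assume s: "s \<in> {0..1}"
    have img: "(\<lambda>s. t0 + s * (t1 - t0)) ` {0..1} \<subseteq> {0..T}"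
    proof
      fix y assume "y \<in> (\<lambda>s. t0 + s * (t1 - t0)) ` {0..1}"
      then obtain u where u0: "y = t0 + u * (t1 - t0)" "u \<in> {0..1}" by blast
      then have u: "y = (1 - u) * t0 + u * t1" "0 \<le> u" "u \<le> 1" by (simp_all add: algebra_simps)
      have "(1 - u) * t0 + u * t1 \<le> (1 - u) * T + u * T" using u t by (intro add_mono mult_left_mono) auto
      moreover have "(1 - u) * T + u * T = T" by (simp add: algebra_simps)
      ultimately show "y \<in> {0..T}" using u t by simp
    qed
    have "((\<lambda>s. t0 + s * (t1 - t0)) has_vector_derivative (t1 - t0)) (at s within {0..1})"
      by (auto intro!: derivative_eq_intros)
    moreover have "(W has_vector_derivative F (t0 + s * (t1 - t0))) (at (t0 + s * (t1 - t0)) within (\<lambda>s. t0 + s * (t1 - t0)) ` {0..1})"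
    proof -
      have "t0 + s * (t1 - t0) \<in> {0..T}" using img s by blast
      from integral_has_vector_derivative[OF F this] show ?thesis
        unfolding W_def by (rule has_vector_derivative_within_subset[OF _ img])
    qed
    ultimately have "((W \<circ> (\<lambda>s. t0 + s * (t1 - t0))) has_vector_derivative (t1 - t0) *\<^sub>R F (t0 + s * (t1 - t0))) (at s within {0..1})"
      by (rule vector_diff_chain_within)
    then show "((W \<circ> (\<lambda>s. t0 + s * (t1 - t0))) has_vector_derivative of_real (t1 - t0) * F (t0 + s * (t1 - t0))) (at s within {0..1})"
      by (simp only: scaleR_conv_of_real)
  qed simp
  from integral_unique[OF this] show ?thesis unfolding W_def o_def by simp
qed

lemma continuous_on_matrix2:
  fixes f :: "'a::topological_space \<Rightarrow> complex^2^2"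
  assumes "continuous_on S (\<lambda>x. f x $ 1 $ 1)" "continuous_on S (\<lambda>x. f x $ 1 $ 2)"
    "continuous_on S (\<lambda>x. f x $ 2 $ 1)" "continuous_on S (\<lambda>x. f x $ 2 $ 2)"
  shows "continuous_on S f"
proof -
  have "continuous_on S (\<lambda>x. f x $ i $ j)" for i j :: 2
    using assms exhaust_2[of i] exhaust_2[of j] by auto
  then have "continuous_on S (\<lambda>x. \<chi> i j. f x $ i $ j)" by (intro continuous_on_vec_lambda)
  then show ?thesis by simp
qed

text \<open>The integrand of \<open>lax_line_integral\<close> with velocity and position as
  independent arguments, so that a change of speed is homogeneity in \<open>v\<close>.\<close>

definition lax_form ::
    "real \<Rightarrow> complex \<Rightarrow> (real \<Rightarrow> real \<Rightarrow> complex) \<Rightarrow> (real \<Rightarrow> real \<Rightarrow> complex \<Rightarrow> complex^2^2) \<Rightarrow>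
     complex \<Rightarrow> real \<Rightarrow> real \<Rightarrow> real \<times> real \<Rightarrow> real \<times> real \<Rightarrow> complex^2^2" where
  "lax_form L lam q \<mu> k x t v P =
     exp_sigma3_hat (\<i> * (k * of_real (fst P - x) + 2 * k\<^sup>2 * of_real (snd P - t)))
       ((fst v *\<^sub>R Qmat lam q (fst P) (snd P) + snd v *\<^sub>R Qtilde L lam q k (fst P) (snd P)) ** \<mu> (fst P) (snd P) k)"

lemma exp_sigma3_hat_nth:
  "exp_sigma3_hat z A $ 1 $ 1 = A $ 1 $ 1" "exp_sigma3_hat z A $ 1 $ 2 = exp (2 * z) * A $ 1 $ 2"
  "exp_sigma3_hat z A $ 2 $ 1 = exp (- 2 * z) * A $ 2 $ 1" "exp_sigma3_hat z A $ 2 $ 2 = A $ 2 $ 2"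
proof -
  have e: "exp (2 * z) = exp z * exp z" "exp (- 2 * z) = exp (- z) * exp (- z)" "exp z * exp (- z) = 1"
    by (simp_all add: exp_add[symmetric])
  show "exp_sigma3_hat z A $ 1 $ 1 = A $ 1 $ 1" "exp_sigma3_hat z A $ 1 $ 2 = exp (2 * z) * A $ 1 $ 2"
    "exp_sigma3_hat z A $ 2 $ 1 = exp (- 2 * z) * A $ 2 $ 1" "exp_sigma3_hat z A $ 2 $ 2 = A $ 2 $ 2"
    unfolding e exp_sigma3_hat_def using e(3) by (simp_all add: matrix_matrix_mult_def sum_2 mat2_def mult_ac)
qed

lemma lax_form_nth:
  fixes P v :: "real \<times> real" and k :: complex and x t :: real
  defines "x' \<equiv> fst P" and "t' \<equiv> snd P"
  defines "z \<equiv> \<i> * (k * of_real (fst P - x) + 2 * k\<^sup>2 * of_real (snd P - t))"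
  shows "lax_form L lam q \<mu> k x t v P $ 1 $ j = (if j = 1 then 1 else exp (2 * z)) *
      (of_real (fst v) * (q x' t' * \<mu> x' t' k $ 2 $ j) +
       of_real (snd v) * (- \<i> * lam * of_real ((cmod (q x' t'))\<^sup>2) * \<mu> x' t' k $ 1 $ j
         + (2 * k * q x' t' + \<i> * dx L q x' t') * \<mu> x' t' k $ 2 $ j))" (is ?A)
    and "lax_form L lam q \<mu> k x t v P $ 2 $ j = (if j = 1 then exp (- 2 * z) else 1) *
      (of_real (fst v) * (lam * cnj (q x' t') * \<mu> x' t' k $ 1 $ j) +
       of_real (snd v) * (lam * ((2 * k * cnj (q x' t') - \<i> * cnj (dx L q x' t')) * \<mu> x' t' k $ 1 $ j
         + \<i> * of_real ((cmod (q x' t'))\<^sup>2) * \<mu> x' t' k $ 2 $ j)))"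
proof -
  have "j = 1 \<or> j = 2" using exhaust_2[of j] .
  then show ?A
    "lax_form L lam q \<mu> k x t v P $ 2 $ j = (if j = 1 then exp (- 2 * z) else 1) *
      (of_real (fst v) * (lam * cnj (q x' t') * \<mu> x' t' k $ 1 $ j) +
       of_real (snd v) * (lam * ((2 * k * cnj (q x' t') - \<i> * cnj (dx L q x' t')) * \<mu> x' t' k $ 1 $ j
         + \<i> * of_real ((cmod (q x' t'))\<^sup>2) * \<mu> x' t' k $ 2 $ j)))"
    unfolding lax_form_def x'_def t'_def z_def
    by (auto simp: exp_sigma3_hat_nth)
       (simp_all add: matrix_matrix_mult_def sum_2 Qtilde_def Qmat_def mat2_def sigma3_def mat_def scaleR_conv_of_real[where 'a=complex] algebra_simps)
qed

lemma lax_form_scale: "lax_form L lam q \<mu> k x t (r *\<^sub>R v) P = r *\<^sub>R lax_form L lam q \<mu> k x t v P"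
proof -
  have distrib: "e * (of_real (r * a) * X + of_real (r * b) * Y) = r *\<^sub>R (e * (of_real a * X + of_real b * Y))"
    for a b :: real and e X Y :: complex
    by (simp add: scaleR_conv_of_real algebra_simps)
  have "lax_form L lam q \<mu> k x t (r *\<^sub>R v) P $ i $ j = (r *\<^sub>R lax_form L lam q \<mu> k x t v P) $ i $ j" for i j
    using exhaust_2[of i]
    by (elim disjE; simp only: vector_scaleR_component lax_form_nth fst_scaleR snd_scaleR real_scaleR_def distrib)
  then show ?thesis by (simp add: vec_eq_iff)
qed

text \<open>What the four eigenfunctions have in common; the base point is left open.\<close>

locale lax_data =
  fixes L T :: real and lam :: complex and q :: "real \<Rightarrow> real \<Rightarrow> complex"
    and \<mu> :: "real \<Rightarrow> real \<Rightarrow> complex \<Rightarrow> complex^2^2" and x0 t0 :: real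
  assumes LT: "0 < L" "0 < T"
    and cont_q: "continuous_on (rect L T) (\<lambda>(x, t). q x t)"
    and cont_qx: "continuous_on (rect L T) (\<lambda>(x, t). dx L q x t)"
    and eig: "eigenfunction L T lam q x0 t0 \<mu>"
    and base: "x0 \<in> {0..L}" "t0 \<in> {0..T}"
begin

lemma cont_\<mu>: "continuous_on (rect L T) (\<lambda>P. \<mu> (fst P) (snd P) k $ i $ j)"
proof -
  have "continuous_on (rect L T) (\<lambda>P. \<mu> (fst P) (snd P) k)"
    using eig unfolding eigenfunction_def by (simp add: case_prod_beta)
  then show ?thesis by (intro continuous_intros)
qed

lemma cont_q': "continuous_on (rect L T) (\<lambda>P. q (fst P) (snd P))"
  "continuous_on (rect L T) (\<lambda>P. dx L q (fst P) (snd P))"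
  using cont_q cont_qx by (simp_all add: case_prod_beta)

lemma cont_lax_form: "continuous_on (rect L T) (lax_form L lam q \<mu> k x t v)"
proof -
  have n: "((2::2) = 1) = False" by simp
  show ?thesis
    by (intro continuous_on_matrix2; simp only: lax_form_nth n refl if_True if_False)
       (intro cont_\<mu> cont_q' continuous_on_mult continuous_on_add continuous_on_diff continuous_on_const continuous_on_minus
         continuous_on_of_real continuous_on_power continuous_on_norm continuous_on_exp continuous_on_cnj continuous_on_fst continuous_on_snd continuous_on_id)+
qed

text \<open>Joining runs each leg at double speed over half the parameter interval, and the factors
  2 and 1/2 cancel. The derivative of the joined path at 0, 1/2 and 1 does not affect the
  integral.\<close>

lemma lax_line_integral_polyline:
  assumes abc: "a \<in> rect L T" "b \<in> rect L T" "c \<in> rect L T"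
  shows "lax_line_integral L lam q \<mu> k x t (linepath a b +++ linepath b c)
    = integral {0..1} (\<lambda>s. lax_form L lam q \<mu> k x t (b - a) (linepath a b s))
    + integral {0..1} (\<lambda>s. lax_form L lam q \<mu> k x t (c - b) (linepath b c s))"
proof -
  let ?p = "linepath a b +++ linepath b c"
  define Ig where "Ig s = lax_form L lam q \<mu> k x t (vector_derivative ?p (at s within {0..1})) (?p s)" for s
  have conv: "convex (rect L T)" unfolding rect_def by (intro convex_Times) auto
  have ci: "(\<lambda>s. lax_form L lam q \<mu> k x t (d - e) (linepath e d s)) integrable_on {0..1}"
    if "e \<in> rect L T" "d \<in> rect L T" for d e
  proof (rule integrable_continuous_interval, rule continuous_on_compose2[OF cont_lax_form])
    show "linepath e d ` {0..1} \<subseteq> rect L T"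
      using closed_segment_subset[OF that conv] by (simp add: linepath_image_01)
  qed (intro continuous_intros)
  define I1 I2 where "I1 = integral {0..1} (\<lambda>s. lax_form L lam q \<mu> k x t (b - a) (linepath a b s))"
    and "I2 = integral {0..1} (\<lambda>s. lax_form L lam q \<mu> k x t (c - b) (linepath b c s))"
  have i1: "((\<lambda>s. lax_form L lam q \<mu> k x t (b - a) (linepath a b s)) has_integral I1) (cbox 0 1)"
    and i2: "((\<lambda>s. lax_form L lam q \<mu> k x t (c - b) (linepath b c s)) has_integral I2) (cbox 0 1)"
    unfolding I1_def I2_def
    using integrable_integral[OF ci[OF abc(1,2)]] integrable_integral[OF ci[OF abc(2,3)]] by simp_all
  have d: "vector_derivative ?p (at s within {0..1}) = 2 *\<^sub>R (b - a)" if "0 < s" "s < 1/2" for s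
  proof -
    have "((\<lambda>s. linepath a b (2 * s)) has_vector_derivative 2 *\<^sub>R (b - a)) (at s)"
      unfolding linepath_def by (auto intro!: derivative_eq_intros simp: algebra_simps scaleR_2[symmetric])
    then have "(?p has_vector_derivative 2 *\<^sub>R (b - a)) (at s)"
      by (rule has_vector_derivative_transform_within_open[where S = "{0<..<1/2}"]) (use that in \<open>auto simp: joinpaths_def\<close>)
    then show ?thesis using that by (simp add: at_within_Icc_at vector_derivative_at)
  qed
  have d': "vector_derivative ?p (at s within {0..1}) = 2 *\<^sub>R (c - b)" if "1/2 < s" "s < 1" for s
  proof -
    have "((\<lambda>s. linepath b c (2 * s - 1)) has_vector_derivative 2 *\<^sub>R (c - b)) (at s)"
      unfolding linepath_def by (auto intro!: derivative_eq_intros simp: algebra_simps scaleR_2[symmetric])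
    then have "(?p has_vector_derivative 2 *\<^sub>R (c - b)) (at s)"
      by (rule has_vector_derivative_transform_within_open[where S = "{1/2<..<1}"]) (use that in \<open>auto simp: joinpaths_def\<close>)
    then show ?thesis using that by (simp add: at_within_Icc_at vector_derivative_at)
  qed
  have h1: "(Ig has_integral I1) (cbox 0 (1/2))"
  proof (rule has_integral_spike_interior)
    from has_integral_scaleR_left has_integral_affinity'[OF i1, of 2 0]
    have "((\<lambda>s. lax_form L lam q \<mu> k x t (b - a) (linepath a b (2 * s))) has_integral (1/2) *\<^sub>R I1) (cbox 0 (1/2))" by simp
    from has_integral_cmul[OF this, of 2]
    show "((\<lambda>s. 2 *\<^sub>R lax_form L lam q \<mu> k x t (b - a) (linepath a b (2 * s))) has_integral I1) (cbox 0 (1/2))" by simp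
    show "Ig s = 2 *\<^sub>R lax_form L lam q \<mu> k x t (b - a) (linepath a b (2 * s))" if "s \<in> box 0 (1/2)" for s
      using that d[of s] unfolding Ig_def by (simp add: lax_form_scale joinpaths_def)
  qed
  have h2: "(Ig has_integral I2) (cbox (1/2) 1)"
  proof (rule has_integral_spike_interior)
    from has_integral_affinity'[OF i2, of 2 "-1"]
    have "((\<lambda>s. lax_form L lam q \<mu> k x t (c - b) (linepath b c (2 * s - 1))) has_integral (1/2) *\<^sub>R I2) (cbox (1/2) 1)" by simp
    from has_integral_cmul[OF this, of 2]
    show "((\<lambda>s. 2 *\<^sub>R lax_form L lam q \<mu> k x t (c - b) (linepath b c (2 * s - 1))) has_integral I2) (cbox (1/2) 1)" by simp
    show "Ig s = 2 *\<^sub>R lax_form L lam q \<mu> k x t (c - b) (linepath b c (2 * s - 1))" if "s \<in> box (1/2) 1" for s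
      using that d'[of s] unfolding Ig_def by (simp add: lax_form_scale joinpaths_def)
  qed
  have "(Ig has_integral I1 + I2) {0..1}"
    using has_integral_combine[of 0 "1/2" 1 Ig I1 I2] h1 h2 by simp
  then have "integral {0..1} Ig = I1 + I2" by (rule integral_unique)
  moreover have "lax_line_integral L lam q \<mu> k x t ?p = integral {0..1} Ig"
    by (simp only: lax_line_integral_def Ig_def[abs_def] lax_form_def Let_def)
  ultimately show ?thesis by (simp only: I1_def I2_def)
qed

text \<open>Polygons with one corner are admissible paths. The corner (x, t0) will lead to the
  t-part of the Lax pair, the corner (x0, t) to the x-part.\<close>

lemma eigenfunction_polyline:
  assumes "(x1, t1) \<in> rect L T" "(x, t) \<in> rect L T"
  shows "\<mu> x t k $ i $ j = mat 1 $ i $ j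
    + integral {0..1} (\<lambda>s. lax_form L lam q \<mu> k x t ((x1, t1) - (x0, t0)) (linepath (x0, t0) (x1, t1) s) $ i $ j)
    + integral {0..1} (\<lambda>s. lax_form L lam q \<mu> k x t ((x, t) - (x1, t1)) (linepath (x1, t1) (x, t) s) $ i $ j)"
proof -
  have b: "(x0, t0) \<in> rect L T" using base by (simp add: rect_def)
  have conv: "convex (rect L T)" unfolding rect_def by (intro convex_Times) auto
  let ?p = "linepath (x0, t0) (x1, t1) +++ linepath (x1, t1) (x, t)"
  have "path_image ?p \<subseteq> rect L T"
    using closed_segment_subset[OF b assms(1) conv] closed_segment_subset[OF assms conv] by (simp add: path_image_join)
  moreover have "valid_path ?p" by (intro valid_path_join valid_path_linepath) auto
  ultimately have e: "\<mu> x t k = mat 1 + lax_line_integral L lam q \<mu> k x t ?p"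
    using eig assms(2) unfolding eigenfunction_def by simp
  have bl: "bounded_linear (\<lambda>A :: complex^2^2. A $ i $ j)"
    using bounded_linear_compose[OF bounded_linear_vec_nth bounded_linear_vec_nth] .
  have comp: "integral {0..1} (\<lambda>s. lax_form L lam q \<mu> k x t (d - e) (linepath e d s)) $ i $ j
      = integral {0..1} (\<lambda>s. lax_form L lam q \<mu> k x t (d - e) (linepath e d s) $ i $ j)"
    if "e \<in> rect L T" "d \<in> rect L T" for d e
  proof -
    have "(\<lambda>s. lax_form L lam q \<mu> k x t (d - e) (linepath e d s)) integrable_on {0..1}"
    proof (rule integrable_continuous_interval, rule continuous_on_compose2[OF cont_lax_form])
      show "linepath e d ` {0..1} \<subseteq> rect L T"
        using closed_segment_subset[OF that conv] by (simp add: linepath_image_01)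
    qed (intro continuous_intros)
    from integral_linear[OF this bl] show ?thesis by (simp add: o_def)
  qed
  show ?thesis unfolding e lax_line_integral_polyline[OF b assms]
    using comp[OF b assms(1)] comp[OF assms] by simp
qed

text \<open>Second column of the time component \<open>Qtilde\<close> times mu; in the lower entry
  the factor \<open>lam\<close> is taken out.\<close>

definition "F1 k x s = - \<i> * lam * of_real ((cmod (q x s))\<^sup>2) * \<mu> x s k $ 1 $ 2 + (2 * k * q x s + \<i> * dx L q x s) * \<mu> x s k $ 2 $ 2"
definition "F2 k x s = (2 * k * cnj (q x s) - \<i> * cnj (dx L q x s)) * \<mu> x s k $ 1 $ 2 + \<i> * of_real ((cmod (q x s))\<^sup>2) * \<mu> x s k $ 2 $ 2"

lemma cont_vertical:
  assumes "x \<in> {0..L}"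
  shows "continuous_on {0..T} (F1 k x)" "continuous_on {0..T} (F2 k x)"
    "continuous_on {0..T} (\<lambda>s. \<mu> x s k $ i $ j)"
proof -
  have *: "continuous_on {0..T} (\<lambda>s. f (fst (x, s)) (snd (x, s)))" if "continuous_on (rect L T) (\<lambda>P. f (fst P) (snd P))"
    for f :: "real \<Rightarrow> real \<Rightarrow> complex"
    by (rule continuous_on_compose2[OF that]) (use assms in \<open>auto intro!: continuous_intros simp: rect_def\<close>)
  note c = *[OF cont_q'(1), simplified] *[OF cont_q'(2), simplified] *[OF cont_\<mu>, simplified]
  show "continuous_on {0..T} (F1 k x)" "continuous_on {0..T} (F2 k x)" "continuous_on {0..T} (\<lambda>s. \<mu> x s k $ i $ j)"
    unfolding F1_def F2_def by (intro continuous_intros c)+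
qed

lemma cont_horizontal:
  assumes "t \<in> {0..T}"
  shows "continuous_on {0..L} (\<lambda>x. \<mu> x t k $ i $ j)" "continuous_on {0..L} (\<lambda>x. q x t)"
proof -
  have *: "continuous_on {0..L} (\<lambda>x. f (fst (x, t)) (snd (x, t)))" if "continuous_on (rect L T) (\<lambda>P. f (fst P) (snd P))"
    for f :: "real \<Rightarrow> real \<Rightarrow> complex"
    by (rule continuous_on_compose2[OF that]) (use assms in \<open>auto intro!: continuous_intros simp: rect_def\<close>)
  show "continuous_on {0..L} (\<lambda>x. \<mu> x t k $ i $ j)" "continuous_on {0..L} (\<lambda>x. q x t)"
    using *[OF cont_\<mu>, simplified] *[OF cont_q'(1), simplified] .
qed

lemma vertical_integrals:
  assumes "x \<in> {0..L}" "t1 \<in> {0..T}" "t2 \<in> {0..T}"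
  shows "integral {0..1} (\<lambda>s. lax_form L lam q \<mu> k X t ((x, t2) - (x, t1)) (linepath (x, t1) (x, t2) s) $ 1 $ 2)
      = exp (2 * \<i> * k * of_real (x - X)) * exp (- 4 * \<i> * k\<^sup>2 * of_real t)
        * (integral {0..t2} (\<lambda>s. exp (4 * \<i> * k\<^sup>2 * of_real s) * F1 k x s) - integral {0..t1} (\<lambda>s. exp (4 * \<i> * k\<^sup>2 * of_real s) * F1 k x s))" (is ?A)
    and "integral {0..1} (\<lambda>s. lax_form L lam q \<mu> k X t ((x, t2) - (x, t1)) (linepath (x, t1) (x, t2) s) $ 2 $ 2)
      = lam * (integral {0..t2} (F2 k x) - integral {0..t1} (F2 k x))" (is ?B)
proof -
  have lp: "linepath (x, t1) (x, t2) s = (x, t1 + s * (t2 - t1))" for s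
    by (simp add: linepath_def algebra_simps)
  have c: "continuous_on {0..T} (\<lambda>s. exp (4 * \<i> * k\<^sup>2 * of_real s) * F1 k x s)"
    by (intro continuous_intros cont_vertical assms)
  have ph: "exp (2 * (\<i> * (k * of_real (x - X) + 2 * k\<^sup>2 * of_real (s - t))))
      = exp (2 * \<i> * k * of_real (x - X)) * exp (- 4 * \<i> * k\<^sup>2 * of_real t) * exp (4 * \<i> * k\<^sup>2 * of_real s)" for s
    unfolding exp_add[symmetric] by (simp add: algebra_simps)
  have "integral {0..1} (\<lambda>s. lax_form L lam q \<mu> k X t ((x, t2) - (x, t1)) (linepath (x, t1) (x, t2) s) $ 1 $ 2)
     = integral {0..1} (\<lambda>s. exp (2 * \<i> * k * of_real (x - X)) * exp (- 4 * \<i> * k\<^sup>2 * of_real t)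
          * (of_real (t2 - t1) * (exp (4 * \<i> * k\<^sup>2 * of_real (t1 + s * (t2 - t1))) * F1 k x (t1 + s * (t2 - t1)))))"
    unfolding lp lax_form_nth fst_conv snd_conv ph F1_def by (intro integral_cong) (simp add: mult_ac)
  then show ?A
    unfolding integral_mult_right segment_integral[OF c assms(2,3)] .
  have "integral {0..1} (\<lambda>s. lax_form L lam q \<mu> k X t ((x, t2) - (x, t1)) (linepath (x, t1) (x, t2) s) $ 2 $ 2)
     = integral {0..1} (\<lambda>s. lam * (of_real (t2 - t1) * F2 k x (t1 + s * (t2 - t1))))"
    unfolding lp lax_form_nth fst_conv snd_conv F2_def by (intro integral_cong) (simp add: mult_ac)
  then show ?B
    unfolding integral_mult_right segment_integral[OF cont_vertical(2)[OF assms(1)] assms(2,3)] .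
qed

lemma horizontal_integrals:
  assumes "t \<in> {0..T}" "x1 \<in> {0..L}" "x2 \<in> {0..L}"
  shows "integral {0..1} (\<lambda>s. lax_form L lam q \<mu> k X t ((x2, t) - (x1, t)) (linepath (x1, t) (x2, t) s) $ 1 $ 2)
      = exp (- 2 * \<i> * k * of_real X)
        * (integral {0..x2} (\<lambda>x. exp (2 * \<i> * k * of_real x) * (q x t * \<mu> x t k $ 2 $ 2))
          - integral {0..x1} (\<lambda>x. exp (2 * \<i> * k * of_real x) * (q x t * \<mu> x t k $ 2 $ 2)))" (is ?A)
    and "integral {0..1} (\<lambda>s. lax_form L lam q \<mu> k X t ((x2, t) - (x1, t)) (linepath (x1, t) (x2, t) s) $ 2 $ 2)
      = lam * (integral {0..x2} (\<lambda>x. cnj (q x t) * \<mu> x t k $ 1 $ 2) - integral {0..x1} (\<lambda>x. cnj (q x t) * \<mu> x t k $ 1 $ 2))" (is ?B)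
proof -
  have lp: "linepath (x1, t) (x2, t) s = (x1 + s * (x2 - x1), t)" for s
    by (simp add: linepath_def algebra_simps)
  have c: "continuous_on {0..L} (\<lambda>x. exp (2 * \<i> * k * of_real x) * (q x t * \<mu> x t k $ 2 $ 2))"
    "continuous_on {0..L} (\<lambda>x. cnj (q x t) * \<mu> x t k $ 1 $ 2)"
    by (intro continuous_intros cont_horizontal assms)+
  have ph: "exp (2 * (\<i> * (k * of_real (x - X) + 2 * k\<^sup>2 * of_real (t - t))))
      = exp (- 2 * \<i> * k * of_real X) * exp (2 * \<i> * k * of_real x)" for x
    unfolding exp_add[symmetric] by (simp add: algebra_simps)
  have "integral {0..1} (\<lambda>s. lax_form L lam q \<mu> k X t ((x2, t) - (x1, t)) (linepath (x1, t) (x2, t) s) $ 1 $ 2)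
     = integral {0..1} (\<lambda>s. exp (- 2 * \<i> * k * of_real X)
          * (of_real (x2 - x1) * (exp (2 * \<i> * k * of_real (x1 + s * (x2 - x1))) * (q (x1 + s * (x2 - x1)) t * \<mu> (x1 + s * (x2 - x1)) t k $ 2 $ 2))))"
    unfolding lp lax_form_nth fst_conv snd_conv ph by (intro integral_cong) (simp add: mult_ac)
  then show ?A
    unfolding integral_mult_right segment_integral[OF c(1) assms(2,3)] .
  have "integral {0..1} (\<lambda>s. lax_form L lam q \<mu> k X t ((x2, t) - (x1, t)) (linepath (x1, t) (x2, t) s) $ 2 $ 2)
     = integral {0..1} (\<lambda>s. lam * (of_real (x2 - x1) * (cnj (q (x1 + s * (x2 - x1)) t) * \<mu> (x1 + s * (x2 - x1)) t k $ 1 $ 2)))"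
    unfolding lp lax_form_nth fst_conv snd_conv ph by (intro integral_cong) (simp add: mult_ac)
  then show ?B
    unfolding integral_mult_right segment_integral[OF c(2) assms(2,3)] .
qed

text \<open>When \<open>q\<close> vanishes at time \<open>t0\<close>, the horizontal first leg of a path contributes nothing.\<close>

lemma eigenfunction_vertical:
  assumes "x \<in> {0..L}" "t \<in> {0..T}" and "x = x0 \<or> (\<forall>y\<in>{0..L}. q y t0 = 0)"
  shows "\<mu> x t k $ 1 $ 2 = exp (- 4 * \<i> * k\<^sup>2 * of_real t)
      * (integral {0..t} (\<lambda>s. exp (4 * \<i> * k\<^sup>2 * of_real s) * F1 k x s) - integral {0..t0} (\<lambda>s. exp (4 * \<i> * k\<^sup>2 * of_real s) * F1 k x s))" (is ?A)
    and "\<mu> x t k $ 2 $ 2 = 1 + lam * (integral {0..t} (F2 k x) - integral {0..t0} (F2 k x))" (is ?B)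
proof -
  have r: "(x, t0) \<in> rect L T" "(x, t) \<in> rect L T" using assms base by (auto simp: rect_def)
  have z: "integral {0..1} (\<lambda>s. lax_form L lam q \<mu> k x t ((x, t0) - (x0, t0)) (linepath (x0, t0) (x, t0) s) $ i $ 2) = 0"
    (is "integral _ ?f = 0") if "i = 1 \<or> i = 2" for i :: 2
  proof -
    have "?f s = 0" if s: "s \<in> {0..1}" for s
    proof (cases "x = x0")
      case True
      then show ?thesis using \<open>i = 1 \<or> i = 2\<close> by (auto simp: lax_form_nth)
    next
      case False
      have "x0 + s * (x - x0) = (1 - s) * x0 + s * x" by (simp add: algebra_simps)
      moreover have "(1 - s) * x0 + s * x \<le> (1 - s) * L + s * L" using s assms base by (intro add_mono mult_left_mono) auto
      moreover have "(1 - s) * L + s * L = L" by (simp add: algebra_simps)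
      moreover have "0 \<le> (1 - s) * x0 + s * x" using s assms base by simp
      ultimately have "x0 + s * (x - x0) \<in> {0..L}" by simp
      then have "q (x0 + s * (x - x0)) t0 = 0" using False assms(3) by blast
      moreover have "linepath (x0, t0) (x, t0) s = (x0 + s * (x - x0), t0)" by (simp add: linepath_def algebra_simps)
      ultimately show ?thesis using \<open>i = 1 \<or> i = 2\<close> by (auto simp: lax_form_nth)
    qed
    then have "integral {0..1} ?f = integral {0..1} (\<lambda>s::real. 0)" by (intro integral_cong) auto
    then show ?thesis by simp
  qed
  show ?A
    using eigenfunction_polyline[OF r, of k 1 2] z[of 1] vertical_integrals(1)[OF assms(1) base(2) assms(2), of k x t]
    by (simp add: mat_def)
  show ?B
    using eigenfunction_polyline[OF r, of k 2 2] z[of 2] vertical_integrals(2)[OF assms(1) base(2) assms(2), of k x t]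
    by (simp add: mat_def)
qed

text \<open>The path first runs along x = x0, where its contribution is the eigenfunction at (x0, t)
  itself, and then along the horizontal line at time t.\<close>

lemma eigenfunction_horizontal:
  assumes "x \<in> {0..L}" "t \<in> {0..T}"
  shows "\<mu> x t k $ 1 $ 2 = exp (- 2 * \<i> * k * of_real x) * (exp (2 * \<i> * k * of_real x0) * \<mu> x0 t k $ 1 $ 2
        + (integral {0..x} (\<lambda>x. exp (2 * \<i> * k * of_real x) * (q x t * \<mu> x t k $ 2 $ 2))
          - integral {0..x0} (\<lambda>x. exp (2 * \<i> * k * of_real x) * (q x t * \<mu> x t k $ 2 $ 2))))" (is ?A)
    and "\<mu> x t k $ 2 $ 2 = \<mu> x0 t k $ 2 $ 2
        + lam * (integral {0..x} (\<lambda>x. cnj (q x t) * \<mu> x t k $ 1 $ 2) - integral {0..x0} (\<lambda>x. cnj (q x t) * \<mu> x t k $ 1 $ 2))" (is ?B)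
proof -
  have r: "(x0, t) \<in> rect L T" "(x, t) \<in> rect L T" using assms base by (auto simp: rect_def)
  have e: "exp (2 * \<i> * k * of_real (x0 - x)) = exp (- 2 * \<i> * k * of_real x) * exp (2 * \<i> * k * of_real x0)"
    unfolding exp_add[symmetric] by (simp add: algebra_simps)
  note v = eigenfunction_vertical[OF base(1) assms(2), of k]
  have a: "integral {0..1} (\<lambda>s. lax_form L lam q \<mu> k x t ((x0, t) - (x0, t0)) (linepath (x0, t0) (x0, t) s) $ 1 $ 2)
      = exp (- 2 * \<i> * k * of_real x) * exp (2 * \<i> * k * of_real x0) * \<mu> x0 t k $ 1 $ 2"
    unfolding vertical_integrals(1)[OF base assms(2), of k x t] e v(1)[OF disjI1[OF refl]] by (simp only: mult.assoc)
  show ?A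
    unfolding eigenfunction_polyline[OF r, of k 1 2] a horizontal_integrals(1)[OF assms(2) base(1) assms(1), of k x]
    by (simp add: mat_def distrib_left mult.assoc)
  show ?B
    unfolding eigenfunction_polyline[OF r, of k 2 2] vertical_integrals(2)[OF base assms(2), of k x t]
      horizontal_integrals(2)[OF assms(2) base(1) assms(1), of k x] v(2)[OF disjI1[OF refl]]
    by (simp add: mat_def)
qed

text \<open>Obtained by differentiating \<open>eigenfunction_vertical\<close>. The second
  alternative for x lets an eigenfunction based at one end be followed in time at the other
  end.\<close>

lemma time_system:
  assumes x: "x \<in> {0..L}" "x = x0 \<or> (\<forall>y\<in>{0..L}. q y t0 = 0)"
  shows "t_part_system lam T (q x) (dx L q x) k (\<lambda>t. \<mu> x t k $ 1 $ 2) (\<lambda>t. \<mu> x t k $ 2 $ 2)"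
  unfolding t_part_system_def
proof (intro ballI conjI)
  fix t assume t: "t \<in> {0..T}"
  define W where "W t = integral {0..t} (\<lambda>s. exp (4 * \<i> * k\<^sup>2 * of_real s) * F1 k x s)" for t
  have c: "continuous_on {0..T} (\<lambda>s. exp (4 * \<i> * k\<^sup>2 * of_real s) * F1 k x s)"
    by (intro continuous_intros cont_vertical x)
  have W: "(W has_vector_derivative exp (4 * \<i> * k\<^sup>2 * of_real t) * F1 k x t) (at t within {0..T})"
    unfolding W_def by (rule integral_has_vector_derivative[OF c t])
  have e: "((\<lambda>t. exp (- 4 * \<i> * k\<^sup>2 * of_real t)) has_vector_derivative (- 4 * \<i> * k\<^sup>2) * exp (- 4 * \<i> * k\<^sup>2 * of_real t)) (at t within {0..T})"
    by (rule has_vector_derivative_real_field[THEN has_vector_derivative_at_within]) (auto intro!: derivative_eq_intros)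
  have ee: "exp (- 4 * \<i> * k\<^sup>2 * of_real t) * (exp (4 * \<i> * k\<^sup>2 * of_real t) * y) = y" for y
    by (simp add: mult.assoc[symmetric] exp_add[symmetric])
  have "((\<lambda>t. exp (- 4 * \<i> * k\<^sup>2 * of_real t) * (W t - W t0)) has_vector_derivative
     exp (- 4 * \<i> * k\<^sup>2 * of_real t) * (exp (4 * \<i> * k\<^sup>2 * of_real t) * F1 k x t - 0)
     + (- 4 * \<i> * k\<^sup>2) * exp (- 4 * \<i> * k\<^sup>2 * of_real t) * (W t - W t0)) (at t within {0..T})"
    by (intro has_vector_derivative_mult has_vector_derivative_diff e W has_vector_derivative_const)
  then have "((\<lambda>t. exp (- 4 * \<i> * k\<^sup>2 * of_real t) * (W t - W t0)) has_vector_derivative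
     F1 k x t + (- 4 * \<i> * k\<^sup>2) * \<mu> x t k $ 1 $ 2) (at t within {0..T})"
    unfolding diff_0_right ee eigenfunction_vertical(1)[OF x(1) t x(2)] W_def[symmetric] by (simp only: mult.assoc)
  then have "((\<lambda>t. \<mu> x t k $ 1 $ 2) has_vector_derivative F1 k x t + (- 4 * \<i> * k\<^sup>2) * \<mu> x t k $ 1 $ 2) (at t within {0..T})"
    by (rule has_vector_derivative_transform[OF t, rotated]) (use eigenfunction_vertical(1)[OF x(1) _ x(2)] in \<open>simp add: W_def\<close>)
  then show "((\<lambda>t. \<mu> x t k $ 1 $ 2) has_vector_derivative - 4 * \<i> * k\<^sup>2 * \<mu> x t k $ 1 $ 2
      - \<i> * lam * (q x t * cnj (q x t)) * \<mu> x t k $ 1 $ 2 + (2 * k * q x t + \<i> * dx L q x t) * \<mu> x t k $ 2 $ 2) (at t within {0..T})"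
    by (simp add: F1_def complex_norm_square[symmetric] algebra_simps)
  have "((\<lambda>t. 1 + lam * (integral {0..t} (F2 k x) - integral {0..t0} (F2 k x))) has_vector_derivative 0 + lam * (F2 k x t - 0)) (at t within {0..T})"
    by (intro has_vector_derivative_add has_vector_derivative_const has_vector_derivative_mult_right has_vector_derivative_diff
        integral_has_vector_derivative[OF cont_vertical(2)[OF x(1)] t])
  then have "((\<lambda>t. \<mu> x t k $ 2 $ 2) has_vector_derivative 0 + lam * (F2 k x t - 0)) (at t within {0..T})"
    by (rule has_vector_derivative_transform[OF t, rotated]) (use eigenfunction_vertical(2)[OF x(1) _ x(2)] in simp)
  then show "((\<lambda>t. \<mu> x t k $ 2 $ 2) has_vector_derivative lam * ((2 * k * cnj (q x t) - \<i> * cnj (dx L q x t)) * \<mu> x t k $ 1 $ 2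
        + \<i> * (q x t * cnj (q x t)) * \<mu> x t k $ 2 $ 2)) (at t within {0..T})"
    by (simp add: F2_def complex_norm_square[symmetric])
qed

lemma space_system:
  assumes t: "t \<in> {0..T}" and x: "x \<in> {0..L}"
  shows "((\<lambda>x. \<mu> x t k $ 1 $ 2) has_vector_derivative - 2 * \<i> * k * \<mu> x t k $ 1 $ 2 + q x t * \<mu> x t k $ 2 $ 2) (at x within {0..L})" (is ?A)
    and "((\<lambda>x. \<mu> x t k $ 2 $ 2) has_vector_derivative lam * (cnj (q x t) * \<mu> x t k $ 1 $ 2)) (at x within {0..L})" (is ?B)
proof -
  define W where "W x = integral {0..x} (\<lambda>x. exp (2 * \<i> * k * of_real x) * (q x t * \<mu> x t k $ 2 $ 2))" for x
  have c: "continuous_on {0..L} (\<lambda>x. exp (2 * \<i> * k * of_real x) * (q x t * \<mu> x t k $ 2 $ 2))"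
    "continuous_on {0..L} (\<lambda>x. cnj (q x t) * \<mu> x t k $ 1 $ 2)"
    by (intro continuous_intros cont_horizontal assms)+
  have W: "(W has_vector_derivative exp (2 * \<i> * k * of_real x) * (q x t * \<mu> x t k $ 2 $ 2)) (at x within {0..L})"
    unfolding W_def by (rule integral_has_vector_derivative[OF c(1) x])
  have e: "((\<lambda>x. exp (- 2 * \<i> * k * of_real x)) has_vector_derivative (- 2 * \<i> * k) * exp (- 2 * \<i> * k * of_real x)) (at x within {0..L})"
    by (rule has_vector_derivative_real_field[THEN has_vector_derivative_at_within]) (auto intro!: derivative_eq_intros)
  have ee: "exp (- 2 * \<i> * k * of_real x) * (exp (2 * \<i> * k * of_real x) * y) = y" for y
    by (simp add: mult.assoc[symmetric] exp_add[symmetric])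
  define c0 where "c0 = exp (2 * \<i> * k * of_real x0) * \<mu> x0 t k $ 1 $ 2"
  have "((\<lambda>x. exp (- 2 * \<i> * k * of_real x) * (c0 + (W x - W x0))) has_vector_derivative
     exp (- 2 * \<i> * k * of_real x) * (0 + (exp (2 * \<i> * k * of_real x) * (q x t * \<mu> x t k $ 2 $ 2) - 0))
     + (- 2 * \<i> * k) * exp (- 2 * \<i> * k * of_real x) * (c0 + (W x - W x0))) (at x within {0..L})"
    by (intro has_vector_derivative_mult has_vector_derivative_add has_vector_derivative_diff e W has_vector_derivative_const)
  then have "((\<lambda>x. exp (- 2 * \<i> * k * of_real x) * (c0 + (W x - W x0))) has_vector_derivative
     q x t * \<mu> x t k $ 2 $ 2 + (- 2 * \<i> * k) * \<mu> x t k $ 1 $ 2) (at x within {0..L})"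
    unfolding diff_0_right add_0_left ee eigenfunction_horizontal(1)[OF x t] W_def[symmetric] c0_def[symmetric] by (simp only: mult.assoc)
  then have "((\<lambda>x. \<mu> x t k $ 1 $ 2) has_vector_derivative q x t * \<mu> x t k $ 2 $ 2 + (- 2 * \<i> * k) * \<mu> x t k $ 1 $ 2) (at x within {0..L})"
    by (rule has_vector_derivative_transform[OF x, rotated]) (use eigenfunction_horizontal(1)[OF _ t] in \<open>simp add: W_def c0_def\<close>)
  then show ?A
    by (simp add: algebra_simps)
  have "((\<lambda>x. \<mu> x0 t k $ 2 $ 2 + lam * (integral {0..x} (\<lambda>x. cnj (q x t) * \<mu> x t k $ 1 $ 2) - integral {0..x0} (\<lambda>x. cnj (q x t) * \<mu> x t k $ 1 $ 2)))
      has_vector_derivative 0 + lam * (cnj (q x t) * \<mu> x t k $ 1 $ 2 - 0)) (at x within {0..L})"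
    by (intro has_vector_derivative_add has_vector_derivative_const has_vector_derivative_mult_right has_vector_derivative_diff
        integral_has_vector_derivative[OF c(2) x])
  then have "((\<lambda>x. \<mu> x t k $ 2 $ 2) has_vector_derivative 0 + lam * (cnj (q x t) * \<mu> x t k $ 1 $ 2 - 0)) (at x within {0..L})"
    by (rule has_vector_derivative_transform[OF x, rotated]) (use eigenfunction_horizontal(2)[OF _ t] in simp)
  then show ?B
    by simp
qed

end

section \<open>The unknown boundary values\<close>

lemma has_improper_integral_uminus:
  assumes "has_improper_integral \<gamma> f J"
  shows "has_improper_integral \<gamma> (\<lambda>k. - f k) (- J)"
proof -
  have "truncated_integral \<gamma> R (\<lambda>k. - f k) = - truncated_integral \<gamma> R f" for R
    unfolding truncated_integral_def by simp
  then show ?thesis using assms unfolding has_improper_integral_def by (simp add: tendsto_minus)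
qed

context boundary_spectral_data
begin

lemmas boundary_values_left = boundary_values[unfolded dirichlet_integrand_def[abs_def] neumann_integrand_def[abs_def]]

text \<open>The formulas for the left end, applied to the reflected data. Reflection changes h1 into
  -h1 and the Dirichlet integrand into its negative, whereas h0 and the Neumann integrand keep their
  signs.\<close>

lemma boundary_values_right:
  assumes "deformed_bdry_D3 L \<gamma>"
  shows "\<exists>J. has_improper_integral \<gamma> (\<lambda>k.
          - (Sigma_fun L k / (2 * Delta L k)) * (k * minus_part f1 k + \<i> * h0)
          + 1 / Delta L k * (k * minus_part F1 k + \<i> * g0)
          + h0 / (4 * \<i>) * minus_part F2 k
          + \<i> * h0 / 2 * minus_part f2 k
          + k / Delta L k * minus_part (\<lambda>l.
              (cnj (f2 (cnj l)) - 1) * F1 l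
              - f1 l * (cnj (F2 (cnj l)) - 1) * exp (2 * \<i> * l * of_real L)) k) J
        \<and> h1 = 4 / (of_real pi * \<i>) * J" (is "\<exists>J. has_improper_integral \<gamma> ?D J \<and> _")
    and "\<exists>J. has_improper_integral \<gamma> (\<lambda>k. 1 / Delta L k *
          (- (Sigma_fun L k / 2) * plus_part f1 k + plus_part F1 k
          + plus_part (\<lambda>l.
              (cnj (f2 (cnj l)) - 1) * F1 l
              - exp (2 * \<i> * l * of_real L) * (cnj (F2 (cnj l)) - 1) * f1 l) k)) J
        \<and> h0 = 2 / of_real pi * J" (is "\<exists>J. has_improper_integral \<gamma> ?N J \<and> _")
proof -
  interpret r: boundary_spectral_data L h0 "- h1" g0 "- g1" "- \<beta>" "- b" "\<lambda>k. - f1 (- k)" "\<lambda>k. f2 (- k)" "\<lambda>k. - F1 (- k)" "\<lambda>k. F2 (- k)"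
    by (rule reflected)
  have D: "?D k = - r.dirichlet_integrand k" for k
  proof -
    define m where "m = ((cnj (f2 (cnj k)) - 1) * F1 k - f1 k * (cnj (F2 (cnj k)) - 1) * exp (2 * \<i> * k * of_real L))
      - ((cnj (f2 (- cnj k)) - 1) * F1 (- k) - f1 (- k) * (cnj (F2 (- cnj k)) - 1) * exp (- (2 * \<i> * k * of_real L)))"
    have "minus_part (\<lambda>l. (cnj (f2 (cnj l)) - 1) * F1 l - f1 l * (cnj (F2 (cnj l)) - 1) * exp (2 * \<i> * l * of_real L)) k = m"
      by (simp add: minus_part_def m_def)
    moreover have "minus_part (\<lambda>l. (cnj (F2 (- cnj l)) - 1) * - f1 (- l) * exp (- (2 * \<i> * l * of_real L)) - - F1 (- l) * (cnj (f2 (- cnj l)) - 1)) k = - m"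
      by (simp add: minus_part_def m_def algebra_simps)
    moreover have "minus_part (\<lambda>k. - f1 (- k)) k = minus_part f1 k" "minus_part (\<lambda>k. - F1 (- k)) k = minus_part F1 k"
      "minus_part (\<lambda>k. f2 (- k)) k = - minus_part f2 k" "minus_part (\<lambda>k. F2 (- k)) k = - minus_part F2 k"
      by (simp_all add: minus_part_def)
    ultimately show ?thesis unfolding r.dirichlet_integrand_def by simp
  qed
  obtain J where J: "has_improper_integral \<gamma> r.dirichlet_integrand J" "- h1 = 4 / (of_real pi * \<i>) * J"
    using r.boundary_values(1)[OF assms] by blast
  have "has_improper_integral \<gamma> ?D (- J)" unfolding D by (rule has_improper_integral_uminus[OF J(1)])
  moreover have "h1 = 4 / (of_real pi * \<i>) * (- J)" using J(2) by (metis minus_minus mult_minus_right)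
  ultimately show "\<exists>J. has_improper_integral \<gamma> ?D J \<and> h1 = 4 / (of_real pi * \<i>) * J" by blast
  have N: "?N k = r.neumann_integrand k" for k
  proof -
    define m where "m = ((cnj (f2 (cnj k)) - 1) * F1 k - exp (2 * \<i> * k * of_real L) * (cnj (F2 (cnj k)) - 1) * f1 k)
      + ((cnj (f2 (- cnj k)) - 1) * F1 (- k) - exp (- (2 * \<i> * k * of_real L)) * (cnj (F2 (- cnj k)) - 1) * f1 (- k))"
    have "plus_part (\<lambda>l. (cnj (f2 (cnj l)) - 1) * F1 l - exp (2 * \<i> * l * of_real L) * (cnj (F2 (cnj l)) - 1) * f1 l) k = m"
      by (simp add: plus_part_def m_def)
    moreover have "plus_part (\<lambda>l. - f1 (- l) * (cnj (F2 (- cnj l)) - 1) * exp (- (2 * \<i> * l * of_real L)) - (cnj (f2 (- cnj l)) - 1) * - F1 (- l)) k = m"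
      by (simp add: plus_part_def m_def algebra_simps)
    moreover have "plus_part (\<lambda>k. - f1 (- k)) k = - plus_part f1 k" "plus_part (\<lambda>k. - F1 (- k)) k = - plus_part F1 k"
      by (simp_all add: plus_part_def)
    ultimately show ?thesis unfolding r.neumann_integrand_def by simp
  qed
  show "\<exists>J. has_improper_integral \<gamma> ?N J \<and> h0 = 2 / of_real pi * J"
    unfolding N using r.boundary_values(2)[OF assms] by simp
qed

end

section \<open>Volterra form, terminal values and uniqueness of the second columns\<close>

context lax_data
begin

lemma eigenfunction_volterra:
  assumes "t0 = 0" "t \<in> {0..T}"
  shows "\<mu> x0 t k $ 1 $ 2 = integral {0..t} (\<lambda>s. exp (4 * \<i> * k\<^sup>2 * of_real (s - t)) *
          (- \<i> * lam * of_real ((cmod (q x0 s))\<^sup>2) * \<mu> x0 s k $ 1 $ 2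
           + (2 * k * q x0 s + \<i> * dx L q x0 s) * \<mu> x0 s k $ 2 $ 2))" (is ?A)
    and "\<mu> x0 t k $ 2 $ 2 = 1 + lam * integral {0..t} (\<lambda>s.
          (2 * k * cnj (q x0 s) - \<i> * cnj (dx L q x0 s)) * \<mu> x0 s k $ 1 $ 2
           + \<i> * of_real ((cmod (q x0 s))\<^sup>2) * \<mu> x0 s k $ 2 $ 2)" (is ?B)
proof -
  have "\<mu> x0 t k $ 1 $ 2 = exp (- 4 * \<i> * k\<^sup>2 * of_real t) * integral {0..t} (\<lambda>s. exp (4 * \<i> * k\<^sup>2 * of_real s) * F1 k x0 s)"
    using eigenfunction_vertical(1)[OF base(1) assms(2), of k] assms(1) by simp
  also have "\<dots> = integral {0..t} (\<lambda>s. exp (4 * \<i> * k\<^sup>2 * of_real (s - t)) * F1 k x0 s)"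
    unfolding integral_mult_right[symmetric]
  proof (rule integral_cong)
    fix s
    have "exp (4 * \<i> * k\<^sup>2 * of_real (s - t)) = exp (- 4 * \<i> * k\<^sup>2 * of_real t) * exp (4 * \<i> * k\<^sup>2 * of_real s)"
      unfolding exp_add[symmetric] by (simp add: algebra_simps)
    then show "exp (- 4 * \<i> * k\<^sup>2 * of_real t) * (exp (4 * \<i> * k\<^sup>2 * of_real s) * F1 k x0 s) = exp (4 * \<i> * k\<^sup>2 * of_real (s - t)) * F1 k x0 s"
      by simp
  qed
  finally show ?A
    unfolding F1_def .
  show ?B
    using eigenfunction_vertical(2)[OF base(1) assms(2), of k] assms(1) unfolding F2_def[abs_def] by simp
qed

lemma eigenfunction_initial:
  assumes "x \<in> {0..L}" "x = x0 \<or> (\<forall>y\<in>{0..L}. q y t0 = 0)"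
  shows "\<mu> x t0 k $ 1 $ 2 = 0" "\<mu> x t0 k $ 2 $ 2 = 1"
  using eigenfunction_vertical[OF assms(1) base(2) assms(2), of k] by simp_all

end

text \<open>Between times 0 and T the starred Wronskian yields f2 0 and the plain one f1 0, since
  each pairing involves one known value at either end. The factor exp (4ik^2 T) is the weight of the
  plain Wronskian.\<close>

lemma terminal_solution:
  assumes f: "t_part_system lam T g0 g1 k f1 f2" "f1 T = 0" "f2 T = 1"
    and h: "\<And>k. t_part_system lam T g0 g1 k (h1 k) (h2 k)" "\<And>k. h1 k 0 = 0" "\<And>k. h2 k 0 = 1"
    and lam: "cnj lam = lam" and T: "0 \<le> T"
  shows "f2 0 = cnj (h2 (cnj k) T)" "f1 0 = - h1 k T * exp (4 * \<i> * k\<^sup>2 * of_real T)"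
  using wronskian_star_constant[OF f(1) h(1) lam, of 0 T] wronskian_constant[OF f(1) h(1), of 0 T] f h T by simp_all

text \<open>The Wronskian makes the two solutions proportional; the starred pairings of both with h
  equal 1, which fixes the factor.\<close>

lemma t_part_system_unique:
  assumes f: "t_part_system lam T g0 g1 k f1 f2" "f1 0 = 0" "f2 0 = 1"
    and h: "\<And>k. t_part_system lam T g0 g1 k (h1 k) (h2 k)" "\<And>k. h1 k 0 = 0" "\<And>k. h2 k 0 = 1"
    and lam: "cnj lam = lam" and t: "t \<in> {0..T}"
  shows "f1 t = h1 k t" "f2 t = h2 k t"
proof -
  have 0: "0 \<in> {0..T}" using t by auto
  have a: "f1 t * h2 k t = f2 t * h1 k t"
    using wronskian_constant[OF f(1) h(1) 0 t] f h by simp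
  have b: "f2 t * cnj (h2 (cnj k) t) - lam * f1 t * cnj (h1 (cnj k) t) = 1"
    using wronskian_star_constant[OF f(1) h(1) lam 0 t] f h by simp
  have c: "h2 k t * cnj (h2 (cnj k) t) - lam * h1 k t * cnj (h1 (cnj k) t) = 1"
    using wronskian_star_constant[OF h(1) h(1) lam 0 t] h by simp
  show "f1 t = h1 k t" using a b c by algebra
  show "f2 t = h2 k t" using a b c by algebra
qed

lemma column2_nth:
  fixes A :: "complex^2^2"
  assumes "column 2 A = vector [a, b]"
  shows "A $ 1 $ 2 = a" "A $ 2 $ 2 = b"
proof -
  have "column 2 A $ 1 = a" "column 2 A $ 2 = b" unfolding assms by simp_all
  then show "A $ 1 $ 2 = a" "A $ 2 $ 2 = b" by (simp_all add: column_def)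
qed

text \<open>mu_2 solves the t-part along both ends and the x-part between them, so it links the two
  boundaries at time t; by uniqueness its second column at x = L may be replaced by that of
  mu_3.\<close>

lemma boundary_spectral_data_of_eigenfunctions:
  fixes q :: "real \<Rightarrow> real \<Rightarrow> complex"
  assumes LT: "0 < L" "0 < T" and lam: "cnj lam = lam" "cmod lam = 1"
    and smooth: "sufficiently_smooth L T q" and q0: "\<And>x. x \<in> {0..L} \<Longrightarrow> q x 0 = 0"
    and m2: "lax_data L T lam q \<mu>2 0 0" and m3: "lax_data L T lam q \<mu>3 L 0"
    and t: "t \<in> {0..T}"
  obtains b \<beta> where "boundary_spectral_data L (q 0 t) (dx L q 0 t) (q L t) (dx L q L t) b \<beta>
    (\<lambda>k. \<mu>2 0 t k $ 1 $ 2) (\<lambda>k. \<mu>2 0 t k $ 2 $ 2) (\<lambda>k. \<mu>3 L t k $ 1 $ 2) (\<lambda>k. \<mu>3 L t k $ 2 $ 2)"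
proof -
  interpret m2: lax_data L T lam q \<mu>2 0 0 by (rule m2)
  interpret m3: lax_data L T lam q \<mu>3 L 0 by (rule m3)
  have six: "6 = Suc (Suc (Suc (Suc (Suc (Suc 0)))))" by simp
  have q6: "C_on_rect (Suc (Suc (Suc (Suc (Suc (Suc 0)))))) L T q"
    using smooth unfolding sufficiently_smooth_def six .
  then have qx5: "C_on_rect (Suc (Suc (Suc (Suc (Suc 0))))) L T (dx L q)"
    unfolding C_on_rect.simps(2)[of "Suc (Suc (Suc (Suc (Suc 0))))"] by blast
  \<comment> \<open>Differentiating the zero datum along t = 0 gives vanishing Neumann values at
    time 0, which the large-k asymptotics requires.\<close>
  have dx0: "dx L q x 0 = 0" if "x \<in> {0..L}" for x
  proof -
    have "((\<lambda>y. q y 0) has_vector_derivative 0) (at x within {0..L})"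
      by (rule has_vector_derivative_transform[OF that _ has_vector_derivative_const]) (use q0 in simp)
    then show ?thesis unfolding dx_def using vector_derivative_within_closed_interval[OF LT(1) that] by blast
  qed
  have xs: "0 \<in> {0..L}" "L \<in> {0..L}" using LT by auto
  have T0: "0 \<in> {0..T}" using LT by auto
  \<comment> \<open>The integrand is lam i Im (cnj q q_x), so \<open>bb\<close> is purely imaginary
    for real lam.\<close>
  define bb where "bb x = integral {0..t} (\<lambda>s. lam * (cnj (q x s) * dx L q x s - q x s * cnj (dx L q x s)) / 2)" for x
  have bb: "cnj (bb x) = - bb x" for x
    unfolding bb_def integral_cnj integral_neg[symmetric] by (rule integral_cong) (simp add: lam algebra_simps diff_divide_distrib)
  have asy: "strip_bound K 3 (\<lambda>k. f1 k t - (q x t / (2 * \<i>) / k + (dx L q x t / 4 + q x t * bb x / (2 * \<i>)) / k\<^sup>2))"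
    "strip_bound K 2 (\<lambda>k. f2 k t - (1 + bb x / k))"
    if x: "x \<in> {0..L}" and sys: "\<And>k. t_part_system lam T (q x) (dx L q x) k (f1 k) (f2 k)" and init: "\<And>k. f1 k 0 = 0" "\<And>k. f2 k 0 = 1"
    for x f1 f2 and K :: real
    using t_part_asymptotics[OF lam(2) C_on_rect_time_derivative(1)[OF LT q6 x] C_on_rect_time_derivative(1)[OF LT qx5 x]
        C_on_rect_time_derivative(2)[OF LT q6 x] C_on_rect_time_derivative(2)[OF LT qx5 x] q0[OF x] dx0[OF x] sys init t, of K]
    unfolding bb_def by blast+
  have s2: "t_part_system lam T (q 0) (dx L q 0) k (\<lambda>t. \<mu>2 0 t k $ 1 $ 2) (\<lambda>t. \<mu>2 0 t k $ 2 $ 2)" for k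
    by (rule m2.time_system) (use LT in auto)
  have s2L: "t_part_system lam T (q L) (dx L q L) k (\<lambda>t. \<mu>2 L t k $ 1 $ 2) (\<lambda>t. \<mu>2 L t k $ 2 $ 2)" for k
    by (rule m2.time_system) (use LT q0 in auto)
  have s3: "t_part_system lam T (q L) (dx L q L) k (\<lambda>t. \<mu>3 L t k $ 1 $ 2) (\<lambda>t. \<mu>3 L t k $ 2 $ 2)" for k
    by (rule m3.time_system) (use LT in auto)
  have i2: "\<mu>2 x 0 k $ 1 $ 2 = 0" "\<mu>2 x 0 k $ 2 $ 2 = 1" if "x \<in> {0..L}" for x k
    using m2.eigenfunction_initial[OF that] q0 by auto
  have i3: "\<mu>3 L 0 k $ 1 $ 2 = 0" "\<mu>3 L 0 k $ 2 $ 2 = 1" for k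
    using m3.eigenfunction_initial[OF xs(2)] by auto
  have end_eq: "\<mu>2 L t k $ 1 $ 2 = \<mu>3 L t k $ 1 $ 2" "\<mu>2 L t k $ 2 $ 2 = \<mu>3 L t k $ 2 $ 2" for k
    using t_part_system_unique[OF s2L[of k] i2[OF xs(2)] s3 i3 lam(1) t] by blast+
  have cq: "continuous_on {0..T} (q x)" "continuous_on {0..T} (dx L q x)" if "x \<in> {0..L}" for x
    by (rule has_vector_derivative_imp_continuous_on[OF C_on_rect_time_derivative(1)[OF LT q6 that]], assumption)
       (rule has_vector_derivative_imp_continuous_on[OF C_on_rect_time_derivative(1)[OF LT qx5 that]], assumption)
  have "boundary_spectral_data L (q 0 t) (dx L q 0 t) (q L t) (dx L q L t) (bb 0) (bb L)
    (\<lambda>k. \<mu>2 0 t k $ 1 $ 2) (\<lambda>k. \<mu>2 0 t k $ 2 $ 2) (\<lambda>k. \<mu>3 L t k $ 1 $ 2) (\<lambda>k. \<mu>3 L t k $ 2 $ 2)"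
  proof
    show "0 < L" by (rule LT)
    show "(\<lambda>k. \<mu>2 0 t k $ 1 $ 2) holomorphic_on UNIV" "(\<lambda>k. \<mu>2 0 t k $ 2 $ 2) holomorphic_on UNIV"
      using t_part_system_entire[OF cq[OF xs(1)] lam(2) s2 i2[OF xs(1)] t] by auto
    show "(\<lambda>k. \<mu>3 L t k $ 1 $ 2) holomorphic_on UNIV" "(\<lambda>k. \<mu>3 L t k $ 2 $ 2) holomorphic_on UNIV"
      using t_part_system_entire[OF cq[OF xs(2)] lam(2) s3 i3 t] by auto
    show "cnj (bb 0) = - bb 0" "cnj (bb L) = - bb L" by (rule bb)+
    show "strip_bound K 3 (\<lambda>k. \<mu>2 0 t k $ 1 $ 2 - (q 0 t / (2 * \<i>) / k + (dx L q 0 t / 4 + q 0 t * bb 0 / (2 * \<i>)) / k\<^sup>2))"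
      "strip_bound K 2 (\<lambda>k. \<mu>2 0 t k $ 2 $ 2 - (1 + bb 0 / k))" for K
      by (rule asy[OF xs(1) s2 i2[OF xs(1)]])+
    show "strip_bound K 3 (\<lambda>k. \<mu>3 L t k $ 1 $ 2 - (q L t / (2 * \<i>) / k + (dx L q L t / 4 + q L t * bb L / (2 * \<i>)) / k\<^sup>2))"
      "strip_bound K 2 (\<lambda>k. \<mu>3 L t k $ 2 $ 2 - (1 + bb L / k))" for K
      by (rule asy[OF xs(2) s3 i3])+
    have "exp_type (\<lambda>k. \<mu>2 0 t k $ 1 $ 2 * cnj (\<mu>2 L t (cnj k) $ 2 $ 2) - cnj (\<mu>2 0 t (cnj k) $ 2 $ 2) * \<mu>2 L t k $ 1 $ 2 * exp (2 * \<i> * k * of_real L))"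
    proof (rule space_connection_exp_type[where q = "\<lambda>x. q x t" and ?M1.0 = "\<lambda>x k. \<mu>2 x t k $ 1 $ 2" and ?M2.0 = "\<lambda>x k. \<mu>2 x t k $ 2 $ 2"])
      \<comment> \<open>The determinant is constant in time along x = L and equals 1 at time
        0.\<close>
      show "\<mu>2 L t k $ 2 $ 2 * cnj (\<mu>2 L t (cnj k) $ 2 $ 2) - lam * \<mu>2 L t k $ 1 $ 2 * cnj (\<mu>2 L t (cnj k) $ 1 $ 2) = 1" for k
        using wronskian_star_constant[OF s2L[of k] s2L[of "cnj k"] lam(1) T0 t] i2[OF xs(2)] by simp
      show "((\<lambda>x. \<mu>2 x t k $ 1 $ 2) has_vector_derivative - 2 * \<i> * k * \<mu>2 x t k $ 1 $ 2 + q x t * \<mu>2 x t k $ 2 $ 2) (at x within {0..L})"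
        "((\<lambda>x. \<mu>2 x t k $ 2 $ 2) has_vector_derivative lam * (cnj (q x t) * \<mu>2 x t k $ 1 $ 2)) (at x within {0..L})"
        if "x \<in> {0..L}" for k x
        using m2.space_system[OF t that] by auto
    qed (use LT lam m2.cont_horizontal(2)[OF t] in auto)
    then show "exp_type (\<lambda>k. \<mu>2 0 t k $ 1 $ 2 * star (\<lambda>k. \<mu>3 L t k $ 2 $ 2) k - star (\<lambda>k. \<mu>2 0 t k $ 2 $ 2) k * \<mu>3 L t k $ 1 $ 2 * exp (2 * \<i> * k * of_real L))"
      unfolding star_def end_eq .
  qed
  then show ?thesis by (rule that)
qed

theorem theorem3p1:
  fixes L T :: real and lam :: complex
    and q :: "real \<Rightarrow> real \<Rightarrow> complex"
    and g0 h0 g1 h1 :: "real \<Rightarrow> complex"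
    and \<mu>1 \<mu>2 \<mu>3 \<mu>4 :: "real \<Rightarrow> real \<Rightarrow> complex \<Rightarrow> complex^2^2"
    and A B \<A> \<B> :: "complex \<Rightarrow> complex"
    and \<Phi>1 \<Phi>2 \<phi>1 \<phi>2 :: "real \<Rightarrow> complex \<Rightarrow> complex"
    and \<gamma> :: "real \<Rightarrow> complex"
  assumes "0 < T" and "0 < L" and "lam \<in> {1, -1}"
    and "sufficiently_smooth L T q"
    and "nls_solution L T lam q"
    and "\<And>x. x \<in> {0..L} \<Longrightarrow> q x 0 = 0"
    and "\<And>t. t \<in> {0..T} \<Longrightarrow> g0 t = q 0 t"
    and "\<And>t. t \<in> {0..T} \<Longrightarrow> h0 t = q L t"
    and "\<And>t. t \<in> {0..T} \<Longrightarrow> g1 t = dx L q 0 t"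
    and "\<And>t. t \<in> {0..T} \<Longrightarrow> h1 t = dx L q L t"
    and "eigenfunction L T lam q 0 T \<mu>1"
    and "eigenfunction L T lam q 0 0 \<mu>2"
    and "eigenfunction L T lam q L 0 \<mu>3"
    and "eigenfunction L T lam q L T \<mu>4"
    and "\<And>k. \<mu>1 0 0 k = mat2 (cnj (A (cnj k))) (B k) (lam * cnj (B (cnj k))) (A k)"
    and "\<And>k. \<mu>4 L 0 k = mat2 (cnj (\<A> (cnj k))) (\<B> k) (lam * cnj (\<B> (cnj k))) (\<A> k)"
    and "\<And>t k. t \<in> {0..T} \<Longrightarrow> column 2 (\<mu>2 0 t k) = vector [\<Phi>1 t k, \<Phi>2 t k]"
    and "\<And>t k. t \<in> {0..T} \<Longrightarrow> column 2 (\<mu>3 L t k) = vector [\<phi>1 t k, \<phi>2 t k]"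
    and "deformed_bdry_D3 L \<gamma>"
  shows
    "(\<forall>k. A k = cnj (\<Phi>2 T (cnj k)) \<and>
         B k = - \<Phi>1 T k * exp (4 * \<i> * k\<^sup>2 * of_real T) \<and>
         \<A> k = cnj (\<phi>2 T (cnj k)) \<and>
         \<B> k = - \<phi>1 T k * exp (4 * \<i> * k\<^sup>2 * of_real T)) \<and>
     (\<forall>t k. 0 < t \<and> t < T \<longrightarrow>
      \<Phi>1 t k = integral {0..t} (\<lambda>t'. exp (4 * \<i> * k\<^sup>2 * of_real (t' - t)) *
          (- \<i> * lam * of_real ((cmod (g0 t'))\<^sup>2) * \<Phi>1 t' k
           + (2 * k * g0 t' + \<i> * g1 t') * \<Phi>2 t' k)) \<and>
      \<Phi>2 t k = 1 + lam * integral {0..t} (\<lambda>t'.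
          (2 * k * cnj (g0 t') - \<i> * cnj (g1 t')) * \<Phi>1 t' k
           + \<i> * of_real ((cmod (g0 t'))\<^sup>2) * \<Phi>2 t' k) \<and>
      \<phi>1 t k = integral {0..t} (\<lambda>t'. exp (4 * \<i> * k\<^sup>2 * of_real (t' - t)) *
          (- \<i> * lam * of_real ((cmod (h0 t'))\<^sup>2) * \<phi>1 t' k
           + (2 * k * h0 t' + \<i> * h1 t') * \<phi>2 t' k)) \<and>
      \<phi>2 t k = 1 + lam * integral {0..t} (\<lambda>t'.
          (2 * k * cnj (h0 t') - \<i> * cnj (h1 t')) * \<phi>1 t' k
           + \<i> * of_real ((cmod (h0 t'))\<^sup>2) * \<phi>2 t' k)) \<and>
     \<comment> \<open>Dirichlet problem\<close>
     (\<forall>t. 0 < t \<and> t < T \<longrightarrow>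
      (\<exists>J. has_improper_integral \<gamma> (\<lambda>k.
          Sigma_fun L k / (2 * Delta L k) * (k * minus_part (\<Phi>1 t) k + \<i> * g0 t)
          - 1 / Delta L k * (k * minus_part (\<phi>1 t) k + \<i> * h0 t)
          + g0 t / (4 * \<i>) * minus_part (\<phi>2 t) k
          + \<i> * g0 t / 2 * minus_part (\<Phi>2 t) k
          + k / Delta L k * minus_part (\<lambda>l.
              (cnj (\<phi>2 t (cnj l)) - 1) * \<Phi>1 t l * exp (- (2 * \<i> * l * of_real L))
              - \<phi>1 t l * (cnj (\<Phi>2 t (cnj l)) - 1)) k) J
        \<and> g1 t = 4 / (of_real pi * \<i>) * J) \<and>
      (\<exists>J. has_improper_integral \<gamma> (\<lambda>k.
          - (Sigma_fun L k / (2 * Delta L k)) * (k * minus_part (\<phi>1 t) k + \<i> * h0 t)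
          + 1 / Delta L k * (k * minus_part (\<Phi>1 t) k + \<i> * g0 t)
          + h0 t / (4 * \<i>) * minus_part (\<Phi>2 t) k
          + \<i> * h0 t / 2 * minus_part (\<phi>2 t) k
          + k / Delta L k * minus_part (\<lambda>l.
              (cnj (\<phi>2 t (cnj l)) - 1) * \<Phi>1 t l
              - \<phi>1 t l * (cnj (\<Phi>2 t (cnj l)) - 1) * exp (2 * \<i> * l * of_real L)) k) J
        \<and> h1 t = 4 / (of_real pi * \<i>) * J)) \<and>
     \<comment> \<open>Neumann problem\<close>
     (\<forall>t. 0 < t \<and> t < T \<longrightarrow>
      (\<exists>J. has_improper_integral \<gamma> (\<lambda>k. 1 / Delta L k *
          (Sigma_fun L k / 2 * plus_part (\<Phi>1 t) k - plus_part (\<phi>1 t) k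
          + plus_part (\<lambda>l.
              \<Phi>1 t l * (cnj (\<phi>2 t (cnj l)) - 1) * exp (- (2 * \<i> * l * of_real L))
              - (cnj (\<Phi>2 t (cnj l)) - 1) * \<phi>1 t l) k)) J
        \<and> g0 t = 2 / of_real pi * J) \<and>
      (\<exists>J. has_improper_integral \<gamma> (\<lambda>k. 1 / Delta L k *
          (- (Sigma_fun L k / 2) * plus_part (\<phi>1 t) k + plus_part (\<Phi>1 t) k
          + plus_part (\<lambda>l.
              (cnj (\<phi>2 t (cnj l)) - 1) * \<Phi>1 t l
              - exp (2 * \<i> * l * of_real L) * (cnj (\<Phi>2 t (cnj l)) - 1) * \<phi>1 t l) k)) J
        \<and> h0 t = 2 / of_real pi * J))"
proof -
  have lam: "cnj lam = lam" "cmod lam = 1" using assms(3) by auto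
  have six: "6 = Suc (Suc (Suc (Suc (Suc (Suc 0)))))" by simp
  have q6: "C_on_rect (Suc (Suc (Suc (Suc (Suc (Suc 0)))))) L T q"
    using assms(4) unfolding sufficiently_smooth_def six .
  then have qx5: "C_on_rect (Suc (Suc (Suc (Suc (Suc 0))))) L T (dx L q)"
    unfolding C_on_rect.simps(2)[of "Suc (Suc (Suc (Suc (Suc 0))))"] by blast
  note cont = C_on_rect_continuous[OF assms(2,1) q6] C_on_rect_continuous[OF assms(2,1) qx5]
  interpret m1: lax_data L T lam q \<mu>1 0 T
    by unfold_locales (use assms(1,2,11) cont in auto)
  interpret m2: lax_data L T lam q \<mu>2 0 0
    by unfold_locales (use assms(1,2,12) cont in auto)
  interpret m3: lax_data L T lam q \<mu>3 L 0
    by unfold_locales (use assms(1,2,13) cont in auto)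
  interpret m4: lax_data L T lam q \<mu>4 L T
    by unfold_locales (use assms(1,2,14) cont in auto)
  have \<Phi>: "\<mu>2 0 t k $ 1 $ 2 = \<Phi>1 t k" "\<mu>2 0 t k $ 2 $ 2 = \<Phi>2 t k" if "t \<in> {0..T}" for t k
    using column2_nth[OF assms(17)[OF that]] by auto
  have \<phi>: "\<mu>3 L t k $ 1 $ 2 = \<phi>1 t k" "\<mu>3 L t k $ 2 $ 2 = \<phi>2 t k" if "t \<in> {0..T}" for t k
    using column2_nth[OF assms(18)[OF that]] by auto
  have xs: "0 \<in> {0..L}" "L \<in> {0..L}" and ts: "T \<in> {0..T}" using assms(1,2) by auto
  have sys: "t_part_system lam T (q 0) (dx L q 0) k (\<lambda>t. \<mu>1 0 t k $ 1 $ 2) (\<lambda>t. \<mu>1 0 t k $ 2 $ 2)"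
    "t_part_system lam T (q 0) (dx L q 0) k (\<lambda>t. \<mu>2 0 t k $ 1 $ 2) (\<lambda>t. \<mu>2 0 t k $ 2 $ 2)"
    "t_part_system lam T (q L) (dx L q L) k (\<lambda>t. \<mu>3 L t k $ 1 $ 2) (\<lambda>t. \<mu>3 L t k $ 2 $ 2)"
    "t_part_system lam T (q L) (dx L q L) k (\<lambda>t. \<mu>4 L t k $ 1 $ 2) (\<lambda>t. \<mu>4 L t k $ 2 $ 2)" for k
    using m1.time_system[OF xs(1)] m2.time_system[OF xs(1)] m3.time_system[OF xs(2)] m4.time_system[OF xs(2)] by auto
  have init: "\<mu>1 0 T k $ 1 $ 2 = 0" "\<mu>1 0 T k $ 2 $ 2 = 1" "\<mu>2 0 0 k $ 1 $ 2 = 0" "\<mu>2 0 0 k $ 2 $ 2 = 1"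
    "\<mu>3 L 0 k $ 1 $ 2 = 0" "\<mu>3 L 0 k $ 2 $ 2 = 1" "\<mu>4 L T k $ 1 $ 2 = 0" "\<mu>4 L T k $ 2 $ 2 = 1" for k
    using m1.eigenfunction_initial[OF xs(1)] m2.eigenfunction_initial[OF xs(1)]
      m3.eigenfunction_initial[OF xs(2)] m4.eigenfunction_initial[OF xs(2)] by auto
  have mat: "(mat2 a b c d :: complex^2^2) $ 1 $ 2 = b" "(mat2 a b c d :: complex^2^2) $ 2 $ 2 = d" for a b c d by (simp_all add: mat2_def)
  have T0: "0 \<le> T" using assms(1) by simp
  \<comment> \<open>Both corner matrices are solutions normalised at time T and read off at time 0,
    along x = 0 for mu_1 and along x = L for mu_4.\<close>
  have spectral: "A k = cnj (\<Phi>2 T (cnj k)) \<and> B k = - \<Phi>1 T k * exp (4 * \<i> * k\<^sup>2 * of_real T) \<and>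
         \<A> k = cnj (\<phi>2 T (cnj k)) \<and> \<B> k = - \<phi>1 T k * exp (4 * \<i> * k\<^sup>2 * of_real T)" for k
    using terminal_solution[OF sys(1)[of k] init(1,2) sys(2) init(3,4) lam(1) T0]
      terminal_solution[OF sys(4)[of k] init(7,8) sys(3) init(5,6) lam(1) T0]
    unfolding assms(15,16) mat \<Phi>[OF ts] \<phi>[OF ts] by simp
  have volterra: "\<Phi>1 t k = integral {0..t} (\<lambda>t'. exp (4 * \<i> * k\<^sup>2 * of_real (t' - t)) *
          (- \<i> * lam * of_real ((cmod (g0 t'))\<^sup>2) * \<Phi>1 t' k
           + (2 * k * g0 t' + \<i> * g1 t') * \<Phi>2 t' k)) \<and>
      \<Phi>2 t k = 1 + lam * integral {0..t} (\<lambda>t'.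
          (2 * k * cnj (g0 t') - \<i> * cnj (g1 t')) * \<Phi>1 t' k
           + \<i> * of_real ((cmod (g0 t'))\<^sup>2) * \<Phi>2 t' k) \<and>
      \<phi>1 t k = integral {0..t} (\<lambda>t'. exp (4 * \<i> * k\<^sup>2 * of_real (t' - t)) *
          (- \<i> * lam * of_real ((cmod (h0 t'))\<^sup>2) * \<phi>1 t' k
           + (2 * k * h0 t' + \<i> * h1 t') * \<phi>2 t' k)) \<and>
      \<phi>2 t k = 1 + lam * integral {0..t} (\<lambda>t'.
          (2 * k * cnj (h0 t') - \<i> * cnj (h1 t')) * \<phi>1 t' k
           + \<i> * of_real ((cmod (h0 t'))\<^sup>2) * \<phi>2 t' k)" if t: "0 < t \<and> t < T" for t k
  proof -
    have tT: "t \<in> {0..T}" using t by auto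
    have sub: "s \<in> {0..T}" if "s \<in> {0..t}" for s using that t by auto
    note bd = assms(7-10)[OF sub]
    show ?thesis
      unfolding \<Phi>[OF tT, symmetric] \<phi>[OF tT, symmetric]
    proof (intro conjI)
      show "\<mu>2 0 t k $ 1 $ 2 = integral {0..t} (\<lambda>t'. exp (4 * \<i> * k\<^sup>2 * of_real (t' - t)) *
          (- \<i> * lam * of_real ((cmod (g0 t'))\<^sup>2) * \<Phi>1 t' k + (2 * k * g0 t' + \<i> * g1 t') * \<Phi>2 t' k))"
        unfolding m2.eigenfunction_volterra(1)[OF refl tT] by (rule integral_cong) (simp only: bd \<Phi>[OF sub])
      show "\<mu>2 0 t k $ 2 $ 2 = 1 + lam * integral {0..t} (\<lambda>t'.
          (2 * k * cnj (g0 t') - \<i> * cnj (g1 t')) * \<Phi>1 t' k + \<i> * of_real ((cmod (g0 t'))\<^sup>2) * \<Phi>2 t' k)"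
        unfolding m2.eigenfunction_volterra(2)[OF refl tT]
        by (rule arg_cong[where f = "\<lambda>z. 1 + lam * z"], rule integral_cong) (simp only: bd \<Phi>[OF sub])
      show "\<mu>3 L t k $ 1 $ 2 = integral {0..t} (\<lambda>t'. exp (4 * \<i> * k\<^sup>2 * of_real (t' - t)) *
          (- \<i> * lam * of_real ((cmod (h0 t'))\<^sup>2) * \<phi>1 t' k + (2 * k * h0 t' + \<i> * h1 t') * \<phi>2 t' k))"
        unfolding m3.eigenfunction_volterra(1)[OF refl tT] by (rule integral_cong) (simp only: bd \<phi>[OF sub])
      show "\<mu>3 L t k $ 2 $ 2 = 1 + lam * integral {0..t} (\<lambda>t'.
          (2 * k * cnj (h0 t') - \<i> * cnj (h1 t')) * \<phi>1 t' k + \<i> * of_real ((cmod (h0 t'))\<^sup>2) * \<phi>2 t' k)"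
        unfolding m3.eigenfunction_volterra(2)[OF refl tT]
        by (rule arg_cong[where f = "\<lambda>z. 1 + lam * z"], rule integral_cong) (simp only: bd \<phi>[OF sub])
    qed
  qed
  have data: "\<exists>b \<beta>. boundary_spectral_data L (g0 t) (g1 t) (h0 t) (h1 t) b \<beta> (\<Phi>1 t) (\<Phi>2 t) (\<phi>1 t) (\<phi>2 t)"
    if t: "0 < t \<and> t < T" for t
  proof -
    have tT: "t \<in> {0..T}" using t by auto
    obtain b \<beta> where "boundary_spectral_data L (q 0 t) (dx L q 0 t) (q L t) (dx L q L t) b \<beta>
      (\<lambda>k. \<mu>2 0 t k $ 1 $ 2) (\<lambda>k. \<mu>2 0 t k $ 2 $ 2) (\<lambda>k. \<mu>3 L t k $ 1 $ 2) (\<lambda>k. \<mu>3 L t k $ 2 $ 2)"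
      using boundary_spectral_data_of_eigenfunctions[OF assms(2,1) lam assms(4,6) m2.lax_data_axioms m3.lax_data_axioms tT] by blast
    then show ?thesis unfolding \<Phi>[OF tT] \<phi>[OF tT] assms(7-10)[OF tT, symmetric] by blast
  qed
  note left = boundary_spectral_data.boundary_values_left[OF _ assms(19)]
    and right = boundary_spectral_data.boundary_values_right[OF _ assms(19)]
  show ?thesis
  proof (intro conjI allI impI, goal_cases)
    case (1 k) show ?case using spectral[of k] by (elim conjE)
  next
    case (2 k) show ?case using spectral[of k] by (elim conjE)
  next
    case (3 k) show ?case using spectral[of k] by (elim conjE)
  next
    case (4 k) show ?case using spectral[of k] by (elim conjE)
  next
    case (5 t k) show ?case using volterra[OF 5, of k] by (elim conjE)
  next
    case (6 t k) show ?case using volterra[OF 6, of k] by (elim conjE)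
  next
    case (7 t k) show ?case using volterra[OF 7, of k] by (elim conjE)
  next
    case (8 t k) show ?case using volterra[OF 8, of k] by (elim conjE)
  next
    case (9 t) show ?case using data[OF 9] left(1) by blast
  next
    case (10 t) show ?case using data[OF 10] right(1) by blast
  next
    case (11 t) show ?case using data[OF 11] left(2) by blast
  next
    case (12 t) show ?case using data[OF 12] right(2) by blast
  qed
qed

end
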